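(* Suppose that the smoothness condition $[A_1]$ (stated in the context) holds, that $$\limsup_{n\to\infty}\frac{\alpha_n^{3/2}}{\sigma_{W_{(n)}}f(\xi_{\alpha_n})}<\infty,\qquad \limsup_{n\to\infty}\frac{\beta_n^{3/2}}{\sigma_{W_{(n)}}f(\xi_{1-\beta_n})}<\infty,$$ and that for every $B>0$, as $n\to\infty$, $$\Psi_{\alpha_n,1/f}(B)=O\left(\frac{1}{f(\xi_{\alpha_n})\ln k_n}\right),\qquad \Psi_{1-\beta_n,1/f}(B)=O\left(\frac{1}{f(\xi_{1-\beta_n})\ln m_n}\right).$$ Then there is a positive constant $C$ not depending on $n$ such that for all sufficiently large $n$ $$\sup_{x\in\mathbb R}\left|F_{T_n}(x)-\Phi(x)\right|\le C\Bigl(\frac{1}{\sqrt{k_n}}+\frac{1}{\sqrt{m_n}}\Bigr).$$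
   Context: Setting. $X_1,X_2,\dots$ are i.i.d. real-valued nondegenerate random variables with distribution function $F$; $X_{1:n}\le\dots\le X_{n:n}$ are the order statistics of $X_1,\dots,X_n$. $F^{-1}(u)=\inf\{x:F(x)\ge u\}$ for $0<u\le 1$, $F^{-1}(0)=F^{-1}(0^+)$, and $\xi_\nu=F^{-1}(\nu)$ for $0<\nu<1$. $k_n,m_n$ are sequences of integers with $0\le k_n<n-m_n\le n$ and $\min(k_n,m_n)\to\infty$ as $n\to\infty$; $\alpha_n=k_n/n$, $\beta_n=m_n/n$. The trimmed sum is $T_n=\frac1n\sum_{i=k_n+1}^{n-m_n}X_{i:n}$. Put $\mu(u,1-v)=\int_u^{1-v}F^{-1}(s)\,ds$. We write $s\vee t=\max(s,t)$, $s\wedge t=\min(s,t)$. Winsorized scale: $Q_n(u)=\xi_{\alpha_n}\vee(F^{-1}(u)\wedge\xi_{1-\beta_n})$, $\mu_{W_{(n)}}=\int_0^1Q_n(u)\,du$, $\sigma^2_{W_{(n)}}=\int_0^1(Q_n(u)-\mu_{W_{(n)}})^2du$. $\Phi$ is the standard normal distribution function and $F_{T_n}(x)=\mathbf P\bigl(\sigma_{W_{(n)}}^{-1}n^{1/2}(T_n-\mu(\alpha_n,1-\beta_n))\le x\bigr)$. Let $a_1=\liminf\alpha_n$, $a_2=\limsup\alpha_n$, $b_1=\liminf(1-\beta_n)$, $b_2=\limsup(1-\beta_n)$. Standing assumptions: $a_2<b_1$ and $\liminf_{n\to\infty}\sigma_{W_{(n)}}>0$. Condition $[A_1]$: there exist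 two open sets $U_a,U_b\subset(0,1)$ such that $F^{-1}$ is differentiable in $U=U_a\cup U_b$, i.e. the density $f=F'$ exists and is positive in $F^{-1}(U)$, and: $U_a\supset(0,\varepsilon)$ if $0=a_1=a_2$; $U_a\supset(0,a_2]$ if $0=a_1<a_2$; $U_a\supset[a_1,a_2]$ if $0<a_1\le a_2$; $U_b\supset(1-\varepsilon,1)$ if $b_1=b_2=1$; $U_b\supset[b_1,1)$ if $b_1<b_2=1$; $U_b\supset[b_1,b_2]$ if $b_1\le b_2<1$ (with some $0<\varepsilon<1$ where it occurs). For a real-valued function $h$ on $F^{-1}(U)$ and $0<B<\infty$ put $\Psi_{\alpha_n,h}(B)=\sup_{|t|\le B}\bigl|h\bigl(F^{-1}(\alpha_n+t\sqrt{\alpha_n\ln k_n/n})\bigr)-h\bigl(F^{-1}(\alpha_n)\bigr)\bigr|$, $\Psi_{1-\beta_n,h}(B)=\sup_{|t|\le B}\bigl|h\bigl(F^{-1}(1-\beta_n+t\sqrt{\beta_n\ln m_n/n})\bigr)-h\bigl(F^{-1}(1-\beta_n)\bigr)\bigr|$; $\Psi_{\cdot,1/f}$ corresponds to $h(x)=1/f(x)$. These quantities are well defined for all sufficiently large $n$. *)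

theory Defs
  imports "HOL-Probability.Probability"
begin

(* Real-valued, hence meaningful only where the infimum resp. the limit is finite: always for
   0 < u < 1, but at u = 0 and u = 1 only if the support is bounded below resp. above. The
   endpoints enter below only as null sets of integrals or through finitely many n. *)
definition quantile :: "(real \<Rightarrow> real) \<Rightarrow> real \<Rightarrow> real" where
  "quantile F u =
     (if u = 0 then Lim (at_right 0) (\<lambda>v. Inf {x. v \<le> F x}) else Inf {x. u \<le> F x})"

(* The sample is X 1, ..., X n (the index 0 is not used), and i ranges over 1, ..., n. *)
definition order_stat :: "(nat \<Rightarrow> 'a \<Rightarrow> real) \<Rightarrow> nat \<Rightarrow> nat \<Rightarrow> 'a \<Rightarrow> real" where
  "order_stat X n i \<omega> = sort (map (\<lambda>j. X j \<omega>) [1..<n + 1]) ! (i - 1)"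

definition trimmed_sum ::
    "(nat \<Rightarrow> 'a \<Rightarrow> real) \<Rightarrow> (nat \<Rightarrow> nat) \<Rightarrow> (nat \<Rightarrow> nat) \<Rightarrow> nat \<Rightarrow> 'a \<Rightarrow> real" where
  "trimmed_sum X k m n \<omega> = 1 / real n * (\<Sum>i = k n + 1..n - m n. order_stat X n i \<omega>)"

(* The trimming fractions alpha_n = k_n / n and beta_n = m_n / n. *)
definition frac_of :: "(nat \<Rightarrow> nat) \<Rightarrow> nat \<Rightarrow> real" where
  "frac_of k n = real (k n) / real n"

definition trimmed_mean :: "(real \<Rightarrow> real) \<Rightarrow> real \<Rightarrow> real \<Rightarrow> real" where
  "trimmed_mean F u v = (LBINT s=ereal u..ereal (1 - v). quantile F s)"

definition wins_quantile ::
    "(real \<Rightarrow> real) \<Rightarrow> (nat \<Rightarrow> nat) \<Rightarrow> (nat \<Rightarrow> nat) \<Rightarrow> nat \<Rightarrow> real \<Rightarrow> real" where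
  "wins_quantile F k m n u =
     max (quantile F (frac_of k n)) (min (quantile F u) (quantile F (1 - frac_of m n)))"

definition wins_mean ::
    "(real \<Rightarrow> real) \<Rightarrow> (nat \<Rightarrow> nat) \<Rightarrow> (nat \<Rightarrow> nat) \<Rightarrow> nat \<Rightarrow> real" where
  "wins_mean F k m n = (LBINT u=0..1. wins_quantile F k m n u)"

definition wins_var ::
    "(real \<Rightarrow> real) \<Rightarrow> (nat \<Rightarrow> nat) \<Rightarrow> (nat \<Rightarrow> nat) \<Rightarrow> nat \<Rightarrow> real" where
  "wins_var F k m n = (LBINT u=0..1. (wins_quantile F k m n u - wins_mean F k m n)\<^sup>2)"

definition wins_sd ::
    "(real \<Rightarrow> real) \<Rightarrow> (nat \<Rightarrow> nat) \<Rightarrow> (nat \<Rightarrow> nat) \<Rightarrow> nat \<Rightarrow> real" where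
  "wins_sd F k m n = sqrt (wins_var F k m n)"

definition trimmed_cdf ::
    "'a measure \<Rightarrow> (nat \<Rightarrow> 'a \<Rightarrow> real) \<Rightarrow> (real \<Rightarrow> real) \<Rightarrow> (nat \<Rightarrow> nat) \<Rightarrow> (nat \<Rightarrow> nat)
       \<Rightarrow> nat \<Rightarrow> real \<Rightarrow> real" where
  "trimmed_cdf M X F k m n x =
     measure M {\<omega> \<in> space M.
       inverse (wins_sd F k m n) * sqrt (real n)
         * (trimmed_sum X k m n \<omega> - trimmed_mean F (frac_of k n) (frac_of m n)) \<le> x}"

(* The library's liminf and limsup need a complete lattice; the results are converted back to
   reals, which is harmless for sequences bounded in the reals, as the trimming fractions are. *)
definition real_liminf :: "(nat \<Rightarrow> real) \<Rightarrow> real" where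
  "real_liminf a = real_of_ereal (liminf (\<lambda>n. ereal (a n)))"

definition real_limsup :: "(nat \<Rightarrow> real) \<Rightarrow> real" where
  "real_limsup a = real_of_ereal (limsup (\<lambda>n. ereal (a n)))"

definition condition_A1 :: "(real \<Rightarrow> real) \<Rightarrow> (nat \<Rightarrow> nat) \<Rightarrow> (nat \<Rightarrow> nat) \<Rightarrow> bool" where
  "condition_A1 F k m \<longleftrightarrow>
     (let a1 = real_liminf (frac_of k); a2 = real_limsup (frac_of k);
          b1 = real_liminf (\<lambda>n. 1 - frac_of m n); b2 = real_limsup (\<lambda>n. 1 - frac_of m n)
      in \<exists>Ua Ub. open Ua \<and> open Ub \<and> Ua \<subseteq> {0<..<1} \<and> Ub \<subseteq> {0<..<1} \<and>
           (\<forall>u \<in> Ua \<union> Ub. quantile F differentiable (at u)) \<and>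
           (\<forall>x \<in> quantile F ` (Ua \<union> Ub). F differentiable (at x) \<and> deriv F x > 0) \<and>
           (a1 = 0 \<and> a2 = 0 \<longrightarrow> (\<exists>\<epsilon>. 0 < \<epsilon> \<and> \<epsilon> < 1 \<and> {0<..<\<epsilon>} \<subseteq> Ua)) \<and>
           (a1 = 0 \<and> 0 < a2 \<longrightarrow> {0<..a2} \<subseteq> Ua) \<and>
           (0 < a1 \<and> a1 \<le> a2 \<longrightarrow> {a1..a2} \<subseteq> Ua) \<and>
           (b1 = 1 \<and> b2 = 1 \<longrightarrow> (\<exists>\<epsilon>. 0 < \<epsilon> \<and> \<epsilon> < 1 \<and> {1 - \<epsilon><..<1} \<subseteq> Ub)) \<and>
           (b1 < b2 \<and> b2 = 1 \<longrightarrow> {b1..<1} \<subseteq> Ub) \<and>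
           (b1 \<le> b2 \<and> b2 < 1 \<longrightarrow> {b1..b2} \<subseteq> Ub))"

(* The suprema are extended-real valued because h may be unbounded on the relevant
   neighbourhood, in which case the supremum has to be infinite. *)
definition Psi_lower ::
    "(real \<Rightarrow> real) \<Rightarrow> (nat \<Rightarrow> nat) \<Rightarrow> (real \<Rightarrow> real) \<Rightarrow> real \<Rightarrow> nat \<Rightarrow> ereal" where
  "Psi_lower F k h B n =
     (SUP t \<in> {t. \<bar>t\<bar> \<le> B}.
        ereal \<bar>h (quantile F (frac_of k n + t * sqrt (frac_of k n * ln (real (k n)) / real n)))
                - h (quantile F (frac_of k n))\<bar>)"

definition Psi_upper ::
    "(real \<Rightarrow> real) \<Rightarrow> (nat \<Rightarrow> nat) \<Rightarrow> (real \<Rightarrow> real) \<Rightarrow> real \<Rightarrow> nat \<Rightarrow> ereal" where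
  "Psi_upper F m h B n =
     (SUP t \<in> {t. \<bar>t\<bar> \<le> B}.
        ereal \<bar>h (quantile F (1 - frac_of m n + t * sqrt (frac_of m n * ln (real (m n)) / real n)))
                - h (quantile F (1 - frac_of m n))\<bar>)"

(* Big-O for a nonnegative extended-real sequence; in particular it is eventually finite. *)
definition ereal_bigo :: "(nat \<Rightarrow> ereal) \<Rightarrow> (nat \<Rightarrow> real) \<Rightarrow> bool" where
  "ereal_bigo p g \<longleftrightarrow> (\<exists>c>0. \<forall>\<^sub>F n in sequentially. p n \<le> ereal (c * \<bar>g n\<bar>))"

end

theory Submission
  imports Defs
begin

text \<open>Let \<open>W\<close> be the standardized sum of the Winsorized observations. The standardized trimmed sum is
  \<open>W + D\<^sub>u - D\<^sub>l\<close>, where the two defects \<open>D\<^sub>l\<close> and \<open>D\<^sub>u\<close> are nonnegative because the sum of the \<open>r\<close>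
  smallest observations is the maximum over \<open>c\<close> of \<open>r c - \<Sum>\<^sub>i (c - X\<^sub>i)\<^sup>+\<close>. Hence the distribution
  function lies between those of \<open>W + D\<^sub>u\<close> and \<open>W - D\<^sub>l\<close>, and each end can be treated alone.
  A defect is controlled by the excesses \<open>(S\<^sub>j - k)\<^sup>+\<close> and \<open>(k - S\<^sub>j)\<^sup>+\<close> of empirical counts at the
  points of a grid around the trimming quantile, of probability spacing \<open>sqrt k / n\<close> and reaching
  \<open>3 sqrt (ln k)\<close> steps to either side: the counts leave that range with probability \<open>O(1 / sqrt k)\<close>,
  and inside it the oscillation condition bounds the length of a step by a multiple of
  \<open>sqrt k / (n f)\<close>.
  The Chen-Shao bound for the nonlinear statistic \<open>W + D\<close> involves only \<open>E |W D|\<close> and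
  \<open>\<Sum>\<^sub>i E |\<xi>\<^sub>i (D - D\<^sub>i)|\<close>, where \<open>D\<^sub>i\<close> ignores the \<open>i\<close>-th observation, rather than the probable size
  of \<open>D\<close>, and the excesses decay exponentially along the grid; this is why no logarithm is lost.\<close>

section \<open>The solution of Stein's equation\<close>

text \<open>What sets the rate is a sup bound. A Winsorized observation equals the lower trimming
  quantile with probability \<open>\<alpha>\<close>, so that quantile lies within
  \<open>\<sigma> / sqrt \<alpha>\<close> of the Winsorized mean; after division by
  \<open>sqrt n * \<sigma>\<close> every summand of \<open>W\<close> is at most
  \<open>K = 1 / sqrt k + 1 / sqrt m\<close>. The error of the normal approximation is therefore
  measured by \<open>K\<close> alone, without third moments. The exponent \<open>3/2\<close> in the
  tail condition arises because a grid step of order \<open>sqrt k / (n f)\<close>, divided by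
  \<open>sqrt n * \<sigma>\<close>, is \<open>1 / k\<close> times
  \<open>\<alpha> powr (3/2) / (\<sigma> f)\<close>. Inside the grid a standardized defect is thus
  at most \<open>c\<close> times a sum of excesses, with \<open>c = O(1 / k)\<close>. That sum
  contributes \<open>O(sqrt k)\<close> to the product moment with \<open>W\<close> and
  \<open>O(K k)\<close> to the influences of the single observations, so both contributions are
  \<open>O(K)\<close>.\<close>

abbreviation (input) Phi :: "real \<Rightarrow> real" where
  "Phi \<equiv> cdf std_normal_distribution"

section \<open>The standard normal density and distribution function\<close>

lemma std_normal_density_even: "std_normal_density (- x) = std_normal_density x"
  by (simp add: std_normal_density_def)

lemma std_normal_density_pos: "0 < std_normal_density x"
  by (simp add: normal_density_pos)

lemma DERIV_std_normal_density:
  "(std_normal_density has_real_derivative - x * std_normal_density x) (at x)"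
proof -
  have "((\<lambda>x. exp (- x\<^sup>2 / 2)) has_real_derivative (exp (- x\<^sup>2 / 2) * (- x))) (at x)"
    by (auto intro!: derivative_eq_intros)
  from DERIV_cmult[OF this, of "1 / sqrt (2 * pi)"]
  have "((\<lambda>x. 1 / sqrt (2 * pi) * exp (- x\<^sup>2 / 2)) has_real_derivative
      1 / sqrt (2 * pi) * (exp (- x\<^sup>2 / 2) * (- x))) (at x)" .
  then show ?thesis
    by (simp add: std_normal_density_def[abs_def] mult_ac)
qed

lemma std_normal_density_le_1: "std_normal_density x \<le> 1"
proof -
  have "1 \<le> sqrt (2 * pi)" using pi_gt3 by simp
  then have "1 / sqrt (2 * pi) * exp (- x\<^sup>2 / 2) \<le> 1 * 1"
    by (intro mult_mono) auto
  then show ?thesis by (simp add: std_normal_density_def)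
qed

lemma Phi_bounds: "0 \<le> Phi x" "Phi x \<le> 1"
  using real_distribution.cdf_bounded_prob[OF real_dist_normal_dist]
    finite_borel_measure.cdf_nonneg[OF real_distribution.finite_borel_measure_M[OF real_dist_normal_dist]]
  by auto

lemma Phi_mono: "x \<le> y \<Longrightarrow> Phi x \<le> Phi y"
  using finite_borel_measure.cdf_nondecreasing[OF real_distribution.finite_borel_measure_M[OF real_dist_normal_dist]]
  by auto

lemma Phi_at_top: "(Phi \<longlongrightarrow> 1) at_top"
  using real_distribution.cdf_lim_at_top_prob[OF real_dist_normal_dist] .

lemma Phi_at_bot: "(Phi \<longlongrightarrow> 0) at_bot"
  using finite_borel_measure.cdf_lim_at_bot[OF real_distribution.finite_borel_measure_M[OF real_dist_normal_dist]] .

lemma Phi_diff: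
  assumes "a \<le> b"
  shows "Phi b - Phi a = (LBINT t=a..b. std_normal_density t)"
proof -
  interpret real_distribution std_normal_distribution by (rule real_dist_normal_dist)
  have int: "integrable lborel (\<lambda>x. indicat_real {a<..b} x * std_normal_density x)"
    using integrable_std_normal_moment[of 0]
    by (intro integrable_real_mult_indicator[where f=std_normal_density, simplified mult.commute]) auto
  have "Phi b - Phi a = measure std_normal_distribution {a<..b}"
    using assms by (cases "a = b") (auto simp: cdf_diff_eq)
  also have "\<dots> = enn2real (\<integral>\<^sup>+x. ennreal (std_normal_density x * indicator {a<..b} x) \<partial>lborel)"
    by (subst measure_def, subst emeasure_density)
       (auto simp: ennreal_mult'' ennreal_indicator)
  also have "\<dots> = (\<integral>x. std_normal_density x * indicator {a<..b} x \<partial>lborel)"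
    using int by (subst nn_integral_eq_integral) (auto simp: mult_ac)
  also have "\<dots> = (LBINT t=a..b. std_normal_density t)"
    using assms by (subst interval_integral_Ioc) (auto simp: set_lebesgue_integral_def mult_ac)
  finally show ?thesis .
qed

lemma DERIV_Phi: "(Phi has_real_derivative std_normal_density x) (at x)"
proof -
  have "((\<lambda>u. LBINT y=x-1..u. std_normal_density y) has_vector_derivative std_normal_density x)
      (at x within {x-1..x+1})"
    by (intro interval_integral_FTC2 DERIV_isCont continuous_at_imp_continuous_on ballI)
       (auto intro: DERIV_isCont DERIV_std_normal_density)
  then have "((\<lambda>u. LBINT y=x-1..u. std_normal_density y) has_real_derivative std_normal_density x)
      (at x within {x-1<..<x+1})"
    unfolding has_real_derivative_iff_has_vector_derivative
    by (rule has_vector_derivative_within_subset) auto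
  then have 1: "((\<lambda>u. LBINT y=x-1..u. std_normal_density y) has_real_derivative std_normal_density x) (at x)"
    by (subst (asm) at_within_open) auto
  have "((\<lambda>u. Phi (x - 1) + (LBINT y=x-1..u. std_normal_density y)) has_real_derivative
      0 + std_normal_density x) (at x)"
    by (intro DERIV_add 1) simp
  moreover have "\<forall>\<^sub>F u in nhds x. Phi u = Phi (x - 1) + (LBINT y=x-1..u. std_normal_density y)"
    by (rule eventually_mono[OF eventually_nhds_in_open[of "{x-1<..}" x]])
       (auto simp: Phi_diff[symmetric])
  ultimately show ?thesis
    by (subst DERIV_cong_ev[OF refl _ refl]) auto
qed

text \<open>The density is even, so \<open>Phi (- x) + Phi x\<close> has derivative 0; the constant
  is read off at infinity.\<close>

lemma Phi_minus: "Phi (- x) = 1 - Phi x"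
proof -
  have "((\<lambda>x. Phi (- x) + Phi x) has_real_derivative 0) (at y)" for y
    by (rule derivative_eq_intros DERIV_chain2[OF DERIV_Phi] DERIV_Phi refl)+
       (simp add: std_normal_density_even)
  then have c: "Phi (- x) + Phi x = Phi (- y) + Phi y" for y
    using DERIV_isconst_all[of "\<lambda>x. Phi (- x) + Phi x"] by blast
  have "((\<lambda>y. Phi (- y) + Phi y) \<longlongrightarrow> 0 + 1) at_top"
    by (intro tendsto_add Phi_at_top filterlim_compose[OF Phi_at_bot] filterlim_uminus_at_bot_at_top)
  moreover have "(\<lambda>y. Phi (- y) + Phi y) = (\<lambda>y. Phi (- x) + Phi x)"
    by (rule ext) (rule c[symmetric])
  ultimately have "((\<lambda>y. Phi (- x) + Phi x) \<longlongrightarrow> 1) (at_top :: real filter)"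
    by simp
  then show ?thesis
    by (simp add: tendsto_const_iff)
qed

text \<open>The Mills ratio. Both branches of Stein's solution are multiples of it, and the bounds
  on that solution reduce to \<open>mills \<bar>w\<bar>\<close>.\<close>

definition mills :: "real \<Rightarrow> real" where
  "mills w = (1 - Phi w) / std_normal_density w"

lemma DERIV_mills: "(mills has_real_derivative w * mills w - 1) (at w)"
  unfolding mills_def[abs_def] using std_normal_density_pos[of w]
  by (auto intro!: derivative_eq_intros DERIV_Phi DERIV_std_normal_density
           simp: field_simps power2_eq_square less_imp_neq[THEN not_sym])

lemma mills_nonneg: "0 \<le> mills w"
  using std_normal_density_pos[of w] Phi_bounds[of w] by (simp add: mills_def)

text \<open>The density over \<open>t\<close> minus the normal tail, \<open>h t\<close>, has
  derivative minus the density over \<open>t^2\<close> and vanishes at infinity; a nonincreasing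
  function with limit 0 is nonnegative.\<close>

lemma mult_mills_le_1:
  assumes "0 \<le> w"
  shows "w * mills w \<le> 1"
proof (cases "w = 0")
  case False
  with assms have w: "w > 0" by simp
  define h where "h t = std_normal_density t / t - (1 - Phi t)" for t
  have "((\<lambda>t. std_normal_density t / t - (1 - Phi t)) \<longlongrightarrow> 0 - (1 - 1)) at_top"
  proof (intro tendsto_diff tendsto_const Phi_at_top)
    have "\<forall>\<^sub>F t in at_top. norm (std_normal_density t / t) \<le> 1 / t"
      using eventually_gt_at_top[of 0]
      by eventually_elim (simp add: std_normal_density_le_1 divide_right_mono abs_mult less_imp_le)
    then show "((\<lambda>t. std_normal_density t / t) \<longlongrightarrow> 0) at_top"
      by (rule Lim_null_comparison) (intro tendsto_divide_0[OF tendsto_const] filterlim_ident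
          filterlim_at_top_imp_at_infinity)
  qed
  then have lim: "(h \<longlongrightarrow> 0) at_top" by (simp add: h_def[abs_def])
  have "0 \<le> h w"
  proof (rule tendsto_upperbound[OF lim])
    show "\<forall>\<^sub>F t in at_top. h t \<le> h w"
      using eventually_ge_at_top[of w]
    proof eventually_elim
      case (elim t)
      show ?case
      proof (rule DERIV_nonpos_imp_nonincreasing[OF elim])
        fix s assume s: "w \<le> s" "s \<le> t"
        then have "(h has_real_derivative
            ((- s * std_normal_density s) * s - std_normal_density s * 1) / (s * s)
              - (0 - std_normal_density s)) (at s)"
          unfolding h_def[abs_def] using w
          by (intro DERIV_diff DERIV_divide DERIV_const DERIV_ident DERIV_Phi DERIV_std_normal_density) auto
        also have "((- s * std_normal_density s) * s - std_normal_density s * 1) / (s * s)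
              - (0 - std_normal_density s) = - std_normal_density s / s\<^sup>2"
          using s w by (simp add: field_simps power2_eq_square)
        finally show "\<exists>y. (h has_real_derivative y) (at s) \<and> y \<le> 0"
          using std_normal_density_pos[of s] by (auto intro!: exI[of _ "- std_normal_density s / s\<^sup>2"])
      qed
    qed
  qed simp
  then have "1 - Phi w \<le> std_normal_density w / w"
    by (simp add: h_def)
  then show ?thesis
    using w std_normal_density_pos[of w] by (simp add: mills_def field_simps)
qed simp

text \<open>The derivative \<open>w * mills w - 1\<close> is nonpositive on the half line by the
  previous bound, so the maximum is at 0; there \<open>Phi 0 \<ge> 0\<close> and
  \<open>2 * pi \<le> 9\<close> give a rough constant.\<close>

lemma mills_le_3:
  assumes "0 \<le> w"
  shows "mills w \<le> 3"
proof -
  have "mills w \<le> mills 0"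
  proof (rule DERIV_nonpos_imp_nonincreasing[OF assms])
    fix x :: real assume "0 \<le> x" "x \<le> w"
    then show "\<exists>y. (mills has_real_derivative y) (at x) \<and> y \<le> 0"
      using DERIV_mills[of x] mult_mills_le_1[of x] by force
  qed
  also have "mills 0 \<le> sqrt (2 * pi)"
    using Phi_bounds[of 0] by (simp add: mills_def std_normal_density_def mult_left_le_one_le)
  also have "\<dots> \<le> 3"
    using pi_less_4 by (intro real_le_lsqrt) auto
  finally show ?thesis .
qed

text \<open>The bounded solution of Stein's equation
  \<open>f' w - w * f w = indicator {..z} w - Phi z\<close>. Its branches meet continuously at
  \<open>z\<close>, with a kink there.\<close>

definition stein :: "real \<Rightarrow> real \<Rightarrow> real" where
  "stein z w = (if w \<le> z then mills (- w) * (1 - Phi z) else mills w * Phi z)"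

lemma mills_minus: "mills (- w) = Phi w / std_normal_density w"
  by (simp add: mills_def Phi_minus std_normal_density_even)

lemma stein_at: "stein z z = mills z * Phi z"
  by (simp add: stein_def mills_minus) (simp add: mills_def)

text \<open>Monotonicity of \<open>Phi\<close> shows that the branch in force on either side of
  \<open>z\<close> is dominated by both \<open>mills w\<close> and \<open>mills (- w)\<close>, hence
  by the one with nonnegative argument.\<close>

lemma stein_le_mills: "0 \<le> stein z w" "stein z w \<le> mills \<bar>w\<bar>"
proof -
  have d: "0 < std_normal_density w" by (rule std_normal_density_pos)
  have 1: "mills (- w) * (1 - Phi z) \<le> mills w" if "w \<le> z"
  proof -
    have "Phi w * (1 - Phi z) \<le> 1 * (1 - Phi w)"
      using Phi_mono[OF that] Phi_bounds[of w] Phi_bounds[of z] by (intro mult_mono) auto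
    then show ?thesis using d by (simp add: mills_minus mills_def[of w] divide_right_mono)
  qed
  have 2: "mills w * Phi z \<le> mills (- w)" if "z \<le> w"
  proof -
    have "(1 - Phi w) * Phi z \<le> 1 * Phi w"
      using Phi_mono[OF that] Phi_bounds[of w] Phi_bounds[of z] by (intro mult_mono) auto
    then show ?thesis using d by (simp add: mills_minus mills_def[of w] divide_right_mono)
  qed
  have 3: "a * Phi z \<le> a" "a * (1 - Phi z) \<le> a" if "0 \<le> a" for a
    using that Phi_bounds[of z] by (auto intro: mult_left_le)
  show "0 \<le> stein z w"
    using mills_nonneg Phi_bounds[of z] by (auto simp: stein_def)
  show "stein z w \<le> mills \<bar>w\<bar>"
    using 1 2 3 mills_nonneg by (auto simp: stein_def abs_if)
qed

lemma stein_le_3: "stein z w \<le> 3"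
  using stein_le_mills[of z w] mills_le_3[of "\<bar>w\<bar>"] by simp

lemma abs_stein_le_3: "\<bar>stein z w\<bar> \<le> 3"
  using stein_le_mills(1)[of z w] stein_le_3[of z w] by simp

lemma abs_mult_stein_le_1: "\<bar>w * stein z w\<bar> \<le> 1"
proof -
  have "\<bar>w * stein z w\<bar> \<le> \<bar>w\<bar> * mills \<bar>w\<bar>"
    using stein_le_mills[of z w] by (simp add: abs_mult mult_left_mono)
  also have "\<dots> \<le> 1" by (rule mult_mills_le_1) simp
  finally show ?thesis .
qed

text \<open>Defined through Stein's equation rather than as a derivative: it then has a value at the
  kink and the equation holds everywhere. Off \<open>z\<close> it is the derivative of
  \<open>stein z\<close>.\<close>

definition stein' :: "real \<Rightarrow> real \<Rightarrow> real" where
  "stein' z w = w * stein z w + indicator {..z} w - Phi z"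

lemma abs_stein'_le_2: "\<bar>stein' z w\<bar> \<le> 2"
  using abs_mult_stein_le_1[of w z] Phi_bounds[of z]
  by (auto simp: stein'_def indicator_def abs_le_iff)

lemma DERIV_stein_pieces:
  "((\<lambda>w. mills (- w) * (1 - Phi z)) has_real_derivative
      w * (mills (- w) * (1 - Phi z)) + 1 - Phi z) (at w)"
  "((\<lambda>w. mills w * Phi z) has_real_derivative w * (mills w * Phi z) - Phi z) (at w)"
proof -
  have "((\<lambda>w. mills (- w)) has_real_derivative ((- w) * mills (- w) - 1) * - 1) (at w)"
    by (rule DERIV_chain2[OF DERIV_mills]) (auto intro!: derivative_eq_intros)
  from DERIV_cmult_right[OF this, of "1 - Phi z"]
  show "((\<lambda>w. mills (- w) * (1 - Phi z)) has_real_derivative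
      w * (mills (- w) * (1 - Phi z)) + 1 - Phi z) (at w)"
    by (simp add: algebra_simps)
  from DERIV_cmult_right[OF DERIV_mills, of "Phi z" w]
  show "((\<lambda>w. mills w * Phi z) has_real_derivative w * (mills w * Phi z) - Phi z) (at w)"
    by (simp add: algebra_simps)
qed

lemma DERIV_stein:
  assumes "w \<noteq> z"
  shows "(stein z has_real_derivative stein' z w) (at w)"
proof (cases "w < z")
  case True
  have "\<forall>\<^sub>F x in nhds w. stein z x = mills (- x) * (1 - Phi z)"
    by (rule eventually_mono[OF eventually_nhds_in_open[of "{..<z}" w]])
       (use True in \<open>auto simp: stein_def\<close>)
  then have "(stein z has_real_derivative w * (mills (- w) * (1 - Phi z)) + 1 - Phi z) (at w)"
    by (subst DERIV_cong_ev[OF refl _ refl]) (auto intro: DERIV_stein_pieces)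
  then show ?thesis using True by (simp add: stein'_def stein_def)
next
  case False
  with assms have *: "z < w" by simp
  have "\<forall>\<^sub>F x in nhds w. stein z x = mills x * Phi z"
    by (rule eventually_mono[OF eventually_nhds_in_open[of "{z<..}" w]])
       (use * in \<open>auto simp: stein_def\<close>)
  then have "(stein z has_real_derivative w * (mills w * Phi z) - Phi z) (at w)"
    by (subst DERIV_cong_ev[OF refl _ refl]) (auto intro: DERIV_stein_pieces)
  then show ?thesis using * by (simp add: stein'_def stein_def)
qed

lemma continuous_on_stein: "continuous_on UNIV (stein z)"
proof -
  have cm: "continuous_on S mills" for S
    by (intro continuous_at_imp_continuous_on ballI DERIV_isCont[OF DERIV_mills])
  have "continuous_on ({..z} \<union> {z..}) (\<lambda>w. if w \<le> z then mills (- w) * (1 - Phi z) else mills w * Phi z)"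
    using stein_at[of z]
    by (intro continuous_on_If continuous_intros continuous_on_compose2[OF cm[of UNIV]])
       (auto simp: stein_def)
  moreover have "{..z} \<union> {z..} = UNIV" by auto
  ultimately show ?thesis
    by (simp add: stein_def[abs_def])
qed

lemma measurable_stein[measurable]: "stein z \<in> borel_measurable borel"
  by (intro borel_measurable_continuous_onI continuous_on_stein)

lemma measurable_stein'[measurable]: "stein' z \<in> borel_measurable borel"
  unfolding stein'_def[abs_def] by measurable

text \<open>Only the open interval has to avoid the kink: at an endpoint, continuity of
  \<open>stein z\<close> suffices for the mean value theorem.\<close>

lemma stein_MVT:
  assumes "a < b" "z \<notin> {a<..<b}"
  obtains t where "a < t" "t < b" "stein z b - stein z a = (b - a) * stein' z t"
proof -
  have "\<exists>l t. a < t \<and> t < b \<and> (stein z has_real_derivative l) (at t) \<and> stein z b - stein z a = (b - a) * l"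
    using assms
    by (intro MVT continuous_on_subset[OF continuous_on_stein])
       (auto simp: real_differentiable_def intro!: exI DERIV_stein)
  then obtain l t where "a < t" "t < b" "(stein z has_real_derivative l) (at t)"
    "stein z b - stein z a = (b - a) * l" by blast
  moreover have "l = stein' z t"
    using calculation assms by (intro DERIV_unique[OF _ DERIV_stein]) auto
  ultimately show ?thesis using that by blast
qed

text \<open>The derivative is bounded by 2 on each side of the kink, and an interval containing
  \<open>z\<close> is cut there.\<close>

lemma stein_lipschitz: "\<bar>stein z x - stein z y\<bar> \<le> 2 * \<bar>x - y\<bar>"
proof -
  have 1: "\<bar>stein z b - stein z a\<bar> \<le> 2 * (b - a)" if ab: "a \<le> b" "z \<notin> {a<..<b}" for a b
  proof (cases "a = b")
    case False
    with ab obtain t where "stein z b - stein z a = (b - a) * stein' z t"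
      using stein_MVT[of a b z] by auto
    then show ?thesis
      using ab mult_right_mono[OF abs_stein'_le_2[of z t], of "b - a"] by (simp add: abs_mult mult_ac)
  qed simp
  have 2: "\<bar>stein z b - stein z a\<bar> \<le> 2 * (b - a)" if ab: "a \<le> b" for a b
  proof (cases "z \<in> {a<..<b}")
    case True
    then show ?thesis using 1[of a z] 1[of z b] by auto
  qed (use 1 ab in auto)
  show ?thesis
    using 2[of x y] 2[of y x] by (cases "x \<le> y") (auto simp: abs_minus_commute)
qed

lemma mult_stein_diff:
  "\<bar>(w + x) * stein z (w + x) - w * stein z w\<bar> \<le> \<bar>x\<bar> * (3 + 2 * \<bar>w\<bar>)"
proof -
  have "(w + x) * stein z (w + x) - w * stein z w
      = x * stein z (w + x) + w * (stein z (w + x) - stein z w)"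
    by (simp add: algebra_simps)
  also have "\<bar>\<dots>\<bar> \<le> \<bar>x\<bar> * \<bar>stein z (w + x)\<bar> + \<bar>w\<bar> * \<bar>stein z (w + x) - stein z w\<bar>"
    by (metis abs_mult abs_triangle_ineq)
  also have "\<dots> \<le> \<bar>x\<bar> * 3 + \<bar>w\<bar> * (2 * \<bar>x\<bar>)"
    using stein_lipschitz[of z "w + x" w]
    by (intro add_mono mult_left_mono abs_stein_le_3) auto
  finally show ?thesis by (simp add: algebra_simps)
qed

text \<open>The jump of the indicator in Stein's equation is felt only when \<open>z\<close>
  separates the two arguments, hence lies within \<open>\<bar>x\<bar>\<close> of \<open>w\<close>;
  the remaining part has increments controlled by \<open>mult_stein_diff\<close>.\<close>

lemma stein'_diff:
  "\<bar>stein' z (w + x) - stein' z w\<bar> \<le> \<bar>x\<bar> * (3 + 2 * \<bar>w\<bar>) + indicator {u. \<bar>u - z\<bar> \<le> \<bar>x\<bar>} w"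
proof -
  have "\<bar>indicator {..z} (w + x) - indicator {..z} w\<bar> \<le> (indicator {u. \<bar>u - z\<bar> \<le> \<bar>x\<bar>} w :: real)"
    by (auto simp: indicator_def)
  moreover have "stein' z (w + x) - stein' z w
      = ((w + x) * stein z (w + x) - w * stein z w) + (indicator {..z} (w + x) - indicator {..z} w)"
    by (simp add: stein'_def)
  ultimately show ?thesis
    using mult_stein_diff[of w x z]
      abs_triangle_ineq[of "(w + x) * stein z (w + x) - w * stein z w" "indicator {..z} (w + x) - indicator {..z} w"]
    by linarith
qed

text \<open>Across the kink there is no second-order remainder. Near it the increment and the linear
  term are each at most \<open>2 * \<bar>x\<bar>\<close>, which leaves a first-order error on the
  event that \<open>w\<close> is close to \<open>z\<close>; the concentration inequality will make
  this event improbable.\<close>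

lemma stein_taylor:
  "\<bar>stein z (w + x) - stein z w - x * stein' z w\<bar>
     \<le> x\<^sup>2 * (3 + 2 * \<bar>w\<bar>) + 4 * \<bar>x\<bar> * indicator {u. \<bar>u - z\<bar> \<le> \<bar>x\<bar>} w"
proof (cases "\<bar>w - z\<bar> \<le> \<bar>x\<bar>")
  case True
  have "\<bar>x * stein' z w\<bar> \<le> \<bar>x\<bar> * 2"
    using abs_stein'_le_2[of z w] by (simp add: abs_mult mult_left_mono)
  moreover have "\<bar>stein z (w + x) - stein z w\<bar> \<le> 2 * \<bar>x\<bar>"
    using stein_lipschitz[of z "w + x" w] by simp
  ultimately have "\<bar>stein z (w + x) - stein z w - x * stein' z w\<bar> \<le> 4 * \<bar>x\<bar>"
    by linarith
  also have "4 * \<bar>x\<bar> = 0 + 4 * \<bar>x\<bar> * indicator {u. \<bar>u - z\<bar> \<le> \<bar>x\<bar>} w"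
    using True by (simp only: indicator_simps mem_Collect_eq mult_1_right add_0)
  also have "\<dots> \<le> x\<^sup>2 * (3 + 2 * \<bar>w\<bar>) + 4 * \<bar>x\<bar> * indicator {u. \<bar>u - z\<bar> \<le> \<bar>x\<bar>} w"
    by (intro add_right_mono mult_nonneg_nonneg zero_le_power2) simp
  finally show ?thesis .
next
  case False
  show ?thesis
  proof (cases "x = 0")
    case x: False
    obtain t where t: "\<bar>t - w\<bar> \<le> \<bar>x\<bar>" "stein z (w + x) - stein z w = x * stein' z t"
    proof (cases "x > 0")
      case True
      then have "w < w + x" "z \<notin> {w<..<w + x}" using False by auto
      then obtain t where t: "w < t" "t < w + x" "stein z (w + x) - stein z w = (w + x - w) * stein' z t"
        by (rule stein_MVT)
      show ?thesis
      proof (rule that)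
        show "stein z (w + x) - stein z w = x * stein' z t" using t(3) by simp
      qed (use t in auto)
next
      case neg: False
      then have "w + x < w" "z \<notin> {w + x<..<w}" using False x by auto
      then obtain t where t: "w + x < t" "t < w" "stein z w - stein z (w + x) = (w - (w + x)) * stein' z t"
        by (rule stein_MVT)
      show ?thesis
      proof (rule that)
        show "stein z (w + x) - stein z w = x * stein' z t" using t(3) by (simp add: algebra_simps)
      qed (use t in auto)
    qed
    define y where "y = t - w"
    have y: "\<bar>y\<bar> \<le> \<bar>x\<bar>" "t = w + y" using t by (auto simp: y_def)
    \<comment> \<open>\<open>y\<close> is no longer than \<open>x\<close>, so \<open>z\<close> is
      out of its reach as well and the indicator vanishes.\<close>
    have "\<bar>stein' z (w + y) - stein' z w\<bar> \<le> \<bar>y\<bar> * (3 + 2 * \<bar>w\<bar>)"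
      using stein'_diff[of z w y] False y by (simp add: indicator_def)
    also have "\<dots> \<le> \<bar>x\<bar> * (3 + 2 * \<bar>w\<bar>)" using y by (intro mult_right_mono) auto
    finally have "\<bar>x\<bar> * \<bar>stein' z t - stein' z w\<bar> \<le> \<bar>x\<bar> * (\<bar>x\<bar> * (3 + 2 * \<bar>w\<bar>))"
      using y by (intro mult_left_mono) auto
    moreover have "stein z (w + x) - stein z w - x * stein' z w = x * (stein' z t - stein' z w)"
      unfolding t(2) by (simp only: right_diff_distrib)
    moreover have "\<bar>x\<bar> * (\<bar>x\<bar> * (3 + 2 * \<bar>w\<bar>)) = x\<^sup>2 * (3 + 2 * \<bar>w\<bar>)"
      by (simp only: mult.assoc[symmetric] abs_mult_self_eq power2_eq_square)
    moreover have "indicator {u. \<bar>u - z\<bar> \<le> \<bar>x\<bar>} w = (0 :: real)"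
      using False by simp
    ultimately show ?thesis by (simp only: abs_mult mult_zero_right add_0_right)
  qed simp
qed

section \<open>Sums of independent bounded variables\<close>

context prob_space
begin

text \<open>The normal approximation only takes expectations of functions of clipped observations
  and of counts. Boundedness on the whole space can therefore stand for integrability; unlike the
  latter it is closed under products.\<close>

definition bounded_rv :: "('a \<Rightarrow> real) \<Rightarrow> bool" where
  "bounded_rv f \<longleftrightarrow> f \<in> borel_measurable M \<and> (\<exists>B. \<forall>\<omega>\<in>space M. \<bar>f \<omega>\<bar> \<le> B)"

lemma bounded_rvI:
  "f \<in> borel_measurable M \<Longrightarrow> (\<And>\<omega>. \<omega> \<in> space M \<Longrightarrow> \<bar>f \<omega>\<bar> \<le> B) \<Longrightarrow> bounded_rv f"
  by (auto simp: bounded_rv_def)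

lemma bounded_rv_measurable: "bounded_rv f \<Longrightarrow> f \<in> borel_measurable M"
  by (simp add: bounded_rv_def)

lemma bounded_rv_integrable: "bounded_rv f \<Longrightarrow> integrable M f"
  unfolding bounded_rv_def by (elim conjE exE) (rule integrable_const_bound, auto)

lemma bounded_rv_const: "bounded_rv (\<lambda>_. c)"
  by (auto intro: bounded_rvI)

lemma bounded_rv_add: "bounded_rv f \<Longrightarrow> bounded_rv g \<Longrightarrow> bounded_rv (\<lambda>x. f x + g x)"
  unfolding bounded_rv_def
  by (auto intro!: borel_measurable_add) (metis abs_triangle_ineq add_mono order_trans)

lemma bounded_rv_mult: "bounded_rv f \<Longrightarrow> bounded_rv g \<Longrightarrow> bounded_rv (\<lambda>x. f x * g x)"
proof -
  assume "bounded_rv f" "bounded_rv g"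
  then obtain A B where fg: "f \<in> borel_measurable M" "g \<in> borel_measurable M"
    and A: "\<And>x. x \<in> space M \<Longrightarrow> \<bar>f x\<bar> \<le> A" and B: "\<And>x. x \<in> space M \<Longrightarrow> \<bar>g x\<bar> \<le> B"
    unfolding bounded_rv_def by auto
  show ?thesis
  proof (rule bounded_rvI)
    fix x assume x: "x \<in> space M"
    show "\<bar>f x * g x\<bar> \<le> A * B"
      unfolding abs_mult using A[OF x] B[OF x] by (intro mult_mono) auto
  qed (use fg in measurable)
qed

lemma bounded_rv_uminus: "bounded_rv f \<Longrightarrow> bounded_rv (\<lambda>x. - f x)"
  by (auto simp: bounded_rv_def)

lemma bounded_rv_diff: "bounded_rv f \<Longrightarrow> bounded_rv g \<Longrightarrow> bounded_rv (\<lambda>x. f x - g x)"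
  using bounded_rv_add[OF _ bounded_rv_uminus[of g]] by simp

lemma bounded_rv_abs: "bounded_rv f \<Longrightarrow> bounded_rv (\<lambda>x. \<bar>f x\<bar>)"
  by (auto simp: bounded_rv_def)

lemma bounded_rv_power2: "bounded_rv f \<Longrightarrow> bounded_rv (\<lambda>x. (f x)\<^sup>2)"
  unfolding power2_eq_square by (rule bounded_rv_mult)

lemma bounded_rv_sum: "(\<And>i. i \<in> J \<Longrightarrow> bounded_rv (f i)) \<Longrightarrow> bounded_rv (\<lambda>x. \<Sum>i\<in>J. f i x)"
  by (induction J rule: infinite_finite_induct) (auto intro: bounded_rv_add bounded_rv_const)

lemma bounded_rv_compose:
  assumes "bounded_rv f" "g \<in> borel_measurable borel" "\<And>x. \<bar>g x\<bar> \<le> B"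
  shows "bounded_rv (\<lambda>x. g (f x))"
  by (rule bounded_rvI[OF measurable_compose[OF bounded_rv_measurable[OF assms(1)] assms(2)] assms(3)])

lemma bounded_rv_divide: "bounded_rv f \<Longrightarrow> bounded_rv (\<lambda>x. f x / c)"
  unfolding divide_inverse by (intro bounded_rv_mult bounded_rv_const)

lemmas bounded_rv_intros = bounded_rv_divide bounded_rv_const bounded_rv_add bounded_rv_mult bounded_rv_uminus
  bounded_rv_diff bounded_rv_abs bounded_rv_power2 bounded_rv_sum

lemma expectation_mono_bounded:
  assumes "bounded_rv f" "bounded_rv g" "\<And>x. x \<in> space M \<Longrightarrow> f x \<le> g x"
  shows "expectation f \<le> expectation g"
  using assms by (intro integral_mono bounded_rv_integrable)

lemma expectation_sum_bounded:
  assumes "\<And>i. i \<in> J \<Longrightarrow> bounded_rv (f i)"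
  shows "expectation (\<lambda>x. \<Sum>i\<in>J. f i x) = (\<Sum>i\<in>J. expectation (f i))"
  using assms by (intro Bochner_Integration.integral_sum bounded_rv_integrable)

lemma expectation_add_bounded:
  "bounded_rv f \<Longrightarrow> bounded_rv g \<Longrightarrow> expectation (\<lambda>x. f x + g x) = expectation f + expectation g"
  by (intro Bochner_Integration.integral_add bounded_rv_integrable)

lemma expectation_diff_bounded:
  "bounded_rv f \<Longrightarrow> bounded_rv g \<Longrightarrow> expectation (\<lambda>x. f x - g x) = expectation f - expectation g"
  by (intro Bochner_Integration.integral_diff bounded_rv_integrable)

lemma abs_expectation_le:
  assumes "bounded_rv f" "bounded_rv g" "\<And>x. x \<in> space M \<Longrightarrow> \<bar>f x\<bar> \<le> g x"
  shows "\<bar>expectation f\<bar> \<le> expectation g"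
proof -
  have "expectation f \<le> expectation g"
    using assms by (intro expectation_mono_bounded) (auto simp: abs_le_iff)
  moreover have "expectation (\<lambda>x. - f x) \<le> expectation g"
    using assms by (intro expectation_mono_bounded bounded_rv_intros) (auto simp: abs_le_iff)
  ultimately show ?thesis by simp
qed

lemma prob_eq_expectation_indicator:
  assumes [measurable]: "Measurable.pred M P"
  shows "prob {x \<in> space M. P x} = expectation (\<lambda>x. indicator {x. P x} x)"
proof -
  have "expectation (\<lambda>x. indicator {x. P x} x :: real) = expectation (indicator {x \<in> space M. P x})"
    by (intro Bochner_Integration.integral_cong) (auto simp: indicator_def)
  then show ?thesis by simp
qed

lemma bounded_rv_indicator:
  "Measurable.pred M P \<Longrightarrow> bounded_rv (\<lambda>x. indicator {x. P x} x)"
  by (rule bounded_rvI[where B=1]) (auto simp: indicator_def)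

text \<open>Reduces independence of one observation from a statistic of the others to measurability
  of that statistic as a function of the restricted family.\<close>

lemma indep_var_rest:
  assumes "indep_vars (\<lambda>_. N) X I" "i \<in> I" "f \<in> measurable N N1" "g \<in> measurable (PiM (I - {i}) (\<lambda>_. N)) N2"
  shows "indep_var N1 (\<lambda>\<omega>. f (X i \<omega>)) N2 (\<lambda>\<omega>. g (\<lambda>j\<in>I-{i}. X j \<omega>))"
proof -
  have "indep_var (PiM {i} (\<lambda>_. N)) (\<lambda>\<omega>. \<lambda>j\<in>{i}. X j \<omega>) (PiM (I-{i}) (\<lambda>_. N)) (\<lambda>\<omega>. \<lambda>j\<in>I-{i}. X j \<omega>)"
    using assms(2) by (intro indep_var_restrict[OF assms(1)]) auto
  then have "indep_var N1 ((\<lambda>x. f (x i)) \<circ> (\<lambda>\<omega>. \<lambda>j\<in>{i}. X j \<omega>)) N2 (g \<circ> (\<lambda>\<omega>. \<lambda>j\<in>I-{i}. X j \<omega>))"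
    using assms(3,4) by (intro indep_var_compose) (auto intro!: measurable_compose[OF measurable_component_singleton])
  then show ?thesis by (simp add: comp_def)
qed

text \<open>The square is split into the terms \<open>Z i\<close> times \<open>Z i\<close> and
  \<open>Z i\<close> times the sum of the others; the latter has expectation 0, since that sum is
  independent of the centred \<open>Z i\<close>.\<close>

lemma expectation_square_sum:
  assumes I: "finite I" "indep_vars (\<lambda>_. borel) Z I"
    and Z: "\<And>i. i \<in> I \<Longrightarrow> bounded_rv (Z i)" "\<And>i. i \<in> I \<Longrightarrow> expectation (Z i) = 0"
  shows "expectation (\<lambda>\<omega>. (\<Sum>i\<in>I. Z i \<omega>)\<^sup>2) = (\<Sum>i\<in>I. expectation (\<lambda>\<omega>. (Z i \<omega>)\<^sup>2))"
proof -
  have b: "bounded_rv (\<lambda>\<omega>. \<Sum>j\<in>I-{i}. Z j \<omega>)" for i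
    using Z by (intro bounded_rv_intros) auto
  have "(\<lambda>\<omega>. (\<Sum>i\<in>I. Z i \<omega>)\<^sup>2) = (\<lambda>\<omega>. \<Sum>i\<in>I. (Z i \<omega>)\<^sup>2 + Z i \<omega> * (\<Sum>j\<in>I-{i}. Z j \<omega>))"
    using I(1) by (auto simp: power2_eq_square sum_distrib_right sum.remove algebra_simps intro!: sum.cong)
  then have "expectation (\<lambda>\<omega>. (\<Sum>i\<in>I. Z i \<omega>)\<^sup>2)
      = (\<Sum>i\<in>I. expectation (\<lambda>\<omega>. (Z i \<omega>)\<^sup>2 + Z i \<omega> * (\<Sum>j\<in>I-{i}. Z j \<omega>)))"
    using Z b by (simp add: expectation_sum_bounded bounded_rv_intros)
  also have "\<dots> = (\<Sum>i\<in>I. expectation (\<lambda>\<omega>. (Z i \<omega>)\<^sup>2))"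
  proof (rule sum.cong[OF refl])
    fix i assume i: "i \<in> I"
    have "indep_var borel (Z i) borel (\<lambda>\<omega>. \<Sum>j\<in>I-{i}. Z j \<omega>)"
      using indep_vars_sum[of "I - {i}" i Z] I i by (simp add: insert_absorb)
    then have "expectation (\<lambda>\<omega>. Z i \<omega> * (\<Sum>j\<in>I-{i}. Z j \<omega>)) = 0"
      using Z i b by (subst indep_var_lebesgue_integral) (auto intro: bounded_rv_integrable)
    then show "expectation (\<lambda>\<omega>. (Z i \<omega>)\<^sup>2 + Z i \<omega> * (\<Sum>j\<in>I-{i}. Z j \<omega>)) = expectation (\<lambda>\<omega>. (Z i \<omega>)\<^sup>2)"
      using Z i b by (subst expectation_add_bounded) (auto intro: bounded_rv_intros)
  qed
  finally show ?thesis .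
qed

end

text \<open>The variances sum to 1 and every summand is at most \<open>K\<close>, so the third
  absolute moments sum to at most \<open>K\<close>: \<open>K\<close> takes the place of the usual
  Berry-Esseen ratio.\<close>

locale standardized_sum = prob_space M for M :: "'a measure" +
  fixes I :: "'i set" and xi :: "'i \<Rightarrow> 'a \<Rightarrow> real" and K :: real
  assumes fin: "finite I"
    and indep: "indep_vars (\<lambda>_. borel) xi I"
    and xi_le: "\<And>i \<omega>. i \<in> I \<Longrightarrow> \<omega> \<in> space M \<Longrightarrow> \<bar>xi i \<omega>\<bar> \<le> K"
    and mean_xi: "\<And>i. i \<in> I \<Longrightarrow> expectation (xi i) = 0"
    and var_sum: "(\<Sum>i\<in>I. expectation (\<lambda>\<omega>. (xi i \<omega>)\<^sup>2)) = 1"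
begin

definition W :: "'a \<Rightarrow> real" where "W \<omega> = (\<Sum>i\<in>I. xi i \<omega>)"

definition W_without :: "'i \<Rightarrow> 'a \<Rightarrow> real" where "W_without i \<omega> = (\<Sum>j\<in>I-{i}. xi j \<omega>)"

lemma xi_measurable: "i \<in> I \<Longrightarrow> xi i \<in> borel_measurable M"
  using indep by (simp add: indep_vars_def2)

lemma bounded_xi: "i \<in> I \<Longrightarrow> bounded_rv (xi i)"
  by (rule bounded_rvI[OF xi_measurable xi_le])

lemma bounded_W: "bounded_rv W"
  unfolding W_def[abs_def] by (intro bounded_rv_intros bounded_xi)

lemma bounded_W_without: "bounded_rv (W_without i)"
  unfolding W_without_def[abs_def] by (intro bounded_rv_intros bounded_xi) auto

lemma measurable_W[measurable]: "W \<in> borel_measurable M"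
  by (rule bounded_rv_measurable[OF bounded_W])

lemma measurable_W_without[measurable]: "W_without i \<in> borel_measurable M"
  by (rule bounded_rv_measurable[OF bounded_W_without])

lemma W_eq: "i \<in> I \<Longrightarrow> W \<omega> = W_without i \<omega> + xi i \<omega>"
  using fin by (simp add: W_def W_without_def sum.remove)

lemma K_pos: "0 < K"
proof (rule ccontr)
  assume "\<not> 0 < K"
  then have "xi i \<omega> = 0" if "i \<in> I" "\<omega> \<in> space M" for i \<omega> using xi_le[OF that] by auto
  then have "(\<Sum>i\<in>I. expectation (\<lambda>\<omega>. (xi i \<omega>)\<^sup>2)) = (\<Sum>i\<in>I. expectation (\<lambda>\<omega>. 0))"
    by (intro sum.cong Bochner_Integration.integral_cong) auto
  then show False using var_sum by simp
qed

lemma expectation_W_square: "expectation (\<lambda>\<omega>. (W \<omega>)\<^sup>2) = 1"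
  unfolding W_def using expectation_square_sum[OF fin indep bounded_xi mean_xi] var_sum by simp

lemma expectation_abs_W: "expectation (\<lambda>\<omega>. \<bar>W \<omega>\<bar>) \<le> 1"
proof -
  have "expectation (\<lambda>\<omega>. \<bar>W \<omega>\<bar>) \<le> expectation (\<lambda>\<omega>. 1 / 2 + 1 / 2 * (W \<omega>)\<^sup>2)"
  proof (rule expectation_mono_bounded)
    fix \<omega>
    have "0 \<le> (1 - \<bar>W \<omega>\<bar>)\<^sup>2" by simp
    then have "2 * \<bar>W \<omega>\<bar> \<le> 1 + (W \<omega>)\<^sup>2" unfolding power2_diff by simp
    then show "\<bar>W \<omega>\<bar> \<le> 1 / 2 + 1 / 2 * (W \<omega>)\<^sup>2" by linarith
  qed (intro bounded_rv_intros bounded_W)+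
  also have "\<dots> = 1"
    using bounded_W
    by (subst expectation_add_bounded) (simp_all add: bounded_rv_intros expectation_W_square prob_space)
  finally show ?thesis .
qed

text \<open>The variance of the sum of squares is at most \<open>K^2\<close>, since
  \<open>xi^4 \<le> K^2 * xi^2\<close>; the inequality \<open>2 * K * u \<le> K^2 + u^2\<close>
  turns this into a first absolute moment.\<close>

lemma expectation_abs_sum_squares: "expectation (\<lambda>\<omega>. \<bar>(\<Sum>i\<in>I. (xi i \<omega>)\<^sup>2) - 1\<bar>) \<le> K"
proof -
  define Z where "Z i \<omega> = (xi i \<omega>)\<^sup>2 - expectation (\<lambda>\<omega>. (xi i \<omega>)\<^sup>2)" for i \<omega>
  have bZ: "bounded_rv (Z i)" if "i \<in> I" for i
    unfolding Z_def[abs_def] using that by (intro bounded_rv_intros bounded_xi)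
  have sZ: "(\<Sum>i\<in>I. (xi i \<omega>)\<^sup>2) - 1 = (\<Sum>i\<in>I. Z i \<omega>)" for \<omega>
    by (simp add: Z_def sum_subtractf var_sum)
  have iZ: "indep_vars (\<lambda>_. borel) Z I"
    unfolding Z_def[abs_def] by (rule indep_vars_compose2[OF indep]) measurable
  have "expectation (\<lambda>\<omega>. (\<Sum>i\<in>I. Z i \<omega>)\<^sup>2) = (\<Sum>i\<in>I. expectation (\<lambda>\<omega>. (Z i \<omega>)\<^sup>2))"
  proof (rule expectation_square_sum[OF fin iZ bZ])
    fix i assume "i \<in> I"
    then show "expectation (Z i) = 0"
      unfolding Z_def[abs_def]
      by (subst expectation_diff_bounded) (auto intro!: bounded_rv_intros bounded_xi simp: prob_space)
  qed
  also have "\<dots> \<le> (\<Sum>i\<in>I. K\<^sup>2 * expectation (\<lambda>\<omega>. (xi i \<omega>)\<^sup>2))"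
  proof (rule sum_mono)
    fix i assume i: "i \<in> I"
    define v where "v = expectation (\<lambda>\<omega>. (xi i \<omega>)\<^sup>2)"
    have b: "bounded_rv (\<lambda>\<omega>. (xi i \<omega>)\<^sup>2)" using i by (intro bounded_rv_intros bounded_xi)
    have "expectation (\<lambda>\<omega>. (Z i \<omega>)\<^sup>2) \<le> expectation (\<lambda>\<omega>. (K\<^sup>2 - 2 * v) * (xi i \<omega>)\<^sup>2 + v\<^sup>2)"
    proof (rule expectation_mono_bounded)
      fix \<omega> assume \<omega>: "\<omega> \<in> space M"
      have "(xi i \<omega>)\<^sup>2 * (xi i \<omega>)\<^sup>2 \<le> K\<^sup>2 * (xi i \<omega>)\<^sup>2"
        using xi_le[OF i \<omega>] by (intro mult_right_mono) (auto simp: abs_le_square_iff[symmetric])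
      then show "(Z i \<omega>)\<^sup>2 \<le> (K\<^sup>2 - 2 * v) * (xi i \<omega>)\<^sup>2 + v\<^sup>2"
        by (simp add: Z_def v_def power2_eq_square algebra_simps)
    qed (use i in \<open>auto intro!: bounded_rv_intros bounded_xi bZ\<close>)
    also have "\<dots> = (K\<^sup>2 - 2 * v) * v + v\<^sup>2"
      using b by (subst expectation_add_bounded) (auto intro!: bounded_rv_intros simp: v_def prob_space)
    also have "\<dots> \<le> K\<^sup>2 * v"
      by (simp add: power2_eq_square algebra_simps)
    finally show "expectation (\<lambda>\<omega>. (Z i \<omega>)\<^sup>2) \<le> K\<^sup>2 * expectation (\<lambda>\<omega>. (xi i \<omega>)\<^sup>2)"
      by (simp add: v_def)
  qed
  also have "\<dots> = K\<^sup>2" by (simp add: sum_distrib_left[symmetric] var_sum)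
  finally have 2: "expectation (\<lambda>\<omega>. (\<Sum>i\<in>I. Z i \<omega>)\<^sup>2) \<le> K\<^sup>2" .
  have bS: "bounded_rv (\<lambda>\<omega>. \<Sum>i\<in>I. Z i \<omega>)" by (intro bounded_rv_intros bZ)
  have "expectation (\<lambda>\<omega>. \<bar>\<Sum>i\<in>I. Z i \<omega>\<bar>) \<le> expectation (\<lambda>\<omega>. K / 2 + (1 / (2 * K)) * (\<Sum>i\<in>I. Z i \<omega>)\<^sup>2)"
  proof (rule expectation_mono_bounded)
    fix \<omega>
    define u where "u = \<bar>\<Sum>i\<in>I. Z i \<omega>\<bar>"
    have "0 \<le> (K - u)\<^sup>2" by simp
    then have "2 * K * u \<le> K\<^sup>2 + u\<^sup>2" unfolding power2_diff by simp
    then have "u \<le> K / 2 + (1 / (2 * K)) * u\<^sup>2"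
      using K_pos by (simp add: field_simps power2_eq_square)
    then show "\<bar>\<Sum>i\<in>I. Z i \<omega>\<bar> \<le> K / 2 + (1 / (2 * K)) * (\<Sum>i\<in>I. Z i \<omega>)\<^sup>2"
      by (simp only: u_def power2_abs)
  qed (intro bounded_rv_intros bS)+
  also have "\<dots> = K / 2 + (1 / (2 * K)) * expectation (\<lambda>\<omega>. (\<Sum>i\<in>I. Z i \<omega>)\<^sup>2)"
    using bS by (subst expectation_add_bounded) (auto intro!: bounded_rv_intros simp: prob_space)
  also have "\<dots> \<le> K / 2 + (1 / (2 * K)) * K\<^sup>2"
    using K_pos 2 by (intro add_left_mono mult_left_mono) auto
  also have "\<dots> = K" using K_pos by (simp add: power2_eq_square)
  finally show ?thesis by (simp add: sZ)
qed

lemma indep_W_without: "i \<in> I \<Longrightarrow> indep_var borel (xi i) borel (W_without i)"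
  unfolding W_without_def[abs_def]
  using indep_vars_sum[of "I - {i}" i xi] fin indep by (simp add: insert_absorb)

lemma expectation_xi_indep:
  assumes "i \<in> I" "indep_var borel (xi i) borel Y" "bounded_rv Y"
  shows "expectation (\<lambda>\<omega>. xi i \<omega> * Y \<omega>) = 0"
    and "expectation (\<lambda>\<omega>. (xi i \<omega>)\<^sup>2 * Y \<omega>) = expectation (\<lambda>\<omega>. (xi i \<omega>)\<^sup>2) * expectation Y"
proof -
  show "expectation (\<lambda>\<omega>. xi i \<omega> * Y \<omega>) = 0"
    using assms mean_xi
    by (subst indep_var_lebesgue_integral) (auto intro: bounded_rv_integrable bounded_xi)
  have "indep_var borel ((\<lambda>x. x\<^sup>2) \<circ> xi i) borel (id \<circ> Y)"
    by (intro indep_var_compose[OF assms(2)]) auto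
  then show "expectation (\<lambda>\<omega>. (xi i \<omega>)\<^sup>2 * Y \<omega>) = expectation (\<lambda>\<omega>. (xi i \<omega>)\<^sup>2) * expectation Y"
    using assms
    by (subst indep_var_lebesgue_integral)
       (auto simp: comp_def id_def intro: bounded_rv_integrable bounded_xi bounded_rv_power2)
qed

lemma indep_W_without_compose:
  assumes "i \<in> I" "g \<in> borel_measurable borel"
  shows "indep_var borel (xi i) borel (\<lambda>\<omega>. g (W_without i \<omega>))"
proof -
  have "indep_var borel (id \<circ> xi i) borel (g \<circ> W_without i)"
    using assms by (intro indep_var_compose[OF indep_W_without]) auto
  then show ?thesis by (simp add: comp_def id_def)
qed

text \<open>The randomized concentration inequality of Chen and Shao: evaluate \<open>E (W \<phi>(W))\<close> for the
  identity \<open>\<phi>\<close> truncated to the random interval, widened by \<open>K\<close> on both sides.\<close>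

lemma concentration:
  assumes D: "bounded_rv D" "\<And>\<omega>. \<omega> \<in> space M \<Longrightarrow> 0 \<le> D \<omega>"
    and D': "\<And>i. i \<in> I \<Longrightarrow> bounded_rv (D' i)" "\<And>i \<omega>. i \<in> I \<Longrightarrow> \<omega> \<in> space M \<Longrightarrow> 0 \<le> D' i \<omega>"
    and ind: "\<And>i g. i \<in> I \<Longrightarrow> g \<in> borel_measurable (borel \<Otimes>\<^sub>M borel)
      \<Longrightarrow> indep_var borel (xi i) borel (\<lambda>\<omega>. g (W_without i \<omega>, D' i \<omega>) :: real)"
    and ab: "a = 0 \<and> b = 1 \<or> a = 1 \<and> b = (0::real)"
  shows "prob {\<omega>\<in>space M. z - a * D \<omega> \<le> W \<omega> \<and> W \<omega> \<le> z + b * D \<omega>}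
    \<le> 2 * K + expectation (\<lambda>\<omega>. \<bar>W \<omega>\<bar> * D \<omega>)
       + 2 * (\<Sum>i\<in>I. expectation (\<lambda>\<omega>. \<bar>xi i \<omega>\<bar> * \<bar>D \<omega> - D' i \<omega>\<bar>))"
proof -
  note [measurable] = bounded_rv_measurable[OF D(1)]
  \<comment> \<open>Subtracting the midpoint bounds \<open>\<bar>\<phi>\<bar>\<close> by half the
    length of the widened interval, \<open>d / 2 + K\<close>. The margin \<open>K\<close> keeps
    \<open>W_without i\<close> unclipped whenever \<open>W\<close> lies in the inner
    interval.\<close>
  define \<phi> where "\<phi> w d = max (z - a * d - K) (min w (z + b * d + K)) - (z + (b - a) * d / 2)" for w d
  have [measurable]: "(\<lambda>p. \<phi> (fst p) (snd p)) \<in> borel_measurable (borel \<Otimes>\<^sub>M borel)"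
    unfolding \<phi>_def by measurable
  have \<phi>_le: "\<bar>\<phi> w d\<bar> \<le> d / 2 + K" if "0 \<le> d" for w d
    using ab that K_pos by (auto simp: \<phi>_def max_def min_def abs_le_iff field_simps)
  have \<phi>_mono: "\<phi> w d \<le> \<phi> w' d" if "w \<le> w'" for w w' d
    using that by (auto simp: \<phi>_def max_def min_def)
  \<comment> \<open>The clipping points move by at most the change of \<open>d\<close>, and the
    midpoint by half of it; the constant is rounded up.\<close>
  have \<phi>_diff: "\<bar>\<phi> w d - \<phi> w d'\<bar> \<le> 2 * \<bar>d - d'\<bar>" for w d d'
    using ab by (auto simp: \<phi>_def max_def min_def abs_if)
  have b\<phi>: "bounded_rv (\<lambda>\<omega>. \<phi> (Y \<omega>) (E \<omega>))"
    if Y: "bounded_rv Y" and E: "bounded_rv E" "\<And>\<omega>. \<omega> \<in> space M \<Longrightarrow> 0 \<le> E \<omega>" for Y E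
  proof -
    obtain B where B: "\<And>\<omega>. \<omega> \<in> space M \<Longrightarrow> \<bar>E \<omega>\<bar> \<le> B" using E by (auto simp: bounded_rv_def)
    note [measurable] = bounded_rv_measurable[OF Y] bounded_rv_measurable[OF E(1)]
    show ?thesis
    proof (rule bounded_rvI[where B="B / 2 + K"])
      fix \<omega> assume "\<omega> \<in> space M"
      then show "\<bar>\<phi> (Y \<omega>) (E \<omega>)\<bar> \<le> B / 2 + K"
        using \<phi>_le[OF E(2), of \<omega> "Y \<omega>"] B[of \<omega>] by auto
    qed (simp add: \<phi>_def)
  qed
  define J where "J \<omega> = (indicator {\<omega>. z - a * D \<omega> \<le> W \<omega> \<and> W \<omega> \<le> z + b * D \<omega>} \<omega> :: real)" for \<omega>
  have bJ: "bounded_rv J" unfolding J_def[abs_def] by (rule bounded_rv_indicator) measurable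
  have J01: "0 \<le> J \<omega>" "J \<omega> \<le> 1" for \<omega> by (auto simp: J_def indicator_def)
  define \<eta> where "\<eta> \<omega> = (\<Sum>i\<in>I. (xi i \<omega>)\<^sup>2)" for \<omega>
  have b\<eta>: "bounded_rv \<eta>" unfolding \<eta>_def[abs_def] by (intro bounded_rv_intros bounded_xi)
  note bi = bounded_rv_intros bounded_xi bounded_W bounded_W_without b\<phi> bJ b\<eta> D D'
  define S where "S \<omega> = (\<Sum>i\<in>I. xi i \<omega> * (\<phi> (W \<omega>) (D \<omega>) - \<phi> (W_without i \<omega>) (D \<omega>)))" for \<omega>
  have bS: "bounded_rv S" unfolding S_def[abs_def] by (intro bi)

  \<comment> \<open>Each term of \<open>S\<close> is nonnegative because \<open>\<phi>\<close> is
    nondecreasing in its first argument, and on the event of \<open>J\<close> it equals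
    \<open>(xi i)^2\<close>.\<close>
  have "expectation (\<lambda>\<omega>. J \<omega> * \<eta> \<omega>) \<le> expectation S"
  proof (rule expectation_mono_bounded)
    fix \<omega> assume \<omega>: "\<omega> \<in> space M"
    have "J \<omega> * \<eta> \<omega> = (\<Sum>i\<in>I. J \<omega> * (xi i \<omega>)\<^sup>2)" by (simp add: \<eta>_def sum_distrib_left)
    also have "\<dots> \<le> S \<omega>"
      unfolding S_def
    proof (rule sum_mono)
      fix i assume i: "i \<in> I"
      have W: "W \<omega> = W_without i \<omega> + xi i \<omega>" by (rule W_eq[OF i])
      show "J \<omega> * (xi i \<omega>)\<^sup>2 \<le> xi i \<omega> * (\<phi> (W \<omega>) (D \<omega>) - \<phi> (W_without i \<omega>) (D \<omega>))"
      proof (cases "z - a * D \<omega> \<le> W \<omega> \<and> W \<omega> \<le> z + b * D \<omega>")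
        case True
        then have "\<phi> (W \<omega>) (D \<omega>) - \<phi> (W_without i \<omega>) (D \<omega>) = xi i \<omega>"
          using xi_le[OF i \<omega>] W K_pos by (auto simp: \<phi>_def max_def min_def)
        then show ?thesis using True by (simp add: J_def power2_eq_square)
      next
        case False
        have "0 \<le> xi i \<omega> * (\<phi> (W \<omega>) (D \<omega>) - \<phi> (W_without i \<omega>) (D \<omega>))"
          unfolding zero_le_mult_iff using \<phi>_mono W
          by (cases "0 \<le> xi i \<omega>") auto
        then show ?thesis using False by (simp add: J_def)
      qed
    qed
    finally show "J \<omega> * \<eta> \<omega> \<le> S \<omega>" .
  qed (intro bi bS)+
  also have "expectation S = expectation (\<lambda>\<omega>. W \<omega> * \<phi> (W \<omega>) (D \<omega>))
      - (\<Sum>i\<in>I. expectation (\<lambda>\<omega>. xi i \<omega> * \<phi> (W_without i \<omega>) (D \<omega>)))"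
  proof -
    have "S = (\<lambda>\<omega>. W \<omega> * \<phi> (W \<omega>) (D \<omega>) - (\<Sum>i\<in>I. xi i \<omega> * \<phi> (W_without i \<omega>) (D \<omega>)))"
      by (auto simp: S_def W_def right_diff_distrib sum_subtractf sum_distrib_right)
    moreover have "bounded_rv (\<lambda>\<omega>. W \<omega> * \<phi> (W \<omega>) (D \<omega>))" by (intro bi)
    moreover have "bounded_rv (\<lambda>\<omega>. xi i \<omega> * \<phi> (W_without i \<omega>) (D \<omega>))" if "i \<in> I" for i
      using that by (intro bi)
    ultimately show ?thesis
      by (simp add: expectation_diff_bounded expectation_sum_bounded bounded_rv_sum)
  qed
  also have "\<dots> \<le> (K + expectation (\<lambda>\<omega>. \<bar>W \<omega>\<bar> * D \<omega>) / 2)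
      + (\<Sum>i\<in>I. 2 * expectation (\<lambda>\<omega>. \<bar>xi i \<omega>\<bar> * \<bar>D \<omega> - D' i \<omega>\<bar>))"
  proof -
    have "expectation (\<lambda>\<omega>. W \<omega> * \<phi> (W \<omega>) (D \<omega>)) \<le> expectation (\<lambda>\<omega>. K * \<bar>W \<omega>\<bar> + (1 / 2) * (\<bar>W \<omega>\<bar> * D \<omega>))"
    proof (rule expectation_mono_bounded)
      fix \<omega> assume \<omega>: "\<omega> \<in> space M"
      have "W \<omega> * \<phi> (W \<omega>) (D \<omega>) \<le> \<bar>W \<omega>\<bar> * \<bar>\<phi> (W \<omega>) (D \<omega>)\<bar>"
        by (metis abs_ge_self abs_mult)
      also have "\<dots> \<le> \<bar>W \<omega>\<bar> * (D \<omega> / 2 + K)"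
        using \<phi>_le[OF D(2)[OF \<omega>]] by (intro mult_left_mono) auto
      finally show "W \<omega> * \<phi> (W \<omega>) (D \<omega>) \<le> K * \<bar>W \<omega>\<bar> + (1 / 2) * (\<bar>W \<omega>\<bar> * D \<omega>)"
        by (simp add: algebra_simps)
    qed (intro bi; assumption)+
    also have "\<dots> = K * expectation (\<lambda>\<omega>. \<bar>W \<omega>\<bar>) + (1 / 2) * expectation (\<lambda>\<omega>. \<bar>W \<omega>\<bar> * D \<omega>)"
      by (subst expectation_add_bounded) (auto intro!: bi)
    also have "\<dots> \<le> K + expectation (\<lambda>\<omega>. \<bar>W \<omega>\<bar> * D \<omega>) / 2"
      using mult_left_mono[OF expectation_abs_W, of K] K_pos by simp
    finally have 1: "expectation (\<lambda>\<omega>. W \<omega> * \<phi> (W \<omega>) (D \<omega>)) \<le> K + expectation (\<lambda>\<omega>. \<bar>W \<omega>\<bar> * D \<omega>) / 2" .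
    have 2: "- expectation (\<lambda>\<omega>. xi i \<omega> * \<phi> (W_without i \<omega>) (D \<omega>))
        \<le> 2 * expectation (\<lambda>\<omega>. \<bar>xi i \<omega>\<bar> * \<bar>D \<omega> - D' i \<omega>\<bar>)" if i: "i \<in> I" for i
    proof -
      have b1: "bounded_rv (\<lambda>\<omega>. \<phi> (W_without i \<omega>) (D \<omega>))" "bounded_rv (\<lambda>\<omega>. \<phi> (W_without i \<omega>) (D' i \<omega>))"
        using i by (auto intro!: bi)
      \<comment> \<open>With \<open>D' i\<close> in place of \<open>D\<close> the clipped value is
        independent of the centred \<open>xi i\<close>. The price of the replacement is the
        influence term.\<close>
      have "expectation (\<lambda>\<omega>. xi i \<omega> * \<phi> (W_without i \<omega>) (D' i \<omega>)) = 0"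
        using expectation_xi_indep(1)[OF i ind[OF i, of "\<lambda>p. \<phi> (fst p) (snd p)"]] b1 by simp
      then have "- expectation (\<lambda>\<omega>. xi i \<omega> * \<phi> (W_without i \<omega>) (D \<omega>))
          = expectation (\<lambda>\<omega>. xi i \<omega> * \<phi> (W_without i \<omega>) (D' i \<omega>) - xi i \<omega> * \<phi> (W_without i \<omega>) (D \<omega>))"
        using i b1 by (subst expectation_diff_bounded) (auto intro!: bounded_rv_intros bounded_xi)
      also have "\<dots> \<le> expectation (\<lambda>\<omega>. 2 * (\<bar>xi i \<omega>\<bar> * \<bar>D \<omega> - D' i \<omega>\<bar>))"
      proof (rule expectation_mono_bounded)
        fix \<omega>
        have "xi i \<omega> * \<phi> (W_without i \<omega>) (D' i \<omega>) - xi i \<omega> * \<phi> (W_without i \<omega>) (D \<omega>)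
            \<le> \<bar>xi i \<omega>\<bar> * \<bar>\<phi> (W_without i \<omega>) (D' i \<omega>) - \<phi> (W_without i \<omega>) (D \<omega>)\<bar>"
          by (metis abs_ge_self abs_mult right_diff_distrib)
        also have "\<dots> \<le> \<bar>xi i \<omega>\<bar> * (2 * \<bar>D' i \<omega> - D \<omega>\<bar>)"
          by (intro mult_left_mono \<phi>_diff) auto
        finally show "xi i \<omega> * \<phi> (W_without i \<omega>) (D' i \<omega>) - xi i \<omega> * \<phi> (W_without i \<omega>) (D \<omega>)
            \<le> 2 * (\<bar>xi i \<omega>\<bar> * \<bar>D \<omega> - D' i \<omega>\<bar>)"
          by (simp add: abs_minus_commute)
      qed (use i b1 in \<open>auto intro!: bounded_rv_intros bounded_xi D D'\<close>)
      finally show ?thesis by simp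
    qed
    have "- (\<Sum>i\<in>I. expectation (\<lambda>\<omega>. xi i \<omega> * \<phi> (W_without i \<omega>) (D \<omega>)))
        \<le> (\<Sum>i\<in>I. 2 * expectation (\<lambda>\<omega>. \<bar>xi i \<omega>\<bar> * \<bar>D \<omega> - D' i \<omega>\<bar>))"
      unfolding sum_negf[symmetric] by (intro sum_mono 2)
    with 1 show ?thesis by linarith
  qed
  finally have main: "expectation (\<lambda>\<omega>. J \<omega> * \<eta> \<omega>) \<le> (K + expectation (\<lambda>\<omega>. \<bar>W \<omega>\<bar> * D \<omega>) / 2)
      + 2 * (\<Sum>i\<in>I. expectation (\<lambda>\<omega>. \<bar>xi i \<omega>\<bar> * \<bar>D \<omega> - D' i \<omega>\<bar>))"
    by (simp add: sum_distrib_left)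
  have "prob {\<omega>\<in>space M. z - a * D \<omega> \<le> W \<omega> \<and> W \<omega> \<le> z + b * D \<omega>} = expectation J"
    unfolding J_def[abs_def] by (rule prob_eq_expectation_indicator) measurable
  \<comment> \<open>The weight \<open>\<eta>\<close> has mean 1, and removing it costs its mean
    deviation, which is at most \<open>K\<close>.\<close>
  also have "\<dots> \<le> expectation (\<lambda>\<omega>. J \<omega> * \<eta> \<omega> + \<bar>\<eta> \<omega> - 1\<bar>)"
  proof (rule expectation_mono_bounded)
    fix \<omega>
    have "J \<omega> * (1 - \<eta> \<omega>) \<le> J \<omega> * \<bar>\<eta> \<omega> - 1\<bar>" using J01 by (intro mult_left_mono) auto
    also have "\<dots> \<le> 1 * \<bar>\<eta> \<omega> - 1\<bar>" using J01 by (intro mult_right_mono) auto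
    finally show "J \<omega> \<le> J \<omega> * \<eta> \<omega> + \<bar>\<eta> \<omega> - 1\<bar>" by (simp add: algebra_simps)
  qed (intro bi)+
  also have "\<dots> = expectation (\<lambda>\<omega>. J \<omega> * \<eta> \<omega>) + expectation (\<lambda>\<omega>. \<bar>\<eta> \<omega> - 1\<bar>)"
    by (intro expectation_add_bounded bi)
  also have "\<dots> \<le> expectation (\<lambda>\<omega>. J \<omega> * \<eta> \<omega>) + K"
    using expectation_abs_sum_squares by (simp add: \<eta>_def)
  finally have "prob {\<omega>\<in>space M. z - a * D \<omega> \<le> W \<omega> \<and> W \<omega> \<le> z + b * D \<omega>}
      \<le> expectation (\<lambda>\<omega>. J \<omega> * \<eta> \<omega>) + K" .
  moreover have "0 \<le> expectation (\<lambda>\<omega>. \<bar>W \<omega>\<bar> * D \<omega>)"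
    using D by (intro Bochner_Integration.integral_nonneg_AE AE_I2) auto
  ultimately show ?thesis using main by linarith
qed

text \<open>The concentration inequality with the constant length \<open>4 * K\<close> and the left
  end moved to \<open>z - 2 * K\<close>: the influence terms vanish and \<open>2 * K + 4 * K\<close>
  remains.\<close>

lemma prob_W_near: "prob {\<omega>\<in>space M. \<bar>W \<omega> - z\<bar> \<le> 2 * K} \<le> 6 * K"
proof -
  have "prob {\<omega>\<in>space M. \<bar>W \<omega> - z\<bar> \<le> 2 * K}
      = prob {\<omega>\<in>space M. (z - 2 * K) - 0 * (4 * K) \<le> W \<omega> \<and> W \<omega> \<le> (z - 2 * K) + 1 * (4 * K)}"
    by (intro arg_cong[where f=prob]) (auto simp: abs_le_iff)
  also have "\<dots> \<le> 2 * K + expectation (\<lambda>\<omega>. \<bar>W \<omega>\<bar> * (4 * K))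
       + 2 * (\<Sum>i\<in>I. expectation (\<lambda>\<omega>. \<bar>xi i \<omega>\<bar> * \<bar>(4 * K) - (4 * K)\<bar>))"
  proof (rule concentration)
    fix i and g :: "real \<times> real \<Rightarrow> real"
    assume "i \<in> I" and [measurable]: "g \<in> borel_measurable (borel \<Otimes>\<^sub>M borel)"
    then show "indep_var borel (xi i) borel (\<lambda>\<omega>. g (W_without i \<omega>, 4 * K))"
      by (intro indep_W_without_compose) measurable
  qed (use K_pos in \<open>auto intro: bounded_rv_const\<close>)
  also have "\<dots> \<le> 6 * K"
    using mult_right_mono[OF expectation_abs_W, of "4 * K"] K_pos by simp
  finally show ?thesis .
qed

text \<open>Stein's equation in expectation makes the difference equal to
  \<open>E g(W) - E (W f(W))\<close>. Expanding \<open>f\<close> around \<open>W_without i\<close>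
  matches \<open>xi i * f W\<close> with \<open>(xi i)^2 * g\<close>, and independence replaces
  \<open>(xi i)^2\<close> by its mean \<open>v i\<close>. The constant is \<open>31 + 31\<close>,
  for the Taylor remainder and for the change from \<open>W_without i\<close> to \<open>W\<close> in
  \<open>g\<close>, weighted by variances that sum to 1.\<close>

theorem berry_esseen: "\<bar>prob {\<omega>\<in>space M. W \<omega> \<le> z} - Phi z\<bar> \<le> 62 * K"
proof (cases "K \<le> 1")
  case False
  then show ?thesis
    using Phi_bounds[of z] prob_le_1[of "{\<omega>\<in>space M. W \<omega> \<le> z}"]
      measure_nonneg[of M "{\<omega>\<in>space M. W \<omega> \<le> z}"] unfolding abs_le_iff by linarith
next
  case K1: True
  define f where "f = stein z"
  define g where "g = stein' z"
  \<comment> \<open>\<open>H\<close> dominates the increment of \<open>g\<close>, and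
    \<open>(xi i)^2 * H\<close> the Taylor remainder. Inside it \<open>\<bar>xi i\<bar>\<close> is
    replaced by \<open>K\<close>, so that \<open>H\<close> depends on \<open>W_without i\<close>
    alone, which is independent of \<open>xi i\<close>.\<close>
  define H where "H w = K * (3 + 2 * \<bar>w\<bar>) + 4 * indicator {u. \<bar>u - z\<bar> \<le> K} w" for w
  define v where "v i = expectation (\<lambda>\<omega>. (xi i \<omega>)\<^sup>2)" for i
  have v0: "0 \<le> v i" for i by (simp add: v_def)
  have vs: "(\<Sum>i\<in>I. v i) = 1" using var_sum by (simp add: v_def)
  have [measurable]: "f \<in> borel_measurable borel" "g \<in> borel_measurable borel"
    by (simp_all add: f_def g_def)
  have Hm[measurable]: "H \<in> borel_measurable borel" unfolding H_def[abs_def] by measurable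
  have bf: "bounded_rv (\<lambda>\<omega>. f (Y \<omega>))" and bg: "bounded_rv (\<lambda>\<omega>. g (Y \<omega>))" and bH: "bounded_rv (\<lambda>\<omega>. H (Y \<omega>))"
    if Y: "bounded_rv Y" for Y
  proof -
    show "bounded_rv (\<lambda>\<omega>. f (Y \<omega>))" "bounded_rv (\<lambda>\<omega>. g (Y \<omega>))"
      using abs_stein_le_3 abs_stein'_le_2 by (auto intro!: bounded_rv_compose[OF Y] simp: f_def g_def)
    have "bounded_rv (\<lambda>\<omega>. indicator {u. \<bar>u - z\<bar> \<le> K} (Y \<omega>))"
      by (rule bounded_rv_compose[OF Y, where B=1]) (auto simp: indicator_def)
    then show "bounded_rv (\<lambda>\<omega>. H (Y \<omega>))"
      unfolding H_def by (intro bounded_rv_intros Y)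
  qed
  note bi = bounded_rv_intros bounded_xi bounded_W bounded_W_without bf bg bH
  \<comment> \<open>Passing from \<open>W_without i\<close> to \<open>W\<close> costs at most
    \<open>K \<le> 1\<close>: it turns 3 into 5 and the window \<open>K\<close> into
    \<open>2 * K\<close>. Then \<open>31 = 5 + 2 + 4 * 6\<close>.\<close>
  have EH: "expectation (\<lambda>\<omega>. H (W_without i \<omega>)) \<le> 31 * K" if i: "i \<in> I" for i
  proof -
    have bind: "bounded_rv (\<lambda>\<omega>. indicator {\<omega>. \<bar>W \<omega> - z\<bar> \<le> 2 * K} \<omega>)"
      by (rule bounded_rv_indicator) measurable
    have "expectation (\<lambda>\<omega>. H (W_without i \<omega>))
        \<le> expectation (\<lambda>\<omega>. (5 * K + 2 * K * \<bar>W \<omega>\<bar>) + 4 * indicator {\<omega>. \<bar>W \<omega> - z\<bar> \<le> 2 * K} \<omega>)"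
    proof (rule expectation_mono_bounded)
      fix \<omega> assume \<omega>: "\<omega> \<in> space M"
      note x = xi_le[OF i \<omega>] and W = W_eq[OF i, of \<omega>]
      have "\<bar>W_without i \<omega>\<bar> \<le> \<bar>W \<omega>\<bar> + 1" using x W K1 by linarith
      then have "K * (3 + 2 * \<bar>W_without i \<omega>\<bar>) \<le> K * (5 + 2 * \<bar>W \<omega>\<bar>)"
        using K_pos by (intro mult_left_mono) auto
      moreover have "(indicator {u. \<bar>u - z\<bar> \<le> K} (W_without i \<omega>) :: real)
          \<le> indicator {\<omega>. \<bar>W \<omega> - z\<bar> \<le> 2 * K} \<omega>"
        using x W by (auto simp: indicator_def)
      ultimately show "H (W_without i \<omega>)
          \<le> (5 * K + 2 * K * \<bar>W \<omega>\<bar>) + 4 * indicator {\<omega>. \<bar>W \<omega> - z\<bar> \<le> 2 * K} \<omega>"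
        by (simp add: H_def algebra_simps)
    qed (intro bi bind)+
    also have "\<dots> = 5 * K + 2 * K * expectation (\<lambda>\<omega>. \<bar>W \<omega>\<bar>) + 4 * prob {\<omega>\<in>space M. \<bar>W \<omega> - z\<bar> \<le> 2 * K}"
    proof -
      have "prob {\<omega>\<in>space M. \<bar>W \<omega> - z\<bar> \<le> 2 * K} = expectation (\<lambda>\<omega>. indicator {\<omega>. \<bar>W \<omega> - z\<bar> \<le> 2 * K} \<omega>)"
        by (rule prob_eq_expectation_indicator) measurable
      moreover have b1: "bounded_rv (\<lambda>\<omega>. 5 * K + 2 * K * \<bar>W \<omega>\<bar>)" by (intro bi)
      have "expectation (\<lambda>\<omega>. 5 * K + 2 * K * \<bar>W \<omega>\<bar>) = 5 * K + 2 * K * expectation (\<lambda>\<omega>. \<bar>W \<omega>\<bar>)"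
        by (subst expectation_add_bounded) (auto intro!: bi simp: prob_space)
      ultimately show ?thesis
        using b1 bind by (subst expectation_add_bounded) (auto intro!: bounded_rv_intros)
    qed
    also have "\<dots> \<le> 5 * K + 2 * K * 1 + 4 * (6 * K)"
      using K_pos by (intro add_mono mult_left_mono prob_W_near expectation_abs_W) auto
    finally show ?thesis by simp
  qed
  have Eg: "\<bar>expectation (\<lambda>\<omega>. g (W \<omega>)) - expectation (\<lambda>\<omega>. g (W_without i \<omega>))\<bar> \<le> 31 * K" if i: "i \<in> I" for i
  proof -
    have "\<bar>expectation (\<lambda>\<omega>. g (W \<omega>) - g (W_without i \<omega>))\<bar> \<le> expectation (\<lambda>\<omega>. H (W_without i \<omega>))"
    proof (rule abs_expectation_le)
      fix \<omega> assume \<omega>: "\<omega> \<in> space M"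
      note x = xi_le[OF i \<omega>] and W = W_eq[OF i, of \<omega>]
      have "\<bar>g (W \<omega>) - g (W_without i \<omega>)\<bar> \<le> \<bar>xi i \<omega>\<bar> * (3 + 2 * \<bar>W_without i \<omega>\<bar>)
          + indicator {u. \<bar>u - z\<bar> \<le> \<bar>xi i \<omega>\<bar>} (W_without i \<omega>)"
        unfolding W g_def by (rule stein'_diff)
      also have "\<dots> \<le> H (W_without i \<omega>)"
        unfolding H_def using x by (intro add_mono mult_right_mono) (auto simp: indicator_def)
      finally show "\<bar>g (W \<omega>) - g (W_without i \<omega>)\<bar> \<le> H (W_without i \<omega>)" .
    qed (intro bi)+
    also have "expectation (\<lambda>\<omega>. g (W \<omega>) - g (W_without i \<omega>))
        = expectation (\<lambda>\<omega>. g (W \<omega>)) - expectation (\<lambda>\<omega>. g (W_without i \<omega>))"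
      by (intro expectation_diff_bounded bi)
    finally show ?thesis using EH[OF i] by linarith
  qed
  have summand: "\<bar>expectation (\<lambda>\<omega>. xi i \<omega> * f (W \<omega>)) - v i * expectation (\<lambda>\<omega>. g (W \<omega>))\<bar> \<le> v i * (62 * K)"
    if i: "i \<in> I" for i
  proof -
    have e0: "expectation (\<lambda>\<omega>. xi i \<omega> * f (W_without i \<omega>)) = 0"
      by (rule expectation_xi_indep(1)[OF i indep_W_without_compose[OF i]]) (measurable, intro bi)
    have e1: "expectation (\<lambda>\<omega>. (xi i \<omega>)\<^sup>2 * g (W_without i \<omega>)) = v i * expectation (\<lambda>\<omega>. g (W_without i \<omega>))"
      unfolding v_def
      by (rule expectation_xi_indep(2)[OF i indep_W_without_compose[OF i]]) (measurable, intro bi)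
    have e2: "expectation (\<lambda>\<omega>. (xi i \<omega>)\<^sup>2 * H (W_without i \<omega>)) = v i * expectation (\<lambda>\<omega>. H (W_without i \<omega>))"
      unfolding v_def
      by (rule expectation_xi_indep(2)[OF i indep_W_without_compose[OF i]]) (measurable, intro bi)
    have "\<bar>expectation (\<lambda>\<omega>. xi i \<omega> * f (W \<omega>) - xi i \<omega> * f (W_without i \<omega>) - (xi i \<omega>)\<^sup>2 * g (W_without i \<omega>))\<bar>
        \<le> expectation (\<lambda>\<omega>. (xi i \<omega>)\<^sup>2 * H (W_without i \<omega>))"
    proof (rule abs_expectation_le)
      fix \<omega> assume \<omega>: "\<omega> \<in> space M"
      note x = xi_le[OF i \<omega>] and W = W_eq[OF i, of \<omega>]
      have "xi i \<omega> * f (W \<omega>) - xi i \<omega> * f (W_without i \<omega>) - (xi i \<omega>)\<^sup>2 * g (W_without i \<omega>)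
          = xi i \<omega> * (f (W_without i \<omega> + xi i \<omega>) - f (W_without i \<omega>) - xi i \<omega> * g (W_without i \<omega>))"
        by (simp add: W algebra_simps power2_eq_square)
      also have "\<bar>\<dots>\<bar> \<le> \<bar>xi i \<omega>\<bar> * ((xi i \<omega>)\<^sup>2 * (3 + 2 * \<bar>W_without i \<omega>\<bar>)
          + 4 * \<bar>xi i \<omega>\<bar> * indicator {u. \<bar>u - z\<bar> \<le> \<bar>xi i \<omega>\<bar>} (W_without i \<omega>))"
        unfolding abs_mult f_def g_def by (intro mult_left_mono stein_taylor) auto
      also have "\<dots> = (xi i \<omega>)\<^sup>2 * (\<bar>xi i \<omega>\<bar> * (3 + 2 * \<bar>W_without i \<omega>\<bar>)
          + 4 * indicator {u. \<bar>u - z\<bar> \<le> \<bar>xi i \<omega>\<bar>} (W_without i \<omega>))"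
      proof -
        have "a * (a\<^sup>2 * p + 4 * a * q) = a\<^sup>2 * (a * p + 4 * q)" for a p q :: real
          by (simp add: algebra_simps power2_eq_square)
        from this[of "\<bar>xi i \<omega>\<bar>"] show ?thesis by (simp only: power2_abs)
      qed
      also have "\<dots> \<le> (xi i \<omega>)\<^sup>2 * H (W_without i \<omega>)"
        unfolding H_def using x by (intro mult_left_mono add_mono mult_right_mono) (auto simp: indicator_def)
      finally show "\<bar>xi i \<omega> * f (W \<omega>) - xi i \<omega> * f (W_without i \<omega>) - (xi i \<omega>)\<^sup>2 * g (W_without i \<omega>)\<bar>
          \<le> (xi i \<omega>)\<^sup>2 * H (W_without i \<omega>)" .
    qed (use i in \<open>auto intro!: bi\<close>)
    also have "expectation (\<lambda>\<omega>. xi i \<omega> * f (W \<omega>) - xi i \<omega> * f (W_without i \<omega>) - (xi i \<omega>)\<^sup>2 * g (W_without i \<omega>))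
        = expectation (\<lambda>\<omega>. xi i \<omega> * f (W \<omega>)) - v i * expectation (\<lambda>\<omega>. g (W_without i \<omega>))"
    proof -
      have "bounded_rv (\<lambda>\<omega>. xi i \<omega> * f (W \<omega>))" "bounded_rv (\<lambda>\<omega>. xi i \<omega> * f (W_without i \<omega>))"
        "bounded_rv (\<lambda>\<omega>. (xi i \<omega>)\<^sup>2 * g (W_without i \<omega>))"
        using i by (auto intro!: bi)
      then show ?thesis
        by (subst expectation_diff_bounded, simp add: bounded_rv_diff, simp)
           (subst expectation_diff_bounded, simp_all add: e0 e1)
    qed
    finally have 1: "\<bar>expectation (\<lambda>\<omega>. xi i \<omega> * f (W \<omega>)) - v i * expectation (\<lambda>\<omega>. g (W_without i \<omega>))\<bar>
        \<le> v i * (31 * K)"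
      using mult_left_mono[OF EH[OF i] v0[of i]] e2 by linarith
    have "\<bar>v i * (expectation (\<lambda>\<omega>. g (W \<omega>)) - expectation (\<lambda>\<omega>. g (W_without i \<omega>)))\<bar> \<le> v i * (31 * K)"
      using mult_left_mono[OF Eg[OF i] v0[of i]] v0[of i] by (simp add: abs_mult)
    then show ?thesis using 1 unfolding right_diff_distrib by linarith
  qed
  have EWf: "expectation (\<lambda>\<omega>. W \<omega> * f (W \<omega>)) = (\<Sum>i\<in>I. expectation (\<lambda>\<omega>. xi i \<omega> * f (W \<omega>)))"
    unfolding W_def sum_distrib_right
    by (subst expectation_sum_bounded) (auto intro!: bi bounded_W[unfolded W_def[abs_def]])
  have "expectation (\<lambda>\<omega>. W \<omega> * f (W \<omega>)) - expectation (\<lambda>\<omega>. g (W \<omega>))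
      = (\<Sum>i\<in>I. expectation (\<lambda>\<omega>. xi i \<omega> * f (W \<omega>)) - v i * expectation (\<lambda>\<omega>. g (W \<omega>)))"
    unfolding EWf sum_subtractf by (simp add: sum_distrib_right[symmetric] vs)
  also have "\<bar>\<dots>\<bar> \<le> (\<Sum>i\<in>I. v i * (62 * K))"
    by (rule order_trans[OF sum_abs sum_mono[OF summand]])
  also have "\<dots> = 62 * K" by (simp add: sum_distrib_right[symmetric] vs)
  finally have "\<bar>expectation (\<lambda>\<omega>. W \<omega> * f (W \<omega>)) - expectation (\<lambda>\<omega>. g (W \<omega>))\<bar> \<le> 62 * K" .
  moreover have "expectation (\<lambda>\<omega>. g (W \<omega>))
      = expectation (\<lambda>\<omega>. W \<omega> * f (W \<omega>)) + (prob {\<omega>\<in>space M. W \<omega> \<le> z} - Phi z)"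
  proof -
    have b1: "bounded_rv (\<lambda>\<omega>. W \<omega> * f (W \<omega>))" by (intro bi)
    have b2: "bounded_rv (\<lambda>\<omega>. indicator {\<omega>. W \<omega> \<le> z} \<omega>)" by (rule bounded_rv_indicator) measurable
    have "(\<lambda>\<omega>. g (W \<omega>)) = (\<lambda>\<omega>. W \<omega> * f (W \<omega>) + (indicator {\<omega>. W \<omega> \<le> z} \<omega> - Phi z))"
      by (auto simp: g_def f_def stein'_def indicator_def)
    then have "expectation (\<lambda>\<omega>. g (W \<omega>))
        = expectation (\<lambda>\<omega>. W \<omega> * f (W \<omega>) + (indicator {\<omega>. W \<omega> \<le> z} \<omega> - Phi z))"
      by (simp only:)
    also have "\<dots> = expectation (\<lambda>\<omega>. W \<omega> * f (W \<omega>))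
        + expectation (\<lambda>\<omega>. indicator {\<omega>. W \<omega> \<le> z} \<omega> - Phi z)"
      by (rule expectation_add_bounded[OF b1 bounded_rv_diff[OF b2 bounded_rv_const]])
    also have "expectation (\<lambda>\<omega>. indicator {\<omega>. W \<omega> \<le> z} \<omega> - Phi z)
        = prob {\<omega>\<in>space M. W \<omega> \<le> z} - expectation (\<lambda>\<omega>. Phi z)"
    proof -
      have "prob {\<omega>\<in>space M. W \<omega> \<le> z} = expectation (\<lambda>\<omega>. indicator {\<omega>. W \<omega> \<le> z} \<omega>)"
        by (rule prob_eq_expectation_indicator) measurable
      then show ?thesis unfolding expectation_diff_bounded[OF b2 bounded_rv_const] by (simp only:)
    qed
    also have "expectation (\<lambda>\<omega>. Phi z) = Phi z" by (simp add: prob_space)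
    finally show ?thesis .
  qed
  ultimately have "\<bar>- (prob {\<omega>\<in>space M. W \<omega> \<le> z} - Phi z)\<bar> \<le> 62 * K" by simp
  then show ?thesis by (simp only: abs_minus_cancel)
qed

text \<open>As \<open>D\<close> is nonnegative, the events \<open>W + D \<le> z\<close> and
  \<open>W \<le> z\<close> differ only if \<open>z - D \<le> W \<le> z\<close>, while
  \<open>W - D \<le> z\<close> and \<open>W \<le> z\<close> differ only if
  \<open>z \<le> W \<le> z + D\<close>. The concentration inequality bounds both windows, and
  \<open>64 = 62 + 2\<close>.\<close>

theorem nonlinear_berry_esseen:
  assumes D: "bounded_rv D" "\<And>\<omega>. \<omega> \<in> space M \<Longrightarrow> 0 \<le> D \<omega>"
    and D': "\<And>i. i \<in> I \<Longrightarrow> bounded_rv (D' i)" "\<And>i \<omega>. i \<in> I \<Longrightarrow> \<omega> \<in> space M \<Longrightarrow> 0 \<le> D' i \<omega>"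
    and ind: "\<And>i g. i \<in> I \<Longrightarrow> g \<in> borel_measurable (borel \<Otimes>\<^sub>M borel)
      \<Longrightarrow> indep_var borel (xi i) borel (\<lambda>\<omega>. g (W_without i \<omega>, D' i \<omega>) :: real)"
    and R: "expectation (\<lambda>\<omega>. \<bar>W \<omega>\<bar> * D \<omega>)
       + 2 * (\<Sum>i\<in>I. expectation (\<lambda>\<omega>. \<bar>xi i \<omega>\<bar> * \<bar>D \<omega> - D' i \<omega>\<bar>)) \<le> R"
  shows "\<bar>prob {\<omega>\<in>space M. W \<omega> + D \<omega> \<le> z} - Phi z\<bar> \<le> 64 * K + R"
    and "\<bar>prob {\<omega>\<in>space M. W \<omega> - D \<omega> \<le> z} - Phi z\<bar> \<le> 64 * K + R"
proof -
  note [measurable] = bounded_rv_measurable[OF D(1)]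
  have 1: "prob {\<omega>\<in>space M. z - 1 * D \<omega> \<le> W \<omega> \<and> W \<omega> \<le> z + 0 * D \<omega>} \<le> 2 * K + R"
    by (rule order_trans[OF concentration[OF D D' ind]]) (use R in auto)
  have 2: "prob {\<omega>\<in>space M. z - 0 * D \<omega> \<le> W \<omega> \<and> W \<omega> \<le> z + 1 * D \<omega>} \<le> 2 * K + R"
    by (rule order_trans[OF concentration[OF D D' ind]]) (use R in auto)
  have "prob {\<omega>\<in>space M. W \<omega> \<le> z} \<le> prob ({\<omega>\<in>space M. W \<omega> + D \<omega> \<le> z}
      \<union> {\<omega>\<in>space M. z - 1 * D \<omega> \<le> W \<omega> \<and> W \<omega> \<le> z + 0 * D \<omega>})"
    by (intro finite_measure_mono) auto
  also have "\<dots> \<le> prob {\<omega>\<in>space M. W \<omega> + D \<omega> \<le> z}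
      + prob {\<omega>\<in>space M. z - 1 * D \<omega> \<le> W \<omega> \<and> W \<omega> \<le> z + 0 * D \<omega>}"
    by (intro measure_Un_le) auto
  finally have 3: "prob {\<omega>\<in>space M. W \<omega> \<le> z} \<le> prob {\<omega>\<in>space M. W \<omega> + D \<omega> \<le> z} + (2 * K + R)"
    using 1 by linarith
  have 4: "prob {\<omega>\<in>space M. W \<omega> + D \<omega> \<le> z} \<le> prob {\<omega>\<in>space M. W \<omega> \<le> z}" (is "prob ?A \<le> prob ?B")
  proof (rule finite_measure_mono)
    show "?A \<subseteq> ?B"
    proof
      fix \<omega> assume "\<omega> \<in> ?A"
      then show "\<omega> \<in> ?B" using D(2)[of \<omega>] by simp
    qed
  qed measurable
  have "prob {\<omega>\<in>space M. W \<omega> - D \<omega> \<le> z} \<le> prob ({\<omega>\<in>space M. W \<omega> \<le> z}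
      \<union> {\<omega>\<in>space M. z - 0 * D \<omega> \<le> W \<omega> \<and> W \<omega> \<le> z + 1 * D \<omega>})"
    by (intro finite_measure_mono) auto
  also have "\<dots> \<le> prob {\<omega>\<in>space M. W \<omega> \<le> z}
      + prob {\<omega>\<in>space M. z - 0 * D \<omega> \<le> W \<omega> \<and> W \<omega> \<le> z + 1 * D \<omega>}"
    by (intro measure_Un_le) auto
  finally have 5: "prob {\<omega>\<in>space M. W \<omega> - D \<omega> \<le> z} \<le> prob {\<omega>\<in>space M. W \<omega> \<le> z} + (2 * K + R)"
    using 2 by linarith
  have 6: "prob {\<omega>\<in>space M. W \<omega> \<le> z} \<le> prob {\<omega>\<in>space M. W \<omega> - D \<omega> \<le> z}" (is "prob ?A \<le> prob ?B")
  proof (rule finite_measure_mono)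
    show "?A \<subseteq> ?B"
    proof
      fix \<omega> assume "\<omega> \<in> ?A"
      then show "\<omega> \<in> ?B" using D(2)[of \<omega>] by simp
    qed
  qed measurable
  have 7: "prob {\<omega>\<in>space M. W \<omega> \<le> z} - Phi z \<le> 62 * K"
    "Phi z - prob {\<omega>\<in>space M. W \<omega> \<le> z} \<le> 62 * K"
    using berry_esseen[of z] by (auto dest: abs_le_D1 abs_le_D2)
  show "\<bar>prob {\<omega>\<in>space M. W \<omega> + D \<omega> \<le> z} - Phi z\<bar> \<le> 64 * K + R"
    "\<bar>prob {\<omega>\<in>space M. W \<omega> - D \<omega> \<le> z} - Phi z\<bar> \<le> 64 * K + R"
    using 3 4 5 6 7 by (intro abs_leI; linarith)+
qed

end

section \<open>Counts of independent events\<close>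

text \<open>Both signs occur, since counts are bounded from above and from below. For
  \<open>x = - y\<close> with \<open>y > 0\<close>, the reciprocal of \<open>1 + y\<close> is
  compared by means of \<open>(1 - y + y^2) * (1 + y) = 1 + y^3\<close>.\<close>

lemma exp_le_quadratic:
  assumes "\<bar>x::real\<bar> \<le> 1"
  shows "exp x \<le> 1 + x + x\<^sup>2"
proof (cases "0 \<le> x")
  case True
  then show ?thesis using assms exp_bound[of x] by simp
next
  case False
  define y where "y = - x"
  have y: "0 < y" "y \<le> 1" using False assms by (auto simp: y_def)
  have "exp x = 1 / exp y" by (simp add: y_def exp_minus inverse_eq_divide)
  also have "\<dots> \<le> 1 / (1 + y)"
    using y exp_ge_add_one_self[of y] by (intro divide_left_mono) auto
  also have "\<dots> \<le> 1 - y + y\<^sup>2"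
  proof -
    have "(1 - y + y\<^sup>2) * (1 + y) = 1 + y ^ 3"
      by (simp add: algebra_simps power2_eq_square power3_eq_cube)
    then show ?thesis using y by (simp add: divide_le_eq)
  qed
  finally show ?thesis by (simp add: y_def)
qed

lemma le_mult_exp:
  fixes x r :: real
  assumes "0 < r"
  shows "x \<le> r * exp (x / r)"
proof -
  have "x / r \<le> exp (x / r)" using exp_ge_add_one_self[of "x / r"] by linarith
  then show ?thesis using assms by (simp add: field_simps)
qed

lemma sum_exp_minus_le_2: "(\<Sum>j<J. exp (- real j)) \<le> 2"
proof -
  have e: "exp (- real j) = (exp (-1)) ^ j" for j by (simp add: exp_of_nat_mult[symmetric])
  have h: "exp (-1 :: real) \<le> 1 / 2"
    using exp_ge_add_one_self[of 1] by (simp add: exp_minus inverse_eq_divide field_simps)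
  have "(\<Sum>j<J. exp (- real j)) \<le> (\<Sum>j<J. (1 / 2) ^ j)"
    unfolding e by (intro sum_mono power_mono h) auto
  also have "\<dots> \<le> 2"
    by (simp add: geometric_sum)
  finally show ?thesis .
qed

locale indep_sample = prob_space M for M :: "'a measure" +
  fixes I :: "'i set" and X :: "'i \<Rightarrow> 'a \<Rightarrow> real"
  assumes fin_I: "finite I"
    and indep_X: "indep_vars (\<lambda>_. borel) X I"
begin

definition count :: "real set \<Rightarrow> 'a \<Rightarrow> real" where
  "count A \<omega> = (\<Sum>i\<in>I. indicator A (X i \<omega>))"

lemma X_measurable: "i \<in> I \<Longrightarrow> X i \<in> borel_measurable M"
  using indep_X by (simp add: indep_vars_def2)

lemma bounded_hit:
  assumes "i \<in> I" "A \<in> sets borel"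
  shows "bounded_rv (\<lambda>\<omega>. indicator A (X i \<omega>))"
proof -
  have "(\<lambda>\<omega>. indicator A (X i \<omega>) :: real) \<in> borel_measurable M"
    using measurable_compose[OF X_measurable[OF assms(1)] borel_measurable_indicator[OF assms(2)]] .
  then show ?thesis by (rule bounded_rvI[where B=1]) (simp add: indicator_def)
qed

lemma bounded_count: "A \<in> sets borel \<Longrightarrow> bounded_rv (count A)"
  unfolding count_def[abs_def] by (intro bounded_rv_sum bounded_hit)

lemma bounded_rv_exp: "bounded_rv f \<Longrightarrow> bounded_rv (\<lambda>\<omega>. exp (f \<omega>))"
proof -
  assume f: "bounded_rv f"
  then obtain B where B: "\<And>\<omega>. \<omega> \<in> space M \<Longrightarrow> \<bar>f \<omega>\<bar> \<le> B" by (auto simp: bounded_rv_def)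
  note [measurable] = bounded_rv_measurable[OF f]
  show ?thesis by (rule bounded_rvI[where B="exp B"]) (use B in \<open>auto dest: abs_le_D1\<close>)
qed

lemma bounded_rv_max: "bounded_rv f \<Longrightarrow> bounded_rv (\<lambda>\<omega>. max 0 (f \<omega>))"
proof -
  assume f: "bounded_rv f"
  then obtain B where B: "\<And>\<omega>. \<omega> \<in> space M \<Longrightarrow> \<bar>f \<omega>\<bar> \<le> B" by (auto simp: bounded_rv_def)
  note [measurable] = bounded_rv_measurable[OF f]
  show ?thesis
  proof (rule bounded_rvI)
    fix \<omega> assume "\<omega> \<in> space M"
    from B[OF this] show "\<bar>max 0 (f \<omega>)\<bar> \<le> B" by (auto simp: max_def)
  qed measurable
qed

text \<open>By independence a product of equal factors, each of them
  \<open>1 + p * (exp t - 1) \<le> exp (p * (t + t^2))\<close>. Positive \<open>t\<close> serves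
  upper tails, negative \<open>t\<close> lower tails.\<close>

lemma count_mgf:
  fixes p t :: real
  assumes A[measurable]: "A \<in> sets borel" and p: "\<And>i. i \<in> I \<Longrightarrow> prob {\<omega>\<in>space M. X i \<omega> \<in> A} = p"
    and t: "\<bar>t\<bar> \<le> 1"
  shows "expectation (\<lambda>\<omega>. exp (t * count A \<omega>)) \<le> exp (card I * p * (t + t\<^sup>2))"
proof -
  have e: "expectation (\<lambda>\<omega>. exp (t * indicator A (X i \<omega>))) = 1 + p * (exp t - 1)" if i: "i \<in> I" for i
  proof -
    note [measurable] = X_measurable[OF i]
    have "(\<lambda>\<omega>. exp (t * indicator A (X i \<omega>))) = (\<lambda>\<omega>. 1 + indicator A (X i \<omega>) * (exp t - 1))"
      by (auto simp: indicator_def)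
    moreover have "expectation (\<lambda>\<omega>. indicator A (X i \<omega>)) = p"
    proof -
      have "p = expectation (\<lambda>\<omega>. indicator {\<omega>. X i \<omega> \<in> A} \<omega>)"
        unfolding p[OF i, symmetric] by (rule prob_eq_expectation_indicator) measurable
      also have "\<dots> = expectation (\<lambda>\<omega>. indicator A (X i \<omega>))"
        by (intro Bochner_Integration.integral_cong) (auto simp: indicator_def)
      finally show ?thesis by simp
    qed
    moreover have "expectation (\<lambda>\<omega>. 1 + indicator A (X i \<omega>) * (exp t - 1))
        = expectation (\<lambda>\<omega>. 1) + expectation (\<lambda>\<omega>. indicator A (X i \<omega>) * (exp t - 1))"
      by (intro expectation_add_bounded bounded_rv_const bounded_rv_mult bounded_hit i A)
    ultimately show ?thesis by (simp add: prob_space)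
  qed
  have "(\<lambda>\<omega>. exp (t * count A \<omega>)) = (\<lambda>\<omega>. \<Prod>i\<in>I. exp (t * indicator A (X i \<omega>)))"
    by (simp add: count_def sum_distrib_left exp_sum[OF fin_I])
  moreover have "expectation (\<lambda>\<omega>. \<Prod>i\<in>I. exp (t * indicator A (X i \<omega>)))
      = (\<Prod>i\<in>I. expectation (\<lambda>\<omega>. exp (t * indicator A (X i \<omega>))))"
  proof (rule indep_vars_lebesgue_integral[OF fin_I])
    show "indep_vars (\<lambda>_. borel) (\<lambda>i \<omega>. exp (t * indicator A (X i \<omega>))) I"
      by (rule indep_vars_compose2[OF indep_X]) measurable
  qed (intro bounded_rv_integrable bounded_rv_exp bounded_rv_mult bounded_rv_const bounded_hit A)
  ultimately have "expectation (\<lambda>\<omega>. exp (t * count A \<omega>)) = (1 + p * (exp t - 1)) ^ card I"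
    using e by simp
  also have "\<dots> \<le> exp (p * (t + t\<^sup>2)) ^ card I"
  proof (cases "I = {}")
    case False
    then have p0: "0 \<le> p" "p \<le> 1" using p by (metis all_not_in_conv measure_nonneg, metis all_not_in_conv prob_le_1)
    show ?thesis
    proof (rule power_mono)
      have "1 + p * (exp t - 1) \<le> 1 + p * (t + t\<^sup>2)"
        using exp_le_quadratic[OF t] p0 by (intro add_left_mono mult_left_mono) auto
      also have "\<dots> \<le> exp (p * (t + t\<^sup>2))" by (rule exp_ge_add_one_self)
      finally show "1 + p * (exp t - 1) \<le> exp (p * (t + t\<^sup>2))" .
      have "0 \<le> (1 - p) + p * exp t" using p0 by (intro add_nonneg_nonneg mult_nonneg_nonneg) auto
      then show "0 \<le> 1 + p * (exp t - 1)" by (simp add: algebra_simps)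
    qed
  qed simp
  also have "\<dots> = exp (card I * p * (t + t\<^sup>2))"
    by (simp add: exp_of_nat_mult[symmetric] mult_ac)
  finally show ?thesis .
qed

text \<open>A grid of events common to both trimming edges. The expected count of \<open>A j\<close>
  is \<open>j * sqrt k\<close> below the target \<open>k\<close>, that of \<open>B j\<close> as much
  above it, so an excess of the one or a shortfall of the other is a deviation of at least
  \<open>j\<close> units \<open>sqrt k\<close>. \<open>J \<le> sqrt k\<close> keeps the expected
  counts between 0 and \<open>2 * k\<close>, and \<open>4 \<le> k\<close> makes the exponent
  \<open>2 / sqrt k\<close> at most 1, as \<open>count_mgf\<close> requires.\<close>

definition tail_sets :: "real \<Rightarrow> nat \<Rightarrow> (nat \<Rightarrow> real set) \<Rightarrow> (nat \<Rightarrow> real set) \<Rightarrow> bool" where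
  "tail_sets k J A B \<longleftrightarrow> I \<noteq> {} \<and> 4 \<le> k \<and> real J \<le> sqrt k \<and>
     (\<forall>j\<le>J. A j \<in> sets borel \<and> B j \<in> sets borel \<and>
       (\<forall>i\<in>I. card I * prob {\<omega>\<in>space M. X i \<omega> \<in> A j} = k - j * sqrt k \<and>
              card I * prob {\<omega>\<in>space M. X i \<omega> \<in> B j} = k + j * sqrt k))"

lemma tail_setsD:
  assumes "tail_sets k J A B"
  shows "\<And>j. j \<le> J \<Longrightarrow> A j \<in> sets borel" "\<And>j. j \<le> J \<Longrightarrow> B j \<in> sets borel"
    "4 \<le> k" "real J \<le> sqrt k" "2 \<le> sqrt k" "sqrt k * sqrt k = k"
proof -
  show "\<And>j. j \<le> J \<Longrightarrow> A j \<in> sets borel" "\<And>j. j \<le> J \<Longrightarrow> B j \<in> sets borel"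
    and k: "4 \<le> k" and "real J \<le> sqrt k"
    using assms by (auto simp: tail_sets_def)
  show "2 \<le> sqrt k" "sqrt k * sqrt k = k"
    using k real_sqrt_le_mono[OF k] by auto
qed

text \<open>In the quadratic term the expected count is replaced by its upper bound,
  \<open>k\<close> for \<open>A j\<close> and \<open>2 * k\<close> for \<open>B j\<close>; the
  linear term provides the decay in \<open>j\<close>.\<close>

lemma tail_sets_mgf:
  assumes t: "tail_sets k J A B" "j \<le> J" and s: "0 \<le> s" "s \<le> 1"
  shows "expectation (\<lambda>\<omega>. exp (s * (count (A j) \<omega> - k))) \<le> exp (- real j * sqrt k * s + k * s\<^sup>2)"
    and "expectation (\<lambda>\<omega>. exp (s * (k - count (B j) \<omega>))) \<le> exp (- real j * sqrt k * s + 2 * k * s\<^sup>2)"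
proof -
  note d = tail_setsD[OF t(1)]
  have "j * sqrt k \<le> sqrt k * sqrt k"
    using d t(2) by (intro mult_right_mono) auto
  then have jr: "0 \<le> j * sqrt k" "j * sqrt k \<le> k" using d by auto
  have n: "card I > 0" using t fin_I by (auto simp: tail_sets_def card_gt_0_iff)
  then have eq: "real (card I) * (x / real (card I)) = x" for x by simp
  have "expectation (\<lambda>\<omega>. exp (s * count (A j) \<omega>)) \<le> exp (card I * ((k - j * sqrt k) / card I) * (s + s\<^sup>2))"
    using t n s d by (intro count_mgf) (auto simp: tail_sets_def field_simps)
  also have "\<dots> \<le> exp (s * k + (- real j * sqrt k * s + k * s\<^sup>2))"
    using mult_nonneg_nonneg[OF jr(1) zero_le_power2[of s]] unfolding eq by (simp add: algebra_simps)
  finally have 1: "expectation (\<lambda>\<omega>. exp (s * count (A j) \<omega>)) \<le> exp (s * k + (- real j * sqrt k * s + k * s\<^sup>2))" .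
  have "expectation (\<lambda>\<omega>. exp (s * (count (A j) \<omega> - k))) = exp (- (s * k)) * expectation (\<lambda>\<omega>. exp (s * count (A j) \<omega>))"
  proof -
    have "exp (s * (count (A j) \<omega> - k)) = exp (- (s * k)) * exp (s * count (A j) \<omega>)" for \<omega>
      by (simp add: mult_exp_exp right_diff_distrib)
    then show ?thesis by simp
  qed
  also have "\<dots> \<le> exp (- (s * k)) * exp (s * k + (- real j * sqrt k * s + k * s\<^sup>2))"
    by (intro mult_left_mono 1) simp
  also have "\<dots> = exp (- real j * sqrt k * s + k * s\<^sup>2)" by (simp add: exp_add[symmetric])
  finally show "expectation (\<lambda>\<omega>. exp (s * (count (A j) \<omega> - k))) \<le> exp (- real j * sqrt k * s + k * s\<^sup>2)" .
  have "expectation (\<lambda>\<omega>. exp ((- s) * count (B j) \<omega>)) \<le> exp (card I * ((k + j * sqrt k) / card I) * (- s + (- s)\<^sup>2))"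
    using t n s d by (intro count_mgf) (auto simp: tail_sets_def field_simps)
  also have "\<dots> \<le> exp (- (s * k) + (- real j * sqrt k * s + 2 * k * s\<^sup>2))"
    using mult_right_mono[OF jr(2) zero_le_power2[of s]] unfolding eq by (simp add: algebra_simps)
  finally have 2: "expectation (\<lambda>\<omega>. exp ((- s) * count (B j) \<omega>)) \<le> exp (- (s * k) + (- real j * sqrt k * s + 2 * k * s\<^sup>2))" .
  have "expectation (\<lambda>\<omega>. exp (s * (k - count (B j) \<omega>))) = exp (s * k) * expectation (\<lambda>\<omega>. exp ((- s) * count (B j) \<omega>))"
  proof -
    have "exp (s * (k - count (B j) \<omega>)) = exp (s * k) * exp ((- s) * count (B j) \<omega>)" for \<omega>
      by (simp add: mult_exp_exp right_diff_distrib)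
    then show ?thesis by simp
  qed
  also have "\<dots> \<le> exp (s * k) * exp (- (s * k) + (- real j * sqrt k * s + 2 * k * s\<^sup>2))"
    by (intro mult_left_mono 2) simp
  also have "\<dots> = exp (- real j * sqrt k * s + 2 * k * s\<^sup>2)" by (simp add: exp_add[symmetric])
  finally show "expectation (\<lambda>\<omega>. exp (s * (k - count (B j) \<omega>))) \<le> exp (- real j * sqrt k * s + 2 * k * s\<^sup>2)" .
qed

lemma bounded_exp_count:
  assumes "A \<in> sets borel"
  shows "bounded_rv (\<lambda>\<omega>. exp (s * (count A \<omega> - k)))" "bounded_rv (\<lambda>\<omega>. exp (s * (k - count A \<omega>)))"
  by (intro bounded_rv_exp bounded_rv_intros bounded_count assms)+

lemma tail_sets_prob:
  assumes t: "tail_sets k J A B"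
  shows "prob {\<omega>\<in>space M. k < count (A J) \<omega>} \<le> exp (- (real J)\<^sup>2 / 8)"
    and "prob {\<omega>\<in>space M. count (B J) \<omega> < k} \<le> exp (- (real J)\<^sup>2 / 8)"
proof -
  note d = tail_setsD[OF t]
  note [measurable] = bounded_rv_measurable[OF bounded_count[OF d(1)[OF order_refl]]]
    bounded_rv_measurable[OF bounded_count[OF d(2)[OF order_refl]]]
  \<comment> \<open>The minimizer of \<open>- J * sqrt k * s + 2 * k * s^2\<close>, the exponent for
    \<open>B J\<close>; at this \<open>s\<close> the exponent for \<open>A J\<close> is no
    larger.\<close>
  define s where "s = J / (4 * sqrt k)"
  have s: "0 \<le> s" "s \<le> 1" using d by (auto simp: s_def field_simps)
  have s2: "J * sqrt k * s = (real J)\<^sup>2 / 4" "k * s\<^sup>2 = (real J)\<^sup>2 / 16"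
  proof -
    show "J * sqrt k * s = (real J)\<^sup>2 / 4"
      using d by (simp add: s_def field_simps power2_eq_square)
    have "k * s\<^sup>2 = (sqrt k)\<^sup>2 * s\<^sup>2" using d by simp
    also have "\<dots> = (sqrt k * s)\<^sup>2" by (simp add: power_mult_distrib)
    also have "sqrt k * s = J / 4" using d by (simp add: s_def)
    finally show "k * s\<^sup>2 = (real J)\<^sup>2 / 16" by (simp add: power_divide)
  qed
  have "prob {\<omega>\<in>space M. k < count (A J) \<omega>} = expectation (\<lambda>\<omega>. indicator {\<omega>. k < count (A J) \<omega>} \<omega>)"
    by (rule prob_eq_expectation_indicator) measurable
  also have "\<dots> \<le> expectation (\<lambda>\<omega>. exp (s * (count (A J) \<omega> - k)))"
  proof (rule expectation_mono_bounded)
    show "bounded_rv (\<lambda>\<omega>. indicator {\<omega>. k < count (A J) \<omega>} \<omega>)"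
      by (rule bounded_rv_indicator) measurable
  qed (use s d in \<open>auto simp: indicator_def intro!: bounded_exp_count\<close>)
  also have "\<dots> \<le> exp (- real J * sqrt k * s + k * s\<^sup>2)"
    by (rule tail_sets_mgf[OF t order_refl s])
  also have "\<dots> \<le> exp (- (real J)\<^sup>2 / 8)"
    unfolding exp_le_cancel_iff using s2 zero_le_power2[of "real J"] by linarith
  finally show "prob {\<omega>\<in>space M. k < count (A J) \<omega>} \<le> exp (- (real J)\<^sup>2 / 8)" .
  have "prob {\<omega>\<in>space M. count (B J) \<omega> < k} = expectation (\<lambda>\<omega>. indicator {\<omega>. count (B J) \<omega> < k} \<omega>)"
    by (rule prob_eq_expectation_indicator) measurable
  also have "\<dots> \<le> expectation (\<lambda>\<omega>. exp (s * (k - count (B J) \<omega>)))"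
  proof (rule expectation_mono_bounded)
    show "bounded_rv (\<lambda>\<omega>. indicator {\<omega>. count (B J) \<omega> < k} \<omega>)"
      by (rule bounded_rv_indicator) measurable
  qed (use s d in \<open>auto simp: indicator_def intro!: bounded_exp_count\<close>)
  also have "\<dots> \<le> exp (- real J * sqrt k * s + 2 * k * s\<^sup>2)"
    by (rule tail_sets_mgf[OF t order_refl s])
  also have "\<dots> \<le> exp (- (real J)\<^sup>2 / 8)"
    unfolding exp_le_cancel_iff using s2 zero_le_power2[of "real J"] by linarith
  finally show "prob {\<omega>\<in>space M. count (B J) \<omega> < k} \<le> exp (- (real J)\<^sup>2 / 8)" .
qed

text \<open>The exponent \<open>2 / sqrt k\<close> is the one by which
  \<open>square_excess_le\<close> will control second moments in units of \<open>sqrt k\<close>. It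
  yields \<open>4 - 2 * j\<close> for \<open>A j\<close> and \<open>8 - 2 * j\<close> for
  \<open>B j\<close>; the larger value is kept.\<close>

lemma tail_sets_exp_excess:
  assumes t: "tail_sets k J A B" "j \<le> J"
  shows "expectation (\<lambda>\<omega>. exp (2 / sqrt k * (count (A j) \<omega> - k))) \<le> exp (8 - 2 * real j)"
    and "expectation (\<lambda>\<omega>. exp (2 / sqrt k * (k - count (B j) \<omega>))) \<le> exp (8 - 2 * real j)"
proof -
  note d = tail_setsD[OF t(1)]
  have s: "0 \<le> 2 / sqrt k" "2 / sqrt k \<le> 1" using d by auto
  have e: "- real j * sqrt k * (2 / sqrt k) = - 2 * real j" "k * (2 / sqrt k)\<^sup>2 = 4"
    using d by (auto simp: power_divide)
  show "expectation (\<lambda>\<omega>. exp (2 / sqrt k * (count (A j) \<omega> - k))) \<le> exp (8 - 2 * real j)"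
    by (rule order_trans[OF tail_sets_mgf(1)[OF t s]]) (use e in simp)
  show "expectation (\<lambda>\<omega>. exp (2 / sqrt k * (k - count (B j) \<omega>))) \<le> exp (8 - 2 * real j)"
    by (rule order_trans[OF tail_sets_mgf(2)[OF t s]]) (use e in simp)
qed

definition count_without :: "'i \<Rightarrow> real set \<Rightarrow> 'a \<Rightarrow> real" where
  "count_without i A \<omega> = (\<Sum>l\<in>I-{i}. indicator A (X l \<omega>))"

lemma count_eq: "i \<in> I \<Longrightarrow> count A \<omega> = count_without i A \<omega> + indicator A (X i \<omega>)"
  using fin_I by (simp add: count_def count_without_def sum.remove)

lemma bounded_count_without: "A \<in> sets borel \<Longrightarrow> bounded_rv (count_without i A)"
  unfolding count_without_def[abs_def] by (intro bounded_rv_sum bounded_hit) auto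

text \<open>Squaring \<open>x \<le> r * exp (x / r)\<close>: the second moment of an excess is then
  controlled by a moment generating function.\<close>

lemma square_excess_le:
  fixes x r :: real
  assumes "0 < r"
  shows "(max 0 x)\<^sup>2 \<le> r\<^sup>2 * exp (2 / r * x)"
proof -
  have "max 0 x \<le> r * exp (x / r)" using le_mult_exp[OF assms, of x] assms by simp
  then have "(max 0 x)\<^sup>2 \<le> (r * exp (x / r))\<^sup>2" by (intro power_mono) auto
  also have "\<dots> = r\<^sup>2 * exp (2 / r * x)"
    by (simp add: power_mult_distrib power2_eq_square exp_add[symmetric])
  finally show ?thesis .
qed

text \<open>Dropping one observation changes the excess only if that observation lies in the set and
  the excess is positive; summed over the observations this is the count itself.\<close>

lemma sum_excess_without_le:
  assumes k: "4 \<le> k"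
  shows "(\<Sum>i\<in>I. \<bar>max 0 (count A \<omega> - k) - max 0 (count_without i A \<omega> - k)\<bar>)
      \<le> k * exp (2 / sqrt k * (count A \<omega> - k))" (is ?low)
    and "(\<Sum>i\<in>I. \<bar>max 0 (k - count A \<omega>) - max 0 (k - count_without i A \<omega>)\<bar>)
      \<le> exp 2 * k * exp (2 / sqrt k * (k - count A \<omega>))" (is ?high)
proof -
  define S where "S = count A \<omega>"
  have S0: "0 \<le> S" by (simp add: S_def count_def sum_nonneg)
  have r: "2 \<le> sqrt k" "sqrt k \<le> k" "sqrt k * sqrt k = k"
  proof -
    show r2: "2 \<le> sqrt k" and rr: "sqrt k * sqrt k = k" using k real_sqrt_le_mono[OF k] by auto
    show "sqrt k \<le> k" using mult_left_mono[of 1 "sqrt k" "sqrt k"] r2 rr by linarith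
  qed
  have "(\<Sum>i\<in>I. \<bar>max 0 (count A \<omega> - k) - max 0 (count_without i A \<omega> - k)\<bar>)
      \<le> (\<Sum>i\<in>I. indicator A (X i \<omega>) * (if k < S then 1 else 0))"
  proof (rule sum_mono)
    fix i assume "i \<in> I"
    from count_eq[OF this, of A \<omega>]
    show "\<bar>max 0 (count A \<omega> - k) - max 0 (count_without i A \<omega> - k)\<bar>
      \<le> indicator A (X i \<omega>) * (if k < S then 1 else 0)"
      by (auto simp: indicator_def S_def max_def)
  qed
  also have "\<dots> = S * (if k < S then 1 else 0)"
    by (simp add: S_def count_def sum_distrib_right)
  also have "\<dots> \<le> k * exp (2 / sqrt k * (S - k))"
  proof (cases "k < S")
    case True
    have "S \<le> k * (1 + (S - k) / k)" using k by (simp add: field_simps)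
    also have "\<dots> \<le> k * exp ((S - k) / k)" using k by (intro mult_left_mono exp_ge_add_one_self) auto
    also have "(S - k) / k \<le> 2 / sqrt k * (S - k)"
    proof -
      have "1 / k \<le> 2 / sqrt k" using r k by (intro frac_le) auto
      then show ?thesis using True mult_right_mono[of "1 / k" "2 / sqrt k" "S - k"] by simp
    qed
    finally show ?thesis using True k by simp
  qed (use k in simp)
  finally show ?low by (simp add: S_def)
  \<comment> \<open>The threshold is \<open>k + 1\<close> and not \<open>k\<close>: dropping an
    observation lowers the count by one, so a shortfall can appear although
    \<open>S \<ge> k\<close>.\<close>
  have "(\<Sum>i\<in>I. \<bar>max 0 (k - count A \<omega>) - max 0 (k - count_without i A \<omega>)\<bar>)
      \<le> (\<Sum>i\<in>I. indicator A (X i \<omega>) * (if S < k + 1 then 1 else 0))"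
  proof (rule sum_mono)
    fix i assume "i \<in> I"
    from count_eq[OF this, of A \<omega>]
    show "\<bar>max 0 (k - count A \<omega>) - max 0 (k - count_without i A \<omega>)\<bar>
      \<le> indicator A (X i \<omega>) * (if S < k + 1 then 1 else 0)"
      by (auto simp: indicator_def S_def max_def)
  qed
  also have "\<dots> = S * (if S < k + 1 then 1 else 0)"
    by (simp add: S_def count_def sum_distrib_right)
  also have "\<dots> \<le> exp 2 * k * exp (2 / sqrt k * (k - S))"
  proof (cases "S < k + 1")
    case True
    \<comment> \<open>When \<open>S\<close> exceeds \<open>k\<close> the exponent is negative, but
      it is at least -1; the factor \<open>exp 2\<close> absorbs this together with
      \<open>S \<le> 2 * k \<le> exp 1 * k\<close>.\<close>
    have e: "-1 \<le> 2 / sqrt k * (k - S)"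
    proof -
      have "2 / sqrt k * (-1) \<le> 2 / sqrt k * (k - S)" using True r by (intro mult_left_mono) auto
      moreover have "2 / sqrt k \<le> 1" using r by simp
      ultimately show ?thesis by linarith
    qed
    have "S \<le> 2 * k" using True k by simp
    also have "\<dots> \<le> exp 1 * k" using exp_ge_add_one_self[of 1] k by (intro mult_right_mono) auto
    also have "\<dots> = exp 2 * k * exp (-1)" by (simp add: exp_add[symmetric])
    also have "\<dots> \<le> exp 2 * k * exp (2 / sqrt k * (k - S))"
      using e k by (intro mult_left_mono) auto
    finally show ?thesis using True by simp
  qed (use k in simp)
  finally show ?high by (simp add: S_def)
qed

end

text \<open>Summands and counts are functions of the same observations, so dropping the
  \<open>i\<close>-th one makes \<open>W_without i\<close> and the reduced counts jointly
  independent of \<open>h (X i)\<close>.\<close>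

locale standardized_sample = indep_sample M I X + standardized_sum M I "\<lambda>i \<omega>. h (X i \<omega>)" K
  for M :: "'a measure" and I :: "'i set" and X h K +
  assumes h_measurable: "h \<in> borel_measurable borel"
begin

text \<open>Multiplied by the length of a grid step, this bounds a defect as long as the grid
  reaches far enough.\<close>

definition excess :: "real \<Rightarrow> nat \<Rightarrow> (nat \<Rightarrow> real set) \<Rightarrow> (nat \<Rightarrow> real set) \<Rightarrow> 'a \<Rightarrow> real" where
  "excess k J A B \<omega> = (\<Sum>j<J. max 0 (count (A j) \<omega> - k) + max 0 (k - count (B j) \<omega>))"

definition excess_without :: "'i \<Rightarrow> real \<Rightarrow> nat \<Rightarrow> (nat \<Rightarrow> real set) \<Rightarrow> (nat \<Rightarrow> real set) \<Rightarrow> 'a \<Rightarrow> real" where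
  "excess_without i k J A B \<omega> =
     (\<Sum>j<J. max 0 (count_without i (A j) \<omega> - k) + max 0 (k - count_without i (B j) \<omega>))"

text \<open>Cauchy-Schwarz with \<open>E W^2 = 1\<close>, in the form of the weighted inequality
  \<open>2 * a * w * v \<le> a^2 * w^2 + v^2\<close>.\<close>

lemma expectation_abs_W_mult_le:
  assumes V: "bounded_rv V" "expectation (\<lambda>\<omega>. (V \<omega>)\<^sup>2) \<le> a\<^sup>2" and a: "0 < a"
  shows "expectation (\<lambda>\<omega>. \<bar>W \<omega>\<bar> * V \<omega>) \<le> a"
proof -
  have "expectation (\<lambda>\<omega>. \<bar>W \<omega>\<bar> * V \<omega>) \<le> expectation (\<lambda>\<omega>. a / 2 * (W \<omega>)\<^sup>2 + 1 / (2 * a) * (V \<omega>)\<^sup>2)"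
  proof (rule expectation_mono_bounded)
    fix \<omega>
    define w v where "w = \<bar>W \<omega>\<bar>" and "v = V \<omega>"
    have "0 \<le> (a * w - v)\<^sup>2" by simp
    then have "2 * a * (w * v) \<le> a\<^sup>2 * w\<^sup>2 + v\<^sup>2" by (simp add: power2_diff power_mult_distrib mult_ac)
    then have "w * v \<le> a / 2 * w\<^sup>2 + 1 / (2 * a) * v\<^sup>2"
      using a by (simp add: field_simps power2_eq_square)
    then show "\<bar>W \<omega>\<bar> * V \<omega> \<le> a / 2 * (W \<omega>)\<^sup>2 + 1 / (2 * a) * (V \<omega>)\<^sup>2"
      by (simp only: w_def v_def power2_abs)
  qed (intro bounded_rv_intros bounded_W V(1))+
  also have "\<dots> = a / 2 + 1 / (2 * a) * expectation (\<lambda>\<omega>. (V \<omega>)\<^sup>2)"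
    by (subst expectation_add_bounded)
       (intro bounded_rv_intros bounded_W V(1), intro bounded_rv_intros V(1), simp add: expectation_W_square)
  also have "\<dots> \<le> a / 2 + 1 / (2 * a) * a\<^sup>2"
    using V a by (intro add_left_mono mult_left_mono) auto
  also have "\<dots> = a" using a by (simp add: power2_eq_square)
  finally show ?thesis .
qed

lemma excess_facts:
  assumes t: "tail_sets k J A B"
  shows "bounded_rv (excess k J A B)" "0 \<le> excess k J A B \<omega>"
    "i \<in> I \<Longrightarrow> bounded_rv (excess_without i k J A B)" "0 \<le> excess_without i k J A B \<omega>"
  unfolding excess_def[abs_def] excess_without_def[abs_def]
  using tail_setsD[OF t]
  by (auto intro!: bounded_rv_sum bounded_rv_add bounded_rv_max bounded_rv_diff bounded_count
      bounded_count_without bounded_rv_const sum_nonneg add_nonneg_nonneg)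

text \<open>The excess at the \<open>j\<close>-th point has second moment at most
  \<open>k * exp (8 - 2 * j)\<close>. Its contribution therefore decays like
  \<open>exp (- j)\<close>, and the sum over the grid is bounded independently of
  \<open>J\<close>.\<close>

lemma expectation_W_excess:
  assumes t: "tail_sets k J A B"
  shows "expectation (\<lambda>\<omega>. \<bar>W \<omega>\<bar> * excess k J A B \<omega>) \<le> 4 * exp 4 * sqrt k"
proof -
  note d = tail_setsD[OF t]
  have r: "0 < sqrt k" "(sqrt k)\<^sup>2 = k" using d by auto
  have sq: "(max 0 x)\<^sup>2 \<le> k * exp (2 / sqrt k * x)" for x
    using square_excess_le[OF r(1), of x] unfolding r(2) .
  define a where "a j = sqrt k * exp (4 - real j)" for j :: nat
  have a: "0 < a j" "(a j)\<^sup>2 = k * exp (8 - 2 * real j)" for j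
    using r d by (auto simp: a_def power_mult_distrib power2_eq_square[of "exp _"] exp_add[symmetric])
  have bA: "bounded_rv (\<lambda>\<omega>. max 0 (count (A j) \<omega> - k))" "bounded_rv (\<lambda>\<omega>. max 0 (k - count (B j) \<omega>))" if "j < J" for j
    using d that by (auto intro!: bounded_rv_max bounded_rv_diff bounded_count bounded_rv_const)
  have 1: "expectation (\<lambda>\<omega>. \<bar>W \<omega>\<bar> * max 0 (count (A j) \<omega> - k)) \<le> a j" if j: "j < J" for j
  proof (rule expectation_abs_W_mult_le[OF bA(1)[OF j] _ a(1)])
    have "expectation (\<lambda>\<omega>. (max 0 (count (A j) \<omega> - k))\<^sup>2) \<le> expectation (\<lambda>\<omega>. k * exp (2 / sqrt k * (count (A j) \<omega> - k)))"
      using j by (intro expectation_mono_bounded sq bounded_rv_power2 bA bounded_rv_mult bounded_rv_const bounded_exp_count d)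
         simp_all
    also have "\<dots> = k * expectation (\<lambda>\<omega>. exp (2 / sqrt k * (count (A j) \<omega> - k)))" by simp
    also have "\<dots> \<le> (a j)\<^sup>2"
      unfolding a using d j by (intro mult_left_mono tail_sets_exp_excess[OF t]) auto
    finally show "expectation (\<lambda>\<omega>. (max 0 (count (A j) \<omega> - k))\<^sup>2) \<le> (a j)\<^sup>2" .
  qed
  have 2: "expectation (\<lambda>\<omega>. \<bar>W \<omega>\<bar> * max 0 (k - count (B j) \<omega>)) \<le> a j" if j: "j < J" for j
  proof (rule expectation_abs_W_mult_le[OF bA(2)[OF j] _ a(1)])
    have "expectation (\<lambda>\<omega>. (max 0 (k - count (B j) \<omega>))\<^sup>2) \<le> expectation (\<lambda>\<omega>. k * exp (2 / sqrt k * (k - count (B j) \<omega>)))"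
      using j by (intro expectation_mono_bounded sq bounded_rv_power2 bA bounded_rv_mult bounded_rv_const bounded_exp_count d)
         simp_all
    also have "\<dots> = k * expectation (\<lambda>\<omega>. exp (2 / sqrt k * (k - count (B j) \<omega>)))" by simp
    also have "\<dots> \<le> (a j)\<^sup>2"
      unfolding a using d j by (intro mult_left_mono tail_sets_exp_excess[OF t]) auto
    finally show "expectation (\<lambda>\<omega>. (max 0 (k - count (B j) \<omega>))\<^sup>2) \<le> (a j)\<^sup>2" .
  qed
  have bW: "bounded_rv (\<lambda>\<omega>. \<bar>W \<omega>\<bar> * max 0 (count (A j) \<omega> - k))" "bounded_rv (\<lambda>\<omega>. \<bar>W \<omega>\<bar> * max 0 (k - count (B j) \<omega>))"
    if "j < J" for j using that by (auto intro!: bounded_rv_mult bounded_rv_abs bounded_W bA)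
  have "expectation (\<lambda>\<omega>. \<bar>W \<omega>\<bar> * excess k J A B \<omega>)
      = (\<Sum>j<J. expectation (\<lambda>\<omega>. \<bar>W \<omega>\<bar> * max 0 (count (A j) \<omega> - k) + \<bar>W \<omega>\<bar> * max 0 (k - count (B j) \<omega>)))"
    unfolding excess_def sum_distrib_left distrib_left
    by (rule expectation_sum_bounded) (auto intro!: bounded_rv_add bW)
  also have "\<dots> = (\<Sum>j<J. expectation (\<lambda>\<omega>. \<bar>W \<omega>\<bar> * max 0 (count (A j) \<omega> - k))
      + expectation (\<lambda>\<omega>. \<bar>W \<omega>\<bar> * max 0 (k - count (B j) \<omega>)))"
    by (intro sum.cong refl expectation_add_bounded bW) auto
  also have "\<dots> \<le> (\<Sum>j<J. a j + a j)" by (intro sum_mono add_mono 1 2) auto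
  also have "\<dots> = 2 * exp 4 * sqrt k * (\<Sum>j<J. exp (- real j))"
    by (simp add: a_def sum_distrib_left exp_diff exp_minus field_simps)
  also have "\<dots> \<le> 2 * exp 4 * sqrt k * 2"
    using r by (intro mult_left_mono sum_exp_minus_le_2) auto
  finally show ?thesis by simp
qed

text \<open>\<open>\<bar>h\<bar> \<le> K\<close> is taken out before the sum over \<open>i\<close>;
  the influences at one grid point then add up to a multiple of \<open>k\<close> times exponentials
  whose expectations decay along the grid.\<close>

lemma expectation_excess_diff:
  assumes t: "tail_sets k J A B"
  shows "(\<Sum>i\<in>I. expectation (\<lambda>\<omega>. \<bar>h (X i \<omega>)\<bar> * \<bar>excess k J A B \<omega> - excess_without i k J A B \<omega>\<bar>))
    \<le> 4 * exp 10 * K * k"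
proof -
  note d = tail_setsD[OF t]
  define E where "E j \<omega> = k * exp (2 / sqrt k * (count (A j) \<omega> - k))
      + exp 2 * k * exp (2 / sqrt k * (k - count (B j) \<omega>))" for j \<omega>
  have bE: "bounded_rv (E j)" if "j < J" for j
    unfolding E_def[abs_def] using that
    by (intro bounded_rv_add bounded_rv_mult bounded_rv_const bounded_exp_count d) simp_all
  note bi = bounded_rv_mult bounded_rv_abs bounded_xi bounded_rv_diff excess_facts[OF t]
  have "(\<Sum>i\<in>I. expectation (\<lambda>\<omega>. \<bar>h (X i \<omega>)\<bar> * \<bar>excess k J A B \<omega> - excess_without i k J A B \<omega>\<bar>))
      = expectation (\<lambda>\<omega>. \<Sum>i\<in>I. \<bar>h (X i \<omega>)\<bar> * \<bar>excess k J A B \<omega> - excess_without i k J A B \<omega>\<bar>)"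
    by (rule expectation_sum_bounded[symmetric]) (intro bi)
  also have "\<dots> \<le> expectation (\<lambda>\<omega>. K * (\<Sum>j<J. E j \<omega>))"
  proof (rule expectation_mono_bounded)
    fix \<omega> assume \<omega>: "\<omega> \<in> space M"
    have "(\<Sum>i\<in>I. \<bar>h (X i \<omega>)\<bar> * \<bar>excess k J A B \<omega> - excess_without i k J A B \<omega>\<bar>)
        \<le> (\<Sum>i\<in>I. K * (\<Sum>j<J. \<bar>max 0 (count (A j) \<omega> - k) - max 0 (count_without i (A j) \<omega> - k)\<bar>
            + \<bar>max 0 (k - count (B j) \<omega>) - max 0 (k - count_without i (B j) \<omega>)\<bar>))"
    proof (rule sum_mono)
      fix i assume i: "i \<in> I"
      have "\<bar>excess k J A B \<omega> - excess_without i k J A B \<omega>\<bar>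
          \<le> (\<Sum>j<J. \<bar>max 0 (count (A j) \<omega> - k) - max 0 (count_without i (A j) \<omega> - k)\<bar>
            + \<bar>max 0 (k - count (B j) \<omega>) - max 0 (k - count_without i (B j) \<omega>)\<bar>)"
        unfolding excess_def excess_without_def sum_subtractf[symmetric]
      proof (rule order_trans[OF sum_abs sum_mono])
        fix j
        show "\<bar>(max 0 (count (A j) \<omega> - k) + max 0 (k - count (B j) \<omega>))
            - (max 0 (count_without i (A j) \<omega> - k) + max 0 (k - count_without i (B j) \<omega>))\<bar>
          \<le> \<bar>max 0 (count (A j) \<omega> - k) - max 0 (count_without i (A j) \<omega> - k)\<bar>
            + \<bar>max 0 (k - count (B j) \<omega>) - max 0 (k - count_without i (B j) \<omega>)\<bar>"
          by linarith
      qed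
      then show "\<bar>h (X i \<omega>)\<bar> * \<bar>excess k J A B \<omega> - excess_without i k J A B \<omega>\<bar>
        \<le> K * (\<Sum>j<J. \<bar>max 0 (count (A j) \<omega> - k) - max 0 (count_without i (A j) \<omega> - k)\<bar>
            + \<bar>max 0 (k - count (B j) \<omega>) - max 0 (k - count_without i (B j) \<omega>)\<bar>)"
        using xi_le[OF i \<omega>] by (intro mult_mono) auto
    qed
    also have "\<dots> = K * (\<Sum>j<J. (\<Sum>i\<in>I. \<bar>max 0 (count (A j) \<omega> - k) - max 0 (count_without i (A j) \<omega> - k)\<bar>)
            + (\<Sum>i\<in>I. \<bar>max 0 (k - count (B j) \<omega>) - max 0 (k - count_without i (B j) \<omega>)\<bar>))"
      unfolding sum_distrib_left[symmetric] by (subst sum.swap) (simp only: sum.distrib)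
    also have "\<dots> \<le> K * (\<Sum>j<J. E j \<omega>)"
      unfolding E_def using K_pos d(3) by (intro mult_left_mono sum_mono add_mono sum_excess_without_le) auto
    finally show "(\<Sum>i\<in>I. \<bar>h (X i \<omega>)\<bar> * \<bar>excess k J A B \<omega> - excess_without i k J A B \<omega>\<bar>)
        \<le> K * (\<Sum>j<J. E j \<omega>)" .
  next
    show "bounded_rv (\<lambda>\<omega>. \<Sum>i\<in>I. \<bar>h (X i \<omega>)\<bar> * \<bar>excess k J A B \<omega> - excess_without i k J A B \<omega>\<bar>)"
      by (intro bounded_rv_sum bi)
    show "bounded_rv (\<lambda>\<omega>. K * (\<Sum>j<J. E j \<omega>))"
      by (intro bounded_rv_mult bounded_rv_sum bounded_rv_const bE) auto
  qed
  also have "\<dots> = K * (\<Sum>j<J. expectation (E j))"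
  proof -
    have "expectation (\<lambda>\<omega>. \<Sum>j<J. E j \<omega>) = (\<Sum>j<J. expectation (E j))"
      by (rule expectation_sum_bounded) (simp add: bE)
    then show ?thesis by simp
  qed
  \<comment> \<open>\<open>exp 10\<close> is \<open>exp 8\<close> from the exponential moments times
    \<open>exp 2\<close> from the shortfall terms.\<close>
  also have "\<dots> \<le> K * (\<Sum>j<J. 2 * exp 10 * k * exp (- real j))"
  proof (intro mult_left_mono sum_mono)
    fix j assume "j \<in> {..<J}"
    then have j: "j < J" by simp
    have "expectation (E j) = k * expectation (\<lambda>\<omega>. exp (2 / sqrt k * (count (A j) \<omega> - k)))
        + exp 2 * k * expectation (\<lambda>\<omega>. exp (2 / sqrt k * (k - count (B j) \<omega>)))"
    proof -
      have "bounded_rv (\<lambda>\<omega>. exp (2 / sqrt k * (count (A j) \<omega> - k)))"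
        "bounded_rv (\<lambda>\<omega>. exp (2 / sqrt k * (k - count (B j) \<omega>)))"
        using j by (intro bounded_exp_count d; simp)+
      then show ?thesis
        unfolding E_def[abs_def]
        by (subst expectation_add_bounded; (intro bounded_rv_mult bounded_rv_const)?) simp_all
    qed
    also have "\<dots> \<le> k * exp (8 - 2 * real j) + exp 2 * k * exp (8 - 2 * real j)"
      using d j by (intro add_mono mult_left_mono tail_sets_exp_excess[OF t]) auto
    also have "\<dots> \<le> exp 2 * k * exp (8 - 2 * real j) + exp 2 * k * exp (8 - 2 * real j)"
      using d(3) by (intro add_right_mono mult_right_mono) (auto simp: mult_le_cancel_right1)
    also have "\<dots> = 2 * k * exp (10 - 2 * real j)"
      by (simp add: exp_add[symmetric])
    also have "\<dots> \<le> 2 * k * exp (10 - real j)" using d(3) by (intro mult_left_mono) auto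
    also have "\<dots> = 2 * exp 10 * k * exp (- real j)" by (simp add: exp_diff exp_minus field_simps)
    finally show "expectation (E j) \<le> 2 * exp 10 * k * exp (- real j)" .
  qed (use K_pos in simp)
  also have "\<dots> = K * (2 * exp 10 * k * (\<Sum>j<J. exp (- real j)))" by (simp add: sum_distrib_left)
  also have "\<dots> \<le> K * (2 * exp 10 * k * 2)"
    using K_pos d(3) by (intro mult_left_mono sum_exp_minus_le_2) auto
  finally show ?thesis by (simp add: mult_ac)
qed

text \<open>The nonlinear bound with \<open>D = c * excess\<close>, where \<open>D' i\<close> uses
  the counts without the \<open>i\<close>-th observation. On the right, \<open>c * sqrt k\<close>
  comes from the product moment with \<open>W\<close> and \<open>c * K * k\<close> from the
  influences; for \<open>c\<close> of order \<open>1 / k\<close> they are of order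
  \<open>1 / sqrt k\<close> and \<open>K\<close>.\<close>

lemma excess_berry_esseen:
  assumes t: "tail_sets k J A B" and c: "0 \<le> c"
  shows "\<bar>prob {\<omega>\<in>space M. W \<omega> + c * excess k J A B \<omega> \<le> z} - Phi z\<bar>
      \<le> 64 * K + 8 * exp 10 * (c * sqrt k + c * K * k)"
    and "\<bar>prob {\<omega>\<in>space M. W \<omega> - c * excess k J A B \<omega> \<le> z} - Phi z\<bar>
      \<le> 64 * K + 8 * exp 10 * (c * sqrt k + c * K * k)"
proof -
  note d = tail_setsD[OF t]
  note f = excess_facts[OF t]
  have b: "bounded_rv (\<lambda>\<omega>. c * excess k J A B \<omega>)"
    by (intro bounded_rv_mult bounded_rv_const f)
  have n: "0 \<le> c * excess k J A B \<omega>" for \<omega> using c f by simp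
  have b': "bounded_rv (\<lambda>\<omega>. c * excess_without i k J A B \<omega>)" if "i \<in> I" for i
    by (intro bounded_rv_mult bounded_rv_const f that)
  have n': "0 \<le> c * excess_without i k J A B \<omega>" for i \<omega> using c f by simp
  have ind: "indep_var borel (\<lambda>\<omega>. h (X i \<omega>)) borel (\<lambda>\<omega>. g (W_without i \<omega>, c * excess_without i k J A B \<omega>) :: real)"
    if i: "i \<in> I" and [measurable]: "g \<in> borel_measurable (borel \<Otimes>\<^sub>M borel)" for i g
  proof -
    \<comment> \<open>The pair \<open>(W_without i, D' i)\<close>, composed with \<open>g\<close>,
      as a single function of the observations other than the \<open>i\<close>-th.\<close>
    define G where "G x = g (\<Sum>l\<in>I-{i}. h (x l), c * (\<Sum>j<J. max 0 ((\<Sum>l\<in>I-{i}. indicator (A j) (x l)) - k)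
        + max 0 (k - (\<Sum>l\<in>I-{i}. indicator (B j) (x l)))))" for x :: "'i \<Rightarrow> real"
    note [measurable] = h_measurable
    have [measurable]: "A j \<in> sets borel" "B j \<in> sets borel" if "j < J" for j using d that by auto
    have "(\<lambda>x. \<Sum>j<J. max 0 ((\<Sum>l\<in>I-{i}. indicator (A j) (x l)) - k)
        + max 0 (k - (\<Sum>l\<in>I-{i}. indicator (B j) (x l)))) \<in> borel_measurable (PiM (I - {i}) (\<lambda>_. borel :: real measure))"
      (is "?S \<in> _")
    proof (rule borel_measurable_sum)
      fix j assume "j \<in> {..<J}"
      then have [measurable]: "A j \<in> sets borel" "B j \<in> sets borel" using d by auto
      show "(\<lambda>x. max 0 ((\<Sum>l\<in>I-{i}. indicator (A j) (x l)) - k)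
        + max 0 (k - (\<Sum>l\<in>I-{i}. indicator (B j) (x l)))) \<in> borel_measurable (PiM (I - {i}) (\<lambda>_. borel :: real measure))"
        by measurable
    qed
    then have [measurable]: "G \<in> borel_measurable (PiM (I - {i}) (\<lambda>_. borel))"
      unfolding G_def[abs_def] by measurable
    have "indep_var borel (\<lambda>\<omega>. h (X i \<omega>)) borel (\<lambda>\<omega>. G (\<lambda>l\<in>I-{i}. X l \<omega>))"
      by (rule indep_var_rest[OF indep_X i]) measurable
    moreover have "G (\<lambda>l\<in>I-{i}. X l \<omega>) = g (W_without i \<omega>, c * excess_without i k J A B \<omega>)" for \<omega>
      by (simp add: G_def W_without_def excess_without_def count_without_def)
    ultimately show ?thesis by simp
  qed
  have R: "expectation (\<lambda>\<omega>. \<bar>W \<omega>\<bar> * (c * excess k J A B \<omega>))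
      + 2 * (\<Sum>i\<in>I. expectation (\<lambda>\<omega>. \<bar>h (X i \<omega>)\<bar> * \<bar>c * excess k J A B \<omega> - c * excess_without i k J A B \<omega>\<bar>))
    \<le> 8 * exp 10 * (c * sqrt k + c * K * k)"
  proof -
    have e1: "expectation (\<lambda>\<omega>. \<bar>W \<omega>\<bar> * (c * excess k J A B \<omega>)) = c * expectation (\<lambda>\<omega>. \<bar>W \<omega>\<bar> * excess k J A B \<omega>)"
      by (simp add: mult.left_commute)
    have e2: "\<bar>h (X i \<omega>)\<bar> * \<bar>c * excess k J A B \<omega> - c * excess_without i k J A B \<omega>\<bar>
        = c * (\<bar>h (X i \<omega>)\<bar> * \<bar>excess k J A B \<omega> - excess_without i k J A B \<omega>\<bar>)" for i \<omega>
      using c by (simp add: right_diff_distrib[symmetric] abs_mult mult.left_commute)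
    have "c * expectation (\<lambda>\<omega>. \<bar>W \<omega>\<bar> * excess k J A B \<omega>)
      + 2 * (c * (\<Sum>i\<in>I. expectation (\<lambda>\<omega>. \<bar>h (X i \<omega>)\<bar> * \<bar>excess k J A B \<omega> - excess_without i k J A B \<omega>\<bar>)))
      \<le> c * (4 * exp 4 * sqrt k) + 2 * (c * (4 * exp 10 * K * k))"
      using c by (intro add_mono mult_left_mono expectation_W_excess[OF t] expectation_excess_diff[OF t]) auto
    also have "\<dots> \<le> c * (8 * exp 10 * sqrt k) + 2 * (c * (4 * exp 10 * K * k))"
      using c d(3) by (intro add_right_mono mult_left_mono mult_right_mono mult_mono) auto
    finally show ?thesis
      unfolding e1 e2 by (simp add: sum_distrib_left[symmetric] algebra_simps)
  qed
  show "\<bar>prob {\<omega>\<in>space M. W \<omega> + c * excess k J A B \<omega> \<le> z} - Phi z\<bar>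
      \<le> 64 * K + 8 * exp 10 * (c * sqrt k + c * K * k)"
    by (rule nonlinear_berry_esseen(1)[OF b n b' n' ind R])
  show "\<bar>prob {\<omega>\<in>space M. W \<omega> - c * excess k J A B \<omega> \<le> z} - Phi z\<bar>
      \<le> 64 * K + 8 * exp 10 * (c * sqrt k + c * K * k)"
    by (rule nonlinear_berry_esseen(2)[OF b n b' n' ind R])
qed

end

section \<open>Order statistics and Winsorized sums\<close>

text \<open>Turns a distance into a number of crossed grid points, each of which costs one step
  \<open>D\<close>; distances beyond the last point \<open>x J\<close> are cut off.\<close>

lemma grid_bound:
  fixes x :: "nat \<Rightarrow> real" and v D :: real
  assumes "\<And>j. j < J \<Longrightarrow> x j - x (Suc j) \<le> D" "0 \<le> D"
  shows "max 0 (x 0 - max v (x J)) \<le> D * (\<Sum>j<J. if v < x j then 1 else 0)"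
  using assms
proof (induction J)
  case 0
  then show ?case by simp
next
  case (Suc J)
  have IH: "max 0 (x 0 - max v (x J)) \<le> D * (\<Sum>j<J. if v < x j then 1 else 0)"
    using Suc by simp
  have s: "x J - x (Suc J) \<le> D" using Suc.prems by simp
  show ?case
  proof (cases "v < x J")
    case True
    then have "max 0 (x 0 - max v (x (Suc J))) \<le> max 0 (x 0 - max v (x J)) + D"
      using s \<open>0 \<le> D\<close> by (auto simp: max_def)
    moreover have "D * (\<Sum>j<Suc J. if v < x j then 1 else 0) = D * (\<Sum>j<J. if v < x j then 1 else 0) + D"
      using True by (simp add: distrib_left)
    ultimately show ?thesis using IH by linarith
  next
    case False
    then have "max 0 (x 0 - max v (x (Suc J))) \<le> max 0 (x 0 - max v (x J))"
      by (auto simp: max_def)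
    from order_trans[OF this IH] show ?thesis using False by simp
  qed
qed

section \<open>Counts and defects of sorted lists\<close>

definition list_count :: "real list \<Rightarrow> real \<Rightarrow> nat" where
  "list_count xs a = card {i. i < length xs \<and> xs ! i \<le> a}"

text \<open>In a sorted list the entries up to \<open>a\<close> occupy an initial segment of
  indices; as these start at 0, it consists of the indices below
  \<open>list_count xs a\<close>.\<close>

lemma sorted_nth_le_iff:
  assumes "sorted xs" "i < length xs"
  shows "xs ! i \<le> a \<longleftrightarrow> i < list_count xs a"
proof -
  define S where "S = {i. i < length xs \<and> xs ! i \<le> a}"
  have fin: "finite S" by (simp add: S_def)
  have down: "j \<in> S" if "l \<in> S" "j \<le> l" for j l
  proof -
    have "xs ! j \<le> xs ! l" using that assms(1) by (intro sorted_nth_mono) (auto simp: S_def)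
    then show ?thesis using that by (auto simp: S_def)
  qed
  have "i \<in> S \<longleftrightarrow> i < card S"
  proof
    assume i: "i \<in> S"
    have "{..i} \<subseteq> S" using down[OF i] by auto
    then have "card {..i} \<le> card S" by (rule card_mono[OF fin])
    then show "i < card S" by simp
  next
    assume i: "i < card S"
    show "i \<in> S"
    proof (rule ccontr)
      assume "i \<notin> S"
      then have "S \<subseteq> {..<i}" using down by (metis lessThan_iff not_le_imp_less subsetI)
      then have "card S \<le> card {..<i}" by (rule card_mono[rotated]) simp
      then show False using i by simp
    qed
  qed
  then show ?thesis using assms(2) by (simp add: S_def list_count_def)
qed

lemma list_count_le: "list_count xs a \<le> length xs"
  unfolding list_count_def using card_mono[of "{..<length xs}" "{i. i < length xs \<and> xs ! i \<le> a}"]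
  by auto

text \<open>The defect is the difference between the sum of the \<open>r\<close> smallest entries and the lower
  bound \<open>r c - \<Sum>\<^sub>i (c - x\<^sub>i)\<^sup>+\<close>, which is attained when \<open>c\<close> is the \<open>r\<close>-th smallest entry.\<close>

definition defect :: "nat \<Rightarrow> real \<Rightarrow> real list \<Rightarrow> real" where
  "defect r c xs = (\<Sum>i<r. xs ! i) - r * c + (\<Sum>i<length xs. max 0 (c - xs ! i))"

text \<open>For the first \<open>r\<close> entries,
  \<open>t - c + max 0 (c - t) = max 0 (t - c)\<close>. What remains measures the misplaced entries:
  those among the first \<open>r\<close> above \<open>c\<close>, and those among the others below
  \<open>c\<close>.\<close>

lemma defect_eq:
  assumes "r \<le> length xs"
  shows "defect r c xs = (\<Sum>i<r. max 0 (xs ! i - c)) + (\<Sum>i\<in>{r..<length xs}. max 0 (c - xs ! i))"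
proof -
  have "(\<Sum>i<length xs. max 0 (c - xs ! i)) = (\<Sum>i<r. max 0 (c - xs ! i)) + (\<Sum>i\<in>{r..<length xs}. max 0 (c - xs ! i))"
    using sum.union_disjoint[of "{..<r}" "{r..<length xs}" "\<lambda>i. max 0 (c - xs ! i)"] assms
    by (simp add: ivl_disj_un_one(2) ivl_disj_int_one)
  moreover have "(\<Sum>i<r. xs ! i) - r * c + (\<Sum>i<r. max 0 (c - xs ! i)) = (\<Sum>i<r. max 0 (xs ! i - c))"
  proof -
    have "(\<Sum>i<r. max 0 (xs ! i - c)) = (\<Sum>i<r. xs ! i - c + max 0 (c - xs ! i))"
      by (intro sum.cong) (auto simp: max_def)
    then show ?thesis by (simp add: sum.distrib sum_subtractf)
  qed
  ultimately show ?thesis by (simp add: defect_def)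
qed

lemma defect_nonneg: "r \<le> length xs \<Longrightarrow> 0 \<le> defect r c xs"
  by (simp add: defect_eq sum_nonneg add_nonneg_nonneg)

text \<open>Each misplaced entry pays one step \<open>D\<close> per grid point between it and
  \<open>c\<close>. After exchanging the sums, the number of entries charged to the
  \<open>j\<close>-th point is the excess or the shortfall of the count there. \<open>xJ\<close> and
  \<open>yJ\<close> ensure that no misplaced entry lies beyond the ends of the grid.\<close>

lemma defect_le:
  fixes x y :: "nat \<Rightarrow> real"
  assumes xs: "sorted xs" and r: "r \<le> length xs"
    and x: "x 0 = c" "\<And>j. j < J \<Longrightarrow> x j - x (Suc j) \<le> D"
    and y: "y 0 = c" "\<And>j. j < J \<Longrightarrow> y (Suc j) - y j \<le> D"
    and D: "0 \<le> D"
    and xJ: "list_count xs (x J) \<le> r" and yJ: "r \<le> list_count xs (y J)"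
  shows "defect r c xs \<le> D * (\<Sum>j<J. max 0 (real (list_count xs (x j)) - real r)
      + max 0 (real r - real (list_count xs (y j))))"
proof -
  have 1: "max 0 (c - xs ! i) \<le> D * (\<Sum>j<J. if i < list_count xs (x j) then 1 else 0)"
    if i: "i \<in> {r..<length xs}" for i
  proof -
    have "x J < xs ! i"
      using sorted_nth_le_iff[OF xs, of i "x J"] i xJ by auto
    then have "max 0 (c - xs ! i) = max 0 (x 0 - max (xs ! i) (x J))" using x by simp
    also have "\<dots> \<le> D * (\<Sum>j<J. if xs ! i < x j then 1 else 0)"
      by (intro grid_bound x(2) D)
    also have "\<dots> \<le> D * (\<Sum>j<J. if i < list_count xs (x j) then 1 else 0)"
      using i by (intro mult_left_mono sum_mono D) (auto simp: sorted_nth_le_iff[OF xs, symmetric])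
    finally show ?thesis .
  qed
  have 2: "max 0 (xs ! i - c) \<le> D * (\<Sum>j<J. if list_count xs (y j) \<le> i then 1 else 0)"
    if i: "i \<in> {..<r}" for i
  proof -
    have "xs ! i \<le> y J"
      using sorted_nth_le_iff[OF xs, of i "y J"] i yJ r by auto
    \<comment> \<open>The grid above \<open>c\<close> becomes a descending one by negation.\<close>
    then have "max 0 (xs ! i - c) = max 0 (- y 0 - max (- (xs ! i)) (- y J))" using y by simp
    also have "\<dots> \<le> D * (\<Sum>j<J. if - (xs ! i) < - y j then 1 else 0)"
      using y(2) by (intro grid_bound D) auto
    also have "\<dots> \<le> D * (\<Sum>j<J. if list_count xs (y j) \<le> i then 1 else 0)"
      using i r by (intro mult_left_mono sum_mono D)
         (auto simp: sorted_nth_le_iff[OF xs, symmetric] linorder_not_less[symmetric])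
    finally show ?thesis .
  qed
  have "defect r c xs \<le> (\<Sum>i<r. D * (\<Sum>j<J. if list_count xs (y j) \<le> i then 1 else 0))
      + (\<Sum>i\<in>{r..<length xs}. D * (\<Sum>j<J. if i < list_count xs (x j) then 1 else 0))"
    unfolding defect_eq[OF r] by (intro add_mono sum_mono 1 2)
  also have "\<dots> = D * ((\<Sum>j<J. \<Sum>i<r. if list_count xs (y j) \<le> i then 1 else 0)
      + (\<Sum>j<J. \<Sum>i\<in>{r..<length xs}. if i < list_count xs (x j) then 1 else 0))"
    unfolding sum_distrib_left[symmetric] distrib_left[symmetric] by (subst (1 2) sum.swap) (rule refl)
  also have "(\<lambda>j. \<Sum>i<r. if list_count xs (y j) \<le> i then 1 else (0::real)) = (\<lambda>j. max 0 (real r - real (list_count xs (y j))))"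
  proof
    fix j
    have "{i \<in> {..<r}. list_count xs (y j) \<le> i} = {list_count xs (y j)..<r}" by auto
    then show "(\<Sum>i<r. if list_count xs (y j) \<le> i then 1 else (0::real)) = max 0 (real r - real (list_count xs (y j)))"
      by (simp add: sum.If_cases Int_def max_def of_nat_diff)
  qed
  also have "(\<lambda>j. \<Sum>i\<in>{r..<length xs}. if i < list_count xs (x j) then 1 else (0::real)) = (\<lambda>j. max 0 (real (list_count xs (x j)) - real r))"
  proof
    fix j
    have "{i. r \<le> i \<and> i < length xs \<and> i < list_count xs (x j)} = {r..<list_count xs (x j)}"
      using list_count_le[of xs "x j"] by auto
    then show "(\<Sum>i\<in>{r..<length xs}. if i < list_count xs (x j) then 1 else (0::real)) = max 0 (real (list_count xs (x j)) - real r)"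
      by (simp add: sum.If_cases Int_def max_def of_nat_diff conj_assoc)
  qed
  finally show ?thesis by (simp add: sum.distrib add.commute)
qed

section \<open>The ordered sample and the trimmed sum\<close>

definition sorted_sample :: "(nat \<Rightarrow> 'a \<Rightarrow> real) \<Rightarrow> nat \<Rightarrow> 'a \<Rightarrow> real list" where
  "sorted_sample X n \<omega> = sort (map (\<lambda>j. X j \<omega>) [1..<n + 1])"

lemma sorted_sample_simps:
  "sorted (sorted_sample X n \<omega>)" "length (sorted_sample X n \<omega>) = n"
  by (simp_all add: sorted_sample_def)

lemma sum_sorted_sample:
  "(\<Sum>i<n. g (sorted_sample X n \<omega> ! i)) = (\<Sum>i\<in>{1..n}. g (X i \<omega>) :: real)"
proof -
  have "(\<Sum>i<n. g (sorted_sample X n \<omega> ! i)) = sum_list (map g (sorted_sample X n \<omega>))"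
    by (simp add: sum_list_sum_nth sorted_sample_simps atLeast0LessThan)
  also have "\<dots> = sum_mset (image_mset g (mset (sorted_sample X n \<omega>)))"
    by (simp only: mset_map[symmetric] sum_mset_sum_list)
  also have "\<dots> = sum_mset (image_mset g (mset (map (\<lambda>j. X j \<omega>) [1..<n + 1])))"
    by (simp only: sorted_sample_def mset_sort)
  also have "\<dots> = sum_list (map (\<lambda>j. g (X j \<omega>)) [1..<n + 1])"
    by (simp only: mset_map[symmetric] sum_mset_sum_list map_map comp_def)
  also have "\<dots> = (\<Sum>i\<in>{1..n}. g (X i \<omega>))"
    by (simp only: sum_list_distinct_conv_sum_set distinct_upt set_upt)
       (rule sum.cong, auto)
  finally show ?thesis .
qed

lemma list_count_sorted_sample:
  "real (list_count (sorted_sample X n \<omega>) a) = (\<Sum>i\<in>{1..n}. indicator {..a} (X i \<omega>))"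
proof -
  have "real (list_count (sorted_sample X n \<omega>) a) = (\<Sum>i<n. indicator {..a} (sorted_sample X n \<omega> ! i))"
    by (simp add: list_count_def sorted_sample_simps indicator_def sum.If_cases Int_def conj_commute)
  then show ?thesis by (simp add: sum_sorted_sample)
qed

text \<open>The trimmed sum is the sum of the \<open>n - m\<close> smallest observations minus that
  of the \<open>k\<close> smallest. Each of them is its lower bound plus a defect, and the two sums
  of positive parts combine into the Winsorized sum.\<close>

lemma trimmed_sum_eq:
  assumes n: "k n < n - m n" "m n \<le> n" and c: "c1 \<le> c2"
  shows "real n * trimmed_sum X k m n \<omega>
    = (\<Sum>i\<in>{1..n}. max c1 (min (X i \<omega>) c2)) - real (m n) * c2 - real (k n) * c1
      + defect (n - m n) c2 (sorted_sample X n \<omega>) - defect (k n) c1 (sorted_sample X n \<omega>)"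
proof -
  define xs where "xs = sorted_sample X n \<omega>"
  have "real n * trimmed_sum X k m n \<omega> = (\<Sum>i = k n + 1..n - m n. xs ! (i - 1))"
    using n by (simp add: trimmed_sum_def order_stat_def xs_def sorted_sample_def)
  also have "\<dots> = (\<Sum>i\<in>{k n..<n - m n}. xs ! i)"
    by (rule sum.reindex_bij_witness[of _ Suc "\<lambda>i. i - 1"]) auto
  also have "\<dots> = (\<Sum>i<n - m n. xs ! i) - (\<Sum>i<k n. xs ! i)"
    using n sum.union_disjoint[of "{..<k n}" "{k n..<n - m n}" "\<lambda>i. xs ! i"]
    by (simp add: ivl_disj_un_one(2) ivl_disj_int_one)
  also have "\<dots> = (defect (n - m n) c2 xs + real (n - m n) * c2 - (\<Sum>i<n. max 0 (c2 - xs ! i)))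
      - (defect (k n) c1 xs + real (k n) * c1 - (\<Sum>i<n. max 0 (c1 - xs ! i)))"
    by (simp add: defect_def xs_def sorted_sample_simps)
  also have "(\<Sum>i<n. max 0 (c2 - xs ! i)) = (\<Sum>i\<in>{1..n}. max 0 (c2 - X i \<omega>))"
    unfolding xs_def by (rule sum_sorted_sample)
  also have "(\<Sum>i<n. max 0 (c1 - xs ! i)) = (\<Sum>i\<in>{1..n}. max 0 (c1 - X i \<omega>))"
    unfolding xs_def by (rule sum_sorted_sample)
  finally have 1: "real n * trimmed_sum X k m n \<omega> = (defect (n - m n) c2 xs + real (n - m n) * c2 - (\<Sum>i\<in>{1..n}. max 0 (c2 - X i \<omega>)))
      - (defect (k n) c1 xs + real (k n) * c1 - (\<Sum>i\<in>{1..n}. max 0 (c1 - X i \<omega>)))" .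
  \<comment> \<open>Winsorizing is a difference of two positive parts: for
    \<open>c1 \<le> c2\<close>,
    \<open>max c1 (min x c2) = c2 + max 0 (c1 - x) - max 0 (c2 - x)\<close>.\<close>
  have "(\<Sum>i\<in>{1..n}. max c1 (min (X i \<omega>) c2)) = (\<Sum>i\<in>{1..n}. max 0 (c1 - X i \<omega>) - max 0 (c2 - X i \<omega>) + c2)"
    using c by (intro sum.cong) (auto simp: max_def min_def)
  also have "\<dots> = (\<Sum>i\<in>{1..n}. max 0 (c1 - X i \<omega>)) - (\<Sum>i\<in>{1..n}. max 0 (c2 - X i \<omega>)) + real n * c2"
    by (simp add: sum.distrib sum_subtractf)
  finally show ?thesis
    using 1 n by (simp add: xs_def of_nat_diff algebra_simps)
qed

text \<open>The \<open>i\<close>-th smallest observation is at most \<open>a\<close> exactly when at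
  least \<open>i\<close> observations are, and counts are measurable.\<close>

lemma measurable_order_stat:
  assumes X: "\<And>i. i \<in> {1..n} \<Longrightarrow> X i \<in> borel_measurable M" and i: "1 \<le> i" "i \<le> n"
  shows "(\<lambda>\<omega>. order_stat X n i \<omega>) \<in> borel_measurable M"
proof (subst borel_measurable_iff_le, intro allI)
  fix a
  have "order_stat X n i \<omega> \<le> a \<longleftrightarrow> real i \<le> (\<Sum>j\<in>{1..n}. indicator {..a} (X j \<omega>))" for \<omega>
  proof -
    have "order_stat X n i \<omega> \<le> a \<longleftrightarrow> i - 1 < list_count (sorted_sample X n \<omega>) a"
      unfolding order_stat_def sorted_sample_def[symmetric]
      using i by (intro sorted_nth_le_iff) (auto simp: sorted_sample_simps)
    also have "\<dots> \<longleftrightarrow> real i \<le> real (list_count (sorted_sample X n \<omega>) a)" using i by auto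
    finally show ?thesis by (simp only: list_count_sorted_sample)
  qed
  moreover have "(\<lambda>\<omega>. \<Sum>j\<in>{1..n}. indicator {..a} (X j \<omega>) :: real) \<in> borel_measurable M"
    by (intro borel_measurable_sum measurable_compose[OF X borel_measurable_indicator]) auto
  then have "{\<omega> \<in> space M. real i \<le> (\<Sum>j\<in>{1..n}. indicator {..a} (X j \<omega>))} \<in> sets M"
    by measurable
  ultimately show "{\<omega> \<in> space M. order_stat X n i \<omega> \<le> a} \<in> sets M" by simp
qed

lemma measurable_trimmed_sum:
  assumes "\<And>i. i \<in> {1..n} \<Longrightarrow> X i \<in> borel_measurable M"
  shows "(\<lambda>\<omega>. trimmed_sum X k m n \<omega>) \<in> borel_measurable M"
  unfolding trimmed_sum_def
  using assms by (intro borel_measurable_times borel_measurable_const borel_measurable_sum measurable_order_stat) auto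

section \<open>Trimmed sums of a fixed sample size\<close>

lemma quantile_le_iff:
  assumes "real_distribution N" "F = cdf N" "0 < u" "u < 1"
  shows "quantile F u \<le> x \<longleftrightarrow> u \<le> F x"
proof -
  interpret cdf_distribution N using assms(1) by (simp add: cdf_distribution_def)
  show ?thesis using pseudoinverse[of u x] assms by (simp add: quantile_def)
qed

lemma quantile_mono:
  assumes "real_distribution N" "F = cdf N" "0 < u" "u \<le> v" "v < 1"
  shows "quantile F u \<le> quantile F v"
  using assms quantile_le_iff[OF assms(1,2), of u "quantile F v"] quantile_le_iff[OF assms(1,2), of v "quantile F v"]
  by simp

text \<open>Under Lebesgue measure on the open unit interval the quantile function has law
  \<open>N\<close>. This turns the integrals that define the Winsorized mean and variance into
  moments of an observation.\<close>

lemma has_integral_quantile: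
  assumes N: "real_distribution N" "F = cdf N" and g: "g \<in> borel_measurable borel" "integrable N g"
  shows "integrable lborel (\<lambda>u. indicator {0<..<1} u * g (quantile F u))"
    and "(LBINT u. indicator {0<..<1} u * g (quantile F u)) = (LINT x|N. g x :: real)"
proof -
  interpret cdf_distribution N using N(1) by (simp add: cdf_distribution_def)
  note [measurable] = g(1)
  let ?R = "restrict_space lborel {0<..<1::real}"
  have D: "distr ?R borel I = N" by (rule distr_I_eq_M)
  have I_m: "I \<in> borel_measurable ?R"
  proof -
    have "sets ?R = sets (restrict_space borel {0<..<1::real})"
      by (simp only: sets_restrict_space sets_lborel)
    from measurable_cong_sets[OF this refl] show ?thesis using measurable_CI by blast
  qed
  have eq: "indicator {0<..<1} u * g (quantile F u) = indicator {0<..<1} u *\<^sub>R g (I u)" for u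
    using N(2) by (auto simp: quantile_def indicator_def)
  have "integrable (distr ?R borel I) g" using g(2) by (simp only: D)
  then have "integrable ?R (\<lambda>u. g (I u))"
    using I_m by (subst (asm) integrable_distr_eq) auto
  then show "integrable lborel (\<lambda>u. indicator {0<..<1} u * g (quantile F u))"
    unfolding eq by (subst (asm) integrable_restrict_space) auto
  have "(LINT x|N. g x) = (LINT x|distr ?R borel I. g x)" by (simp only: D)
  also have "\<dots> = (LINT u|?R. g (I u))" using I_m by (subst integral_distr) auto
  also have "\<dots> = (LBINT u. indicator {0<..<1} u *\<^sub>R g (I u))"
    by (subst integral_restrict_space) auto
  finally show "(LBINT u. indicator {0<..<1} u * g (quantile F u)) = (LINT x|N. g x :: real)"
    unfolding eq by simp
qed

lemma interval_integral_01: "(LBINT u=0..1. f u) = (LBINT u. indicator {0<..<1} u * f u :: real)"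
proof -
  have "einterval 0 1 = {0<..<1::real}"
    by (auto simp: einterval_iff)
  then show ?thesis by (simp add: interval_lebesgue_integral_def set_lebesgue_integral_def)
qed

text \<open>A single sample size. \<open>F_lower\<close> and \<open>F_upper\<close> say that
  \<open>F\<close> attains the trimming levels exactly: mass \<open>\<alpha>\<close> lies at or
  below \<open>c1\<close> and mass \<open>\<beta>\<close> above \<open>c2\<close>, from which the
  bound on \<open>h\<close> is derived.\<close>

locale trimmed_sample = prob_space M for M :: "'a measure" +
  fixes X :: "nat \<Rightarrow> 'a \<Rightarrow> real" and F :: "real \<Rightarrow> real" and k m :: "nat \<Rightarrow> nat" and n :: nat
  assumes indep_obs: "indep_vars (\<lambda>_. borel) X {1..n}"
    and cdf_eq: "\<And>i. i \<in> {1..n} \<Longrightarrow> cdf (distr M borel (X i)) = F"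
    and trim: "k n < n - m n" "m n \<le> n" and k_ge: "4 \<le> k n" and m_ge: "4 \<le> m n"
    and sd_pos: "0 < wins_sd F k m n"
    and F_lower: "F (quantile F (frac_of k n)) = frac_of k n"
    and F_upper: "F (quantile F (1 - frac_of m n)) = 1 - frac_of m n"
begin

sublocale indep_sample M "{1..n}" X
  by unfold_locales (rule finite_atLeastAtMost, rule indep_obs)

definition "\<alpha> = frac_of k n"
definition "\<beta> = frac_of m n"
definition "c1 = quantile F \<alpha>"
definition "c2 = quantile F (1 - \<beta>)"
definition "\<mu> = wins_mean F k m n"
definition "\<sigma> = wins_sd F k m n"
definition "wins x = max c1 (min x c2)"
definition "h x = (wins x - \<mu>) / (sqrt n * \<sigma>)"
definition "K = 1 / sqrt (k n) + 1 / sqrt (m n)"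

lemma n_pos: "0 < n" using trim by simp

lemma \<alpha>\<beta>: "0 < \<alpha>" "0 < \<beta>" "\<alpha> < 1 - \<beta>" "n * \<alpha> = k n" "n * \<beta> = m n"
proof -
  show "0 < \<alpha>" "0 < \<beta>" "n * \<alpha> = k n" "n * \<beta> = m n"
    using n_pos k_ge m_ge by (auto simp: \<alpha>_def \<beta>_def frac_of_def)
  have "real (k n) < real n - real (m n)" using trim by linarith
  then show "\<alpha> < 1 - \<beta>" using n_pos by (simp add: \<alpha>_def \<beta>_def frac_of_def field_simps)
qed

lemma dist_X: "i \<in> {1..n} \<Longrightarrow> real_distribution (distr M borel (X i))"
  using X_measurable by auto

definition "N = distr M borel (X 1)"

lemma N: "real_distribution N" "F = cdf N" "i \<in> {1..n} \<Longrightarrow> distr M borel (X i) = N"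
proof -
  have 1: "1 \<in> {1..n}" using n_pos by simp
  show "real_distribution N" unfolding N_def by (rule dist_X[OF 1])
  show "F = cdf N" unfolding N_def using cdf_eq[OF 1] by simp
  show "distr M borel (X i) = N" if "i \<in> {1..n}"
    unfolding N_def using dist_X[OF that] dist_X[OF 1] cdf_eq[OF that] cdf_eq[OF 1] by (intro cdf_unique) auto
qed

lemma prob_X_le: "i \<in> {1..n} \<Longrightarrow> prob {\<omega>\<in>space M. X i \<omega> \<in> {..a}} = F a"
proof -
  assume i: "i \<in> {1..n}"
  note [measurable] = X_measurable[OF i]
  have "F a = measure (distr M borel (X i)) {..a}" unfolding cdf_eq[OF i, symmetric] by (simp only: cdf_def2)
  also have "\<dots> = prob (X i -` {..a} \<inter> space M)" by (subst measure_distr) auto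
  also have "X i -` {..a} \<inter> space M = {\<omega>\<in>space M. X i \<omega> \<in> {..a}}" by auto
  finally show ?thesis by simp
qed

lemma prob_X_gt: "i \<in> {1..n} \<Longrightarrow> prob {\<omega>\<in>space M. X i \<omega> \<in> {a<..}} = 1 - F a"
proof -
  assume i: "i \<in> {1..n}"
  note [measurable] = X_measurable[OF i]
  have "{\<omega>\<in>space M. X i \<omega> \<in> {a<..}} = space M - {\<omega>\<in>space M. X i \<omega> \<in> {..a}}" by auto
  also have "prob \<dots> = 1 - prob {\<omega>\<in>space M. X i \<omega> \<in> {..a}}" by (rule prob_compl) measurable
  finally show ?thesis using prob_X_le[OF i] by simp
qed

lemma c1_le_c2: "c1 \<le> c2"
  unfolding c1_def c2_def using \<alpha>\<beta> by (intro quantile_mono[OF N(1,2)]) auto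

lemma wins_measurable[measurable]: "wins \<in> borel_measurable borel"
  unfolding wins_def by measurable

lemma wins_bounds: "c1 \<le> wins x" "wins x \<le> c2"
  using c1_le_c2 by (auto simp: wins_def)

lemma bounded_wins: "i \<in> {1..n} \<Longrightarrow> bounded_rv (\<lambda>\<omega>. wins (X i \<omega>))"
proof (rule bounded_rvI)
  fix \<omega> show "\<bar>wins (X i \<omega>)\<bar> \<le> \<bar>c1\<bar> + \<bar>c2\<bar>"
    using wins_bounds[of "X i \<omega>"] by linarith
qed (rule measurable_compose[OF X_measurable wins_measurable])

lemma integrable_bounded_N:
  assumes "g \<in> borel_measurable borel" "\<And>x. \<bar>g x\<bar> \<le> (B::real)"
  shows "integrable N g"
proof -
  interpret N: real_distribution N by (rule N(1))
  show ?thesis using assms by (intro N.integrable_const_bound[where B=B]) auto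
qed

lemma wins_quantile_eq: "wins_quantile F k m n u = wins (quantile F u)"
  by (simp add: wins_quantile_def wins_def c1_def c2_def \<alpha>_def \<beta>_def)

lemma integral_N_eq: "i \<in> {1..n} \<Longrightarrow> g \<in> borel_measurable borel \<Longrightarrow> (LINT x|N. g x :: real) = expectation (\<lambda>\<omega>. g (X i \<omega>))"
  unfolding N(3)[symmetric] using X_measurable by (subst integral_distr) auto

lemma integrable_wins_N: "integrable N wins"
proof (rule integrable_bounded_N[OF wins_measurable])
  fix x show "\<bar>wins x\<bar> \<le> \<bar>c1\<bar> + \<bar>c2\<bar>" using wins_bounds[of x] by linarith
qed

lemma mean_wins: "i \<in> {1..n} \<Longrightarrow> expectation (\<lambda>\<omega>. wins (X i \<omega>)) = \<mu>"
  using has_integral_quantile(2)[OF N(1,2) wins_measurable integrable_wins_N]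
  by (simp add: \<mu>_def wins_mean_def interval_integral_01 wins_quantile_eq integral_N_eq)

lemma var_wins: "i \<in> {1..n} \<Longrightarrow> expectation (\<lambda>\<omega>. (wins (X i \<omega>) - \<mu>)\<^sup>2) = \<sigma>\<^sup>2"
proof -
  assume i: "i \<in> {1..n}"
  have m: "(\<lambda>x. (wins x - \<mu>)\<^sup>2) \<in> borel_measurable borel" by measurable
  have "integrable N (\<lambda>x. (wins x - \<mu>)\<^sup>2)"
  proof (rule integrable_bounded_N[OF m])
    fix x
    have "\<bar>wins x - \<mu>\<bar> \<le> \<bar>c1\<bar> + \<bar>c2\<bar> + \<bar>\<mu>\<bar>" using wins_bounds[of x] by linarith
    then show "\<bar>(wins x - \<mu>)\<^sup>2\<bar> \<le> (\<bar>c1\<bar> + \<bar>c2\<bar> + \<bar>\<mu>\<bar>)\<^sup>2"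
      using power_mono[of "\<bar>wins x - \<mu>\<bar>" _ 2] by simp
  qed
  from has_integral_quantile(2)[OF N(1,2) m this]
  have "wins_var F k m n = expectation (\<lambda>\<omega>. (wins (X i \<omega>) - \<mu>)\<^sup>2)"
    using integral_N_eq[OF i m]
    by (simp add: \<mu>_def[symmetric] wins_var_def interval_integral_01 wins_quantile_eq)
  moreover have "\<sigma>\<^sup>2 = wins_var F k m n"
    using sd_pos by (simp add: \<sigma>_def wins_sd_def)
  ultimately show ?thesis by simp
qed

text \<open>On the unit interval the Winsorized quantile function is \<open>c1\<close> on a piece of
  length \<open>\<alpha>\<close>, \<open>c2\<close> on one of length \<open>\<beta>\<close>, and the
  quantile function in between.\<close>

lemma trimmed_mean_eq: "trimmed_mean F \<alpha> \<beta> = \<mu> - \<alpha> * c1 - \<beta> * c2"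
proof -
  note q = has_integral_quantile[OF N(1,2) wins_measurable integrable_wins_N]
  have qle: "quantile F u \<le> c1" if "0 < u" "u \<le> \<alpha>" for u
    unfolding c1_def using that \<alpha>\<beta> by (intro quantile_mono[OF N(1,2)]) auto
  have qge: "c2 \<le> quantile F u" if "1 - \<beta> \<le> u" "u < 1" for u
    unfolding c2_def using that \<alpha>\<beta> by (intro quantile_mono[OF N(1,2)]) auto
  have qm: "c1 \<le> quantile F u" "quantile F u \<le> c2" if "\<alpha> < u" "u < 1 - \<beta>" for u
    unfolding c1_def c2_def using that \<alpha>\<beta> by (intro quantile_mono[OF N(1,2)]; simp)+
  have eq: "indicator {\<alpha><..<1 - \<beta>} u * quantile F u
      = indicator {0<..<1} u * wins (quantile F u) - indicator {0<..\<alpha>} u * c1 - indicator {1 - \<beta>..<1} u * c2" for u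
    using \<alpha>\<beta> qle[of u] qge[of u] qm[of u] c1_le_c2 by (auto simp: indicator_def wins_def)
  have int: "integrable lborel (\<lambda>u. indicator {0<..\<alpha>} u * c1)" "integrable lborel (\<lambda>u. indicator {1 - \<beta>..<1} u * c2)"
    using \<alpha>\<beta> by (intro integrable_mult_left integrable_real_indicator; simp)+
  have "trimmed_mean F \<alpha> \<beta> = (LBINT u. indicator {\<alpha><..<1 - \<beta>} u * quantile F u)"
    using \<alpha>\<beta> by (simp add: trimmed_mean_def interval_integral_Ioo set_lebesgue_integral_def)
  also have "\<dots> = (LBINT u. indicator {0<..<1} u * wins (quantile F u))
      - (LBINT u. indicator {0<..\<alpha>} u * c1) - (LBINT u. indicator {1 - \<beta>..<1} u * c2)"
    unfolding eq using q(1) int by simp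
  also have "(LBINT u. indicator {0<..\<alpha>} u * c1) = \<alpha> * c1"
    using \<alpha>\<beta> by simp
  also have "(LBINT u. indicator {1 - \<beta>..<1} u * c2) = \<beta> * c2"
    using \<alpha>\<beta> by simp
  also have "(LBINT u. indicator {0<..<1} u * wins (quantile F u)) = \<mu>"
    by (simp add: \<mu>_def wins_mean_def interval_integral_01 wins_quantile_eq)
  finally show ?thesis .
qed

lemma \<sigma>_pos: "0 < \<sigma>" using sd_pos by (simp add: \<sigma>_def)

text \<open>The event \<open>X 1 \<le> c1\<close>, of probability \<open>\<alpha>\<close>, alone
  contributes \<open>\<alpha> * (c1 - \<mu>)^2\<close> to the variance \<open>\<sigma>^2\<close>;
  for \<open>c2\<close> the event is \<open>X 1 > c2\<close>, of probability
  \<open>\<beta>\<close>.\<close>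

lemma c1_c2_bound: "\<bar>c1 - \<mu>\<bar> \<le> \<sigma> / sqrt \<alpha>" "\<bar>c2 - \<mu>\<bar> \<le> \<sigma> / sqrt \<beta>"
proof -
  have i: "1 \<in> {1..n}" using n_pos by simp
  note [measurable] = X_measurable[OF i]
  have b: "bounded_rv (\<lambda>\<omega>. (wins (X 1 \<omega>) - \<mu>)\<^sup>2)"
    by (intro bounded_rv_power2 bounded_rv_diff bounded_wins[OF i] bounded_rv_const)
  have g: "\<bar>c - \<mu>\<bar> \<le> \<sigma> / sqrt p"
    if p: "prob {\<omega>\<in>space M. P \<omega>} = p" "0 < p" and [measurable]: "Measurable.pred M P"
      and w: "\<And>\<omega>. P \<omega> \<Longrightarrow> wins (X 1 \<omega>) = c" for P c p
  proof -
    have "p * (c - \<mu>)\<^sup>2 = expectation (\<lambda>\<omega>. indicator {\<omega>. P \<omega>} \<omega> * (c - \<mu>)\<^sup>2)"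
      using prob_eq_expectation_indicator[of P] p by simp
    also have "\<dots> \<le> expectation (\<lambda>\<omega>. (wins (X 1 \<omega>) - \<mu>)\<^sup>2)"
    proof (rule expectation_mono_bounded[OF _ b])
      show "bounded_rv (\<lambda>\<omega>. indicator {\<omega>. P \<omega>} \<omega> * (c - \<mu>)\<^sup>2)"
        by (intro bounded_rv_mult bounded_rv_indicator bounded_rv_const) measurable
    qed (auto simp: indicator_def w simp del: One_nat_def)
    also have "\<dots> = \<sigma>\<^sup>2" by (rule var_wins[OF i])
    finally have "(c - \<mu>)\<^sup>2 \<le> \<sigma>\<^sup>2 / p" using p by (simp add: field_simps)
    then have "sqrt ((c - \<mu>)\<^sup>2) \<le> sqrt (\<sigma>\<^sup>2 / p)" by (rule real_sqrt_le_mono)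
    then show ?thesis using \<sigma>_pos by (simp add: real_sqrt_divide)
  qed
  show "\<bar>c1 - \<mu>\<bar> \<le> \<sigma> / sqrt \<alpha>"
  proof (rule g)
    show "prob {\<omega>\<in>space M. X 1 \<omega> \<in> {..c1}} = \<alpha>"
      using prob_X_le[OF i, of c1] F_lower by (simp add: c1_def \<alpha>_def)
    show "Measurable.pred M (\<lambda>\<omega>. X 1 \<omega> \<in> {..c1})" by measurable
  qed (use \<alpha>\<beta> c1_le_c2 in \<open>auto simp: wins_def\<close>)
  show "\<bar>c2 - \<mu>\<bar> \<le> \<sigma> / sqrt \<beta>"
  proof (rule g)
    show "prob {\<omega>\<in>space M. X 1 \<omega> \<in> {c2<..}} = \<beta>"
      using prob_X_gt[OF i, of c2] F_upper by (simp add: c2_def \<beta>_def)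
    show "Measurable.pred M (\<lambda>\<omega>. X 1 \<omega> \<in> {c2<..})" by measurable
  qed (use \<alpha>\<beta> c1_le_c2 in \<open>auto simp: wins_def\<close>)
qed

lemma h_le: "\<bar>h x\<bar> \<le> K"
proof -
  have "\<bar>wins x - \<mu>\<bar> \<le> \<bar>c1 - \<mu>\<bar> + \<bar>c2 - \<mu>\<bar>" using wins_bounds[of x] by linarith
  also have "\<dots> \<le> \<sigma> / sqrt \<alpha> + \<sigma> / sqrt \<beta>" by (intro add_mono c1_c2_bound)
  also have "\<dots> = (sqrt n * \<sigma>) * K"
  proof -
    have "sqrt (k n) = sqrt n * sqrt \<alpha>" "sqrt (m n) = sqrt n * sqrt \<beta>"
      using \<alpha>\<beta> by (simp_all add: real_sqrt_mult[symmetric])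
    then show ?thesis using \<alpha>\<beta> n_pos by (simp add: K_def field_simps)
  qed
  finally show ?thesis using \<sigma>_pos n_pos by (simp add: h_def abs_mult field_simps)
qed

sublocale standardized_sample M "{1..n}" X h K
proof unfold_locales
  show h: "h \<in> borel_measurable borel" unfolding h_def[abs_def] by measurable
  show "indep_vars (\<lambda>_. borel) (\<lambda>i \<omega>. h (X i \<omega>)) {1..n}"
    by (rule indep_vars_compose2[OF indep_obs h])
  show "expectation (\<lambda>\<omega>. h (X i \<omega>)) = 0" if i: "i \<in> {1..n}" for i
    using expectation_diff_bounded[OF bounded_wins[OF i] bounded_rv_const[of \<mu>]] mean_wins[OF i]
    by (simp add: h_def prob_space)
  have "expectation (\<lambda>\<omega>. (h (X i \<omega>))\<^sup>2) = 1 / n" if i: "i \<in> {1..n}" for i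
  proof -
    have "(h (X i \<omega>))\<^sup>2 = (wins (X i \<omega>) - \<mu>)\<^sup>2 / (n * \<sigma>\<^sup>2)" for \<omega>
      by (simp add: h_def power_divide power_mult_distrib)
    then show ?thesis using var_wins[OF i] \<sigma>_pos by simp
  qed
  then show "(\<Sum>i\<in>{1..n}. expectation (\<lambda>\<omega>. (h (X i \<omega>))\<^sup>2)) = 1"
    using n_pos by simp
qed (auto simp: h_le)

section \<open>The standardized trimmed sum and its one-sided normal approximations\<close>

definition "T \<omega> = inverse \<sigma> * sqrt n * (trimmed_sum X k m n \<omega> - trimmed_mean F \<alpha> \<beta>)"

definition "lower_defect \<omega> = defect (k n) c1 (sorted_sample X n \<omega>)"
definition "upper_defect \<omega> = defect (n - m n) c2 (sorted_sample X n \<omega>)"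

text \<open>The centring is exact: by \<open>trimmed_mean_eq\<close> the constants
  \<open>k * c1\<close> and \<open>m * c2\<close> left over by Winsorizing cancel, so that only the
  defects remain.\<close>

lemma T_eq: "T \<omega> = W \<omega> + upper_defect \<omega> / (sqrt n * \<sigma>) - lower_defect \<omega> / (sqrt n * \<sigma>)"
proof -
  have "(sqrt n * \<sigma>) * T \<omega> = n * (trimmed_sum X k m n \<omega> - trimmed_mean F \<alpha> \<beta>)"
  proof -
    have "(sqrt n * \<sigma>) * T \<omega> = (sqrt n * sqrt n) * (\<sigma> * inverse \<sigma>) * (trimmed_sum X k m n \<omega> - trimmed_mean F \<alpha> \<beta>)"
      by (simp only: T_def mult_ac)
    then show ?thesis using \<sigma>_pos by simp
  qed
  also have "\<dots> = n * trimmed_sum X k m n \<omega> - n * \<mu> + k n * c1 + m n * c2"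
    unfolding trimmed_mean_eq \<alpha>\<beta>(4,5)[symmetric] by (simp add: algebra_simps)
  also have "\<dots> = (\<Sum>i\<in>{1..n}. wins (X i \<omega>) - \<mu>) + upper_defect \<omega> - lower_defect \<omega>"
    using trimmed_sum_eq[where k=k and m=m and X=X and \<omega>=\<omega>, OF trim c1_le_c2]
    by (simp add: wins_def lower_defect_def upper_defect_def sum_subtractf)
  also have "(\<Sum>i\<in>{1..n}. wins (X i \<omega>) - \<mu>) = (sqrt n * \<sigma>) * W \<omega>"
    unfolding W_def unfolding h_def sum_distrib_left using \<sigma>_pos n_pos by simp
  finally have e: "(sqrt n * \<sigma>) * T \<omega> = (sqrt n * \<sigma>) * W \<omega> + upper_defect \<omega> - lower_defect \<omega>" .
  define s where "s = sqrt n * \<sigma>"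
  have s: "s \<noteq> 0" using \<sigma>_pos n_pos by (simp add: s_def)
  then have "T \<omega> = (s * W \<omega> + upper_defect \<omega> - lower_defect \<omega>) / s"
    using e[folded s_def] by (simp add: nonzero_eq_divide_eq mult.commute del: One_nat_def)
  also have "\<dots> = W \<omega> + upper_defect \<omega> / s - lower_defect \<omega> / s"
    using s by (simp add: add_divide_distrib diff_divide_distrib)
  finally show ?thesis unfolding s_def .
qed

lemma T_measurable[measurable]: "T \<in> borel_measurable M"
  unfolding T_def[abs_def] using measurable_trimmed_sum[of n X M k m] X_measurable by measurable

lemma list_count_eq: "real (list_count (sorted_sample X n \<omega>) a) = count {..a} \<omega>"
  by (simp only: list_count_sorted_sample count_def)

lemma count_gt: "count {a<..} \<omega> = n - count {..a} \<omega>"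
proof -
  have "count {a<..} \<omega> = (\<Sum>i\<in>{1..n}. 1 - indicator {..a} (X i \<omega>))"
    unfolding count_def by (intro sum.cong) (auto simp: indicator_def)
  also have "\<dots> = n - count {..a} \<omega>"
    unfolding sum_subtractf count_def by simp
  finally show ?thesis .
qed

text \<open>\<open>x\<close> runs down and \<open>y\<close> runs up from the trimming quantile
  \<open>c\<close> at level \<open>p\<close>. One step carries \<open>sqrt r\<close> expected
  observations, about the fluctuation of a count of size \<open>r\<close>; \<open>D\<close> bounds
  its length on the real line.\<close>

definition grids :: "real \<Rightarrow> real \<Rightarrow> real \<Rightarrow> nat \<Rightarrow> (nat \<Rightarrow> real) \<Rightarrow> (nat \<Rightarrow> real) \<Rightarrow> real \<Rightarrow> bool" where
  "grids p c r J x y D \<longleftrightarrow> x 0 = c \<and> y 0 = c \<and> 0 \<le> D \<and> real J \<le> sqrt r \<and>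
     (\<forall>j\<le>J. F (x j) = p - j * (sqrt r / n) \<and> F (y j) = p + j * (sqrt r / n)) \<and>
     (\<forall>j<J. x j - x (Suc j) \<le> D \<and> y (Suc j) - y j \<le> D)"

lemma lower_tail_sets:
  assumes g: "grids \<alpha> c1 (k n) J x y D"
  shows "tail_sets (k n) J (\<lambda>j. {..x j}) (\<lambda>j. {..y j})"
proof -
  have "n * (\<alpha> - j * (sqrt (k n) / n)) = k n - j * sqrt (k n)"
    "n * (\<alpha> + j * (sqrt (k n) / n)) = k n + j * sqrt (k n)" for j :: nat
    using \<alpha>\<beta>(4) n_pos by (simp_all add: algebra_simps)
  then show ?thesis
    using g n_pos k_ge prob_X_le unfolding tail_sets_def grids_def by simp
qed

text \<open>At the upper edge observations are counted from above, so that the target is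
  \<open>m\<close> and not \<open>n - m\<close>; accordingly \<open>x\<close> and \<open>y\<close>
  exchange their roles.\<close>

lemma upper_tail_sets:
  assumes g: "grids (1 - \<beta>) c2 (m n) J x y D"
  shows "tail_sets (m n) J (\<lambda>j. {y j<..}) (\<lambda>j. {x j<..})"
proof -
  have "n * (1 - (1 - \<beta> - j * (sqrt (m n) / n))) = m n + j * sqrt (m n)"
    "n * (1 - (1 - \<beta> + j * (sqrt (m n) / n))) = m n - j * sqrt (m n)" for j :: nat
    using \<alpha>\<beta>(5) n_pos by (simp_all add: algebra_simps)
  then show ?thesis
    using g n_pos m_ge prob_X_gt unfolding tail_sets_def grids_def by simp
qed

lemma lower_defect_le:
  assumes g: "grids \<alpha> c1 (k n) J x y D"
    and good: "count {..x J} \<omega> \<le> k n" "k n \<le> count {..y J} \<omega>"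
  shows "lower_defect \<omega> \<le> D * excess (k n) J (\<lambda>j. {..x j}) (\<lambda>j. {..y j}) \<omega>"
proof -
  have "defect (k n) c1 (sorted_sample X n \<omega>) \<le> D * (\<Sum>j<J.
      max 0 (real (list_count (sorted_sample X n \<omega>) (x j)) - real (k n))
      + max 0 (real (k n) - real (list_count (sorted_sample X n \<omega>) (y j))))"
  proof (rule defect_le[where x=x and y=y])
    show "list_count (sorted_sample X n \<omega>) (x J) \<le> k n" "k n \<le> list_count (sorted_sample X n \<omega>) (y J)"
      using good unfolding list_count_eq[symmetric] by simp_all
  qed (use g trim in \<open>auto simp: grids_def sorted_sample_simps\<close>)
  then show ?thesis unfolding lower_defect_def excess_def list_count_eq .
qed

text \<open>Among \<open>n\<close> observations, an excess over \<open>n - m\<close> of those up to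
  \<open>x j\<close> is a shortfall under \<open>m\<close> of those above \<open>x j\<close>, and
  the reverse holds at \<open>y j\<close>.\<close>

lemma upper_defect_le:
  assumes g: "grids (1 - \<beta>) c2 (m n) J x y D"
    and good: "count {y J<..} \<omega> \<le> m n" "m n \<le> count {x J<..} \<omega>"
  shows "upper_defect \<omega> \<le> D * excess (m n) J (\<lambda>j. {y j<..}) (\<lambda>j. {x j<..}) \<omega>"
proof -
  have r: "real (n - m n) = real n - real (m n)" using trim by simp
  have "defect (n - m n) c2 (sorted_sample X n \<omega>) \<le> D * (\<Sum>j<J.
      max 0 (real (list_count (sorted_sample X n \<omega>) (x j)) - real (n - m n))
      + max 0 (real (n - m n) - real (list_count (sorted_sample X n \<omega>) (y j))))"
  proof (rule defect_le[where x=x and y=y])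
    have "real (list_count (sorted_sample X n \<omega>) (x J)) \<le> real (n - m n)"
      "real (n - m n) \<le> real (list_count (sorted_sample X n \<omega>) (y J))"
      using good unfolding list_count_eq count_gt r by linarith+
    then show "list_count (sorted_sample X n \<omega>) (x J) \<le> n - m n" "n - m n \<le> list_count (sorted_sample X n \<omega>) (y J)"
      by simp_all
  qed (use g trim in \<open>auto simp: grids_def sorted_sample_simps\<close>)
  also have "(\<lambda>j. max 0 (real (list_count (sorted_sample X n \<omega>) (x j)) - real (n - m n))
      + max 0 (real (n - m n) - real (list_count (sorted_sample X n \<omega>) (y j))))
    = (\<lambda>j. max 0 (count {y j<..} \<omega> - m n) + max 0 (m n - count {x j<..} \<omega>))"
    unfolding list_count_eq count_gt r by (auto simp: algebra_simps)
  finally show ?thesis unfolding upper_defect_def excess_def .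
qed

lemma defects_nonneg: "0 \<le> lower_defect \<omega>" "0 \<le> upper_defect \<omega>"
  unfolding lower_defect_def upper_defect_def using trim
  by (intro defect_nonneg; simp add: sorted_sample_simps)+

text \<open>For an upper bound \<open>T \<ge> W - lower_defect / (sqrt n * \<sigma>)\<close> is
  enough. Off two events of probability at most \<open>exp (- J^2 / 8)\<close> each, the grid covers
  all misplaced observations, and the lower defect is replaced by a multiple of the excess.\<close>

lemma prob_T_le:
  assumes g: "grids \<alpha> c1 (k n) J x y D"
  shows "prob {\<omega>\<in>space M. T \<omega> \<le> z} \<le> Phi z + 64 * K
    + 8 * exp 10 * (D / (sqrt n * \<sigma>) * sqrt (k n) + D / (sqrt n * \<sigma>) * K * k n) + 2 * exp (- (real J)\<^sup>2 / 8)"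
proof -
  note t = lower_tail_sets[OF g]
  define c where "c = D / (sqrt n * \<sigma>)"
  have c: "0 \<le> c" using g \<sigma>_pos n_pos by (simp add: c_def grids_def)
  define E where "E = excess (k n) J (\<lambda>j. {..x j}) (\<lambda>j. {..y j})"
  note [measurable] = bounded_rv_measurable[OF excess_facts(1)[OF t, folded E_def]]
    bounded_rv_measurable[OF bounded_count]
  have "{\<omega>\<in>space M. T \<omega> \<le> z} \<subseteq> {\<omega>\<in>space M. W \<omega> - c * E \<omega> \<le> z}
      \<union> ({\<omega>\<in>space M. k n < count {..x J} \<omega>} \<union> {\<omega>\<in>space M. count {..y J} \<omega> < k n})" (is "_ \<subseteq> ?A \<union> (?B \<union> ?C)")
  proof
    fix \<omega> assume \<omega>: "\<omega> \<in> {\<omega>\<in>space M. T \<omega> \<le> z}"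
    show "\<omega> \<in> ?A \<union> (?B \<union> ?C)"
    proof (cases "count {..x J} \<omega> \<le> k n \<and> k n \<le> count {..y J} \<omega>")
      case True
      then have "lower_defect \<omega> \<le> D * E \<omega>" unfolding E_def using lower_defect_le[OF g] by blast
      then have "lower_defect \<omega> / (sqrt n * \<sigma>) \<le> c * E \<omega>"
        using \<sigma>_pos n_pos by (simp add: c_def divide_right_mono)
      moreover have "0 \<le> upper_defect \<omega> / (sqrt n * \<sigma>)" using defects_nonneg \<sigma>_pos by simp
      ultimately show ?thesis using \<omega> T_eq[of \<omega>] by simp
    qed (use \<omega> in auto)
  qed
  then have "prob {\<omega>\<in>space M. T \<omega> \<le> z} \<le> prob (?A \<union> (?B \<union> ?C))"
    by (rule finite_measure_mono) measurable
  also have "\<dots> \<le> prob ?A + (prob ?B + prob ?C)"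
    by (intro order_trans[OF measure_Un_le] add_left_mono measure_Un_le) measurable
  also have "prob ?A \<le> Phi z + (64 * K + 8 * exp 10 * (c * sqrt (k n) + c * K * k n))"
    using excess_berry_esseen(2)[OF t c, of z] unfolding E_def by linarith
  also have "prob ?B \<le> exp (- (real J)\<^sup>2 / 8)" by (rule tail_sets_prob(1)[OF t])
  also have "prob ?C \<le> exp (- (real J)\<^sup>2 / 8)" by (rule tail_sets_prob(2)[OF t])
  finally show ?thesis by (simp add: c_def)
qed

text \<open>The mirror image, from \<open>T \<le> W + upper_defect / (sqrt n * \<sigma>)\<close> and
  the grid at the upper edge.\<close>

lemma prob_T_ge:
  assumes g: "grids (1 - \<beta>) c2 (m n) J x y D"
  shows "Phi z - 64 * K
    - 8 * exp 10 * (D / (sqrt n * \<sigma>) * sqrt (m n) + D / (sqrt n * \<sigma>) * K * m n) - 2 * exp (- (real J)\<^sup>2 / 8)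
    \<le> prob {\<omega>\<in>space M. T \<omega> \<le> z}"
proof -
  note t = upper_tail_sets[OF g]
  define c where "c = D / (sqrt n * \<sigma>)"
  have c: "0 \<le> c" using g \<sigma>_pos n_pos by (simp add: c_def grids_def)
  define E where "E = excess (m n) J (\<lambda>j. {y j<..}) (\<lambda>j. {x j<..})"
  note [measurable] = bounded_rv_measurable[OF excess_facts(1)[OF t, folded E_def]]
    bounded_rv_measurable[OF bounded_count]
  have "{\<omega>\<in>space M. W \<omega> + c * E \<omega> \<le> z} \<subseteq> {\<omega>\<in>space M. T \<omega> \<le> z}
      \<union> ({\<omega>\<in>space M. m n < count {y J<..} \<omega>} \<union> {\<omega>\<in>space M. count {x J<..} \<omega> < m n})" (is "?D \<subseteq> ?A \<union> (?B \<union> ?C)")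
  proof
    fix \<omega> assume \<omega>: "\<omega> \<in> ?D"
    show "\<omega> \<in> ?A \<union> (?B \<union> ?C)"
    proof (cases "count {y J<..} \<omega> \<le> m n \<and> m n \<le> count {x J<..} \<omega>")
      case True
      then have "upper_defect \<omega> \<le> D * E \<omega>" unfolding E_def using upper_defect_le[OF g] by blast
      then have "upper_defect \<omega> / (sqrt n * \<sigma>) \<le> c * E \<omega>"
        using \<sigma>_pos n_pos by (simp add: c_def divide_right_mono)
      moreover have "0 \<le> lower_defect \<omega> / (sqrt n * \<sigma>)" using defects_nonneg \<sigma>_pos by simp
      ultimately show ?thesis using \<omega> T_eq[of \<omega>] by simp
    qed (use \<omega> in auto)
  qed
  then have "prob ?D \<le> prob (?A \<union> (?B \<union> ?C))"
    by (rule finite_measure_mono) measurable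
  also have "\<dots> \<le> prob ?A + (prob ?B + prob ?C)"
    by (intro order_trans[OF measure_Un_le] add_left_mono measure_Un_le) measurable
  also have "prob ?B \<le> exp (- (real J)\<^sup>2 / 8)" by (rule tail_sets_prob(1)[OF t])
  also have "prob ?C \<le> exp (- (real J)\<^sup>2 / 8)" by (rule tail_sets_prob(2)[OF t])
  finally have "prob ?D \<le> prob ?A + (exp (- (real J)\<^sup>2 / 8) + exp (- (real J)\<^sup>2 / 8))" by simp
  moreover have "Phi z - (64 * K + 8 * exp 10 * (c * sqrt (m n) + c * K * m n)) \<le> prob ?D"
    using excess_berry_esseen(1)[OF t c, of z] unfolding E_def by linarith
  ultimately show ?thesis by (simp add: c_def)
qed

lemma trimmed_cdf_eq: "trimmed_cdf M X F k m n z = prob {\<omega>\<in>space M. T \<omega> \<le> z}"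
  unfolding trimmed_cdf_def T_def \<sigma>_def \<alpha>_def \<beta>_def by (rule refl)

end

section \<open>Regularity at the trimming points\<close>

lemma real_lim_fractions:
  assumes a: "\<And>n. 0 \<le> a n \<and> a n \<le> 1"
  shows "ereal (real_liminf a) = liminf (\<lambda>n. ereal (a n))"
    "ereal (real_limsup a) = limsup (\<lambda>n. ereal (a n))"
    "0 \<le> real_liminf a" "real_liminf a \<le> real_limsup a" "real_limsup a \<le> 1"
proof -
  let ?L = "liminf (\<lambda>n. ereal (a n))" and ?S = "limsup (\<lambda>n. ereal (a n))"
  have 1: "0 \<le> ?L" using a by (intro Liminf_bounded always_eventually) simp
  have 2: "?S \<le> 1" using a by (intro Limsup_bounded always_eventually) simp
  have 3: "?L \<le> ?S" by (rule Liminf_le_Limsup) simp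
  from 1 2 3 obtain l s where ls: "?L = ereal l" "?S = ereal s"
    by (cases ?L; cases ?S) auto
  show "ereal (real_liminf a) = ?L" "ereal (real_limsup a) = ?S"
    using ls by (simp_all add: real_liminf_def real_limsup_def)
  show "0 \<le> real_liminf a" "real_liminf a \<le> real_limsup a" "real_limsup a \<le> 1"
    using ls 1 2 3 by (simp_all add: real_liminf_def real_limsup_def)
qed

text \<open>Restates conditions on \<open>1 - frac_of m n\<close> in terms of
  \<open>frac_of m n\<close>, so that one lemma about fractions serves both edges.\<close>

lemma real_lim_one_minus:
  assumes a: "\<And>n. 0 \<le> a n \<and> a n \<le> 1"
  shows "real_liminf (\<lambda>n. 1 - a n) = 1 - real_limsup a" "real_limsup (\<lambda>n. 1 - a n) = 1 - real_liminf a"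
proof -
  note l = real_lim_fractions[OF a]
  have "liminf (\<lambda>n. ereal (1 - a n)) = liminf (\<lambda>n. 1 - ereal (a n))"
    by (simp add: one_ereal_def)
  also have "\<dots> = 1 - limsup (\<lambda>n. ereal (a n))"
    by (intro liminf_ereal_cminus) simp
  also have "\<dots> = ereal (1 - real_limsup a)"
    unfolding l(2)[symmetric] by (simp add: one_ereal_def)
  finally show "real_liminf (\<lambda>n. 1 - a n) = 1 - real_limsup a"
    by (simp add: real_liminf_def)
  have "liminf (\<lambda>n. ereal (a n)) = liminf (\<lambda>n. 1 - ereal (1 - a n))"
    by (simp add: one_ereal_def)
  also have "\<dots> = 1 - limsup (\<lambda>n. ereal (1 - a n))"
    by (intro liminf_ereal_cminus) simp
  also have "\<dots> = ereal (1 - real_limsup (\<lambda>n. 1 - a n))"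
    using real_lim_fractions(2)[of "\<lambda>n. 1 - a n"] a by (simp add: one_ereal_def flip: ereal_minus)
  finally show "real_limsup (\<lambda>n. 1 - a n) = 1 - real_liminf a"
    by (simp add: real_liminf_def)
qed

text \<open>The perturbation is multiplicative because \<open>a n\<close> may come arbitrarily close
  to 0, at any speed: a relative change below 1 keeps it positive. Elsewhere an additive margin
  around the limit points suffices, as \<open>\<bar>a n * s\<bar> \<le> \<delta> n\<close>.\<close>

lemma eventually_scaled_in_open:
  assumes a: "\<And>n. 0 \<le> a n \<and> a n \<le> 1" and pos: "\<forall>\<^sub>F n in sequentially. 0 < a n"
    and U: "open U"
    and U0: "real_liminf a = 0 \<Longrightarrow> real_limsup a = 0 \<Longrightarrow> \<exists>\<epsilon>>0. {0<..<\<epsilon>} \<subseteq> U"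
    and U1: "real_liminf a = 0 \<Longrightarrow> 0 < real_limsup a \<Longrightarrow> {0<..real_limsup a} \<subseteq> U"
    and U2: "0 < real_liminf a \<Longrightarrow> {real_liminf a..real_limsup a} \<subseteq> U"
    and \<delta>: "\<delta> \<longlonglongrightarrow> 0"
  shows "\<forall>\<^sub>F n in sequentially. \<forall>s. \<bar>s\<bar> \<le> \<delta> n \<longrightarrow> a n * (1 + s) \<in> U"
proof -
  note l = real_lim_fractions[OF a]
  define a1 where "a1 = real_liminf a"
  define a2 where "a2 = real_limsup a"
  have a12: "0 \<le> a1" "a1 \<le> a2" using l by (auto simp: a1_def a2_def)
  \<comment> \<open>An interval inside \<open>U\<close> with room above the limit superior that
    either starts at 0 or has room below the limit inferior.\<close>
  obtain lo hi where lh: "{lo<..<hi} \<subseteq> U" "a2 < hi" "lo = 0 \<or> 0 < lo \<and> lo < a1"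
  proof -
    have right: "\<exists>e>0. {x<..<x + e} \<subseteq> U \<and> {x - e<..<x} \<subseteq> U" if "x \<in> U" for x
    proof -
      from openE[OF U that] obtain e where "0 < e" "ball x e \<subseteq> U" by blast
      then show ?thesis by (intro exI[of _ e]) (auto simp: ball_def dist_real_def)
    qed
    consider "a1 = 0" "a2 = 0" | "a1 = 0" "0 < a2" | "0 < a1" using a12 by linarith
    then show ?thesis
    proof cases
      case 1
      with U0 obtain \<epsilon> where "\<epsilon> > 0" "{0<..<\<epsilon>} \<subseteq> U" by (auto simp: a1_def a2_def)
      then show ?thesis using that[of 0 \<epsilon>] 1 by simp
    next
      case 2
      then have s: "{0<..a2} \<subseteq> U" using U1 by (auto simp: a1_def a2_def)
      then have "a2 \<in> U" using 2 by auto
      then obtain e where e: "e > 0" "{a2<..<a2 + e} \<subseteq> U" using right[of a2] by blast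
      have "{0<..<a2 + e} \<subseteq> {0<..a2} \<union> {a2<..<a2 + e}" by auto
      then have "{0<..<a2 + e} \<subseteq> U" using s e by blast
      then show ?thesis using that[of 0 "a2 + e"] e by simp
    next
      case 3
      then have s: "{a1..a2} \<subseteq> U" using U2 by (auto simp: a1_def a2_def)
      then have "a1 \<in> U" "a2 \<in> U" using a12 by auto
      then obtain e e' where e: "e > 0" "{a2<..<a2 + e} \<subseteq> U" "e' > 0" "{a1 - e'<..<a1} \<subseteq> U"
        using right[of a2] right[of a1] by blast
      \<comment> \<open>\<open>a1 / 2\<close> keeps \<open>lo\<close> positive, so that
        \<open>lo = 0\<close> marks the case of an interval starting at 0.\<close>
      define lo where "lo = max (a1 - e') (a1 / 2)"
      have "{lo<..<a2 + e} \<subseteq> {a1 - e'<..<a1} \<union> {a1..a2} \<union> {a2<..<a2 + e}" by (auto simp: lo_def)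
      then have "{lo<..<a2 + e} \<subseteq> U" using s e by blast
      moreover have "0 < lo" "lo < a1" using 3 e by (simp_all add: lo_def)
      ultimately show ?thesis using that[of lo "a2 + e"] e by simp
    qed
  qed
  have "\<forall>\<^sub>F n in sequentially. ereal (a n) < ereal ((a2 + hi) / 2)"
    using lh(2) l(2) by (intro Limsup_lessD) (simp add: a2_def[symmetric] flip: l(2))
  moreover have "\<forall>\<^sub>F n in sequentially. lo = 0 \<or> (lo + a1) / 2 < a n"
  proof (cases "lo = 0")
    case False
    then have "\<forall>\<^sub>F n in sequentially. ereal ((lo + a1) / 2) < ereal (a n)"
      using lh(3) by (intro less_LiminfD) (simp add: a1_def[symmetric] flip: l(1))
    then show ?thesis by eventually_elim simp
  qed simp
  moreover have "\<forall>\<^sub>F n in sequentially. \<delta> n < (hi - a2) / 2"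
    using lh(2) by (intro order_tendstoD(2)[OF \<delta>]) simp
  moreover have "\<forall>\<^sub>F n in sequentially. \<delta> n < 1"
    by (intro order_tendstoD(2)[OF \<delta>]) simp
  moreover have "\<forall>\<^sub>F n in sequentially. lo = 0 \<or> \<delta> n < (a1 - lo) / 2"
  proof (cases "lo = 0")
    case False
    then have "\<forall>\<^sub>F n in sequentially. \<delta> n < (a1 - lo) / 2"
      using lh(3) by (intro order_tendstoD(2)[OF \<delta>]) simp
    then show ?thesis by eventually_elim simp
  qed simp
  ultimately show ?thesis
    using pos
  proof eventually_elim
    case (elim n)
    show ?case
    proof (intro allI impI)
      fix s assume s: "\<bar>s\<bar> \<le> \<delta> n"
      have as: "\<bar>a n * s\<bar> \<le> \<delta> n"
        using mult_mono[of "\<bar>a n\<bar>" 1 "\<bar>s\<bar>" "\<delta> n"] a[of n] s by (simp add: abs_mult)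
      have e: "a n * (1 + s) = a n + a n * s" by (simp add: distrib_left)
      have "a n * (1 + s) < hi" using e as elim by (simp add: field_simps abs_le_iff)
      moreover have "lo < a n * (1 + s)"
      proof (cases "lo = 0")
        case True
        then show ?thesis using elim s by simp
      next
        case False
        then show ?thesis using e as elim by (simp add: field_simps abs_le_iff)
      qed
      ultimately show "a n * (1 + s) \<in> U" using lh(1) by auto
    qed
  qed
qed

text \<open>The part of the smoothness condition that concerns a single open set, so that both edges
  share the lemmas below.\<close>

definition quantile_smooth_on :: "(real \<Rightarrow> real) \<Rightarrow> real set \<Rightarrow> bool" where
  "quantile_smooth_on F U \<longleftrightarrow> open U \<and> U \<subseteq> {0<..<1} \<and> (\<forall>u\<in>U. quantile F differentiable (at u)) \<and>
     (\<forall>x\<in>quantile F ` U. F differentiable (at x) \<and> deriv F x > 0)"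

text \<open>One inequality holds for every distribution function. For the other, \<open>F\<close>
  stays below \<open>u\<close> to the left of the quantile and is continuous there, being
  differentiable.\<close>

lemma F_quantile:
  assumes N: "real_distribution N" "F = cdf N" and U: "quantile_smooth_on F U" "u \<in> U"
  shows "F (quantile F u) = u"
proof (rule antisym)
  have u: "0 < u" "u < 1" using U by (auto simp: quantile_smooth_on_def)
  show "u \<le> F (quantile F u)" using quantile_le_iff[OF N u, of "quantile F u"] by simp
  have "F differentiable (at (quantile F u))" using U by (auto simp: quantile_smooth_on_def)
  then have "isCont F (quantile F u)" by (rule differentiable_imp_continuous_within)
  then have l: "(F \<longlongrightarrow> F (quantile F u)) (at_left (quantile F u))"
    by (auto simp: isCont_def intro: filterlim_at_split[THEN iffD1, THEN conjunct1])
  show "F (quantile F u) \<le> u"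
  proof (rule tendsto_upperbound[OF l])
    have "\<forall>\<^sub>F x in at_left (quantile F u). x < quantile F u"
      by (simp add: eventually_at_filter)
    then show "\<forall>\<^sub>F x in at_left (quantile F u). F x \<le> u"
      by eventually_elim (use quantile_le_iff[OF N u] in \<open>auto simp: not_le[symmetric]\<close>)
  qed simp
qed

text \<open>\<open>F (quantile F v) = v\<close> holds on the open set \<open>U\<close>; as both
  functions are differentiable, the chain rule yields the reciprocal.\<close>

lemma DERIV_quantile:
  assumes N: "real_distribution N" "F = cdf N" and U: "quantile_smooth_on F U" "u \<in> U"
  shows "(quantile F has_real_derivative 1 / deriv F (quantile F u)) (at u)"
proof -
  have F: "F differentiable (at (quantile F u))" "0 < deriv F (quantile F u)"
    and q: "quantile F differentiable (at u)" and oU: "open U"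
    using U by (auto simp: quantile_smooth_on_def)
  obtain D where D: "(quantile F has_real_derivative D) (at u)"
    using q by (auto simp: real_differentiable_def)
  have dF: "(F has_real_derivative deriv F (quantile F u)) (at (quantile F u))"
    using F(1) by (auto simp: real_differentiable_def DERIV_imp_deriv)
  have "((\<lambda>u. F (quantile F u)) has_real_derivative deriv F (quantile F u) * D) (at u)"
    by (rule DERIV_chain2[OF dF D])
  moreover have "\<forall>\<^sub>F v in nhds u. F (quantile F v) = v"
    by (rule eventually_mono[OF eventually_nhds_in_open[OF oU U(2)]]) (rule F_quantile[OF N U(1)])
  ultimately have "((\<lambda>v. v) has_real_derivative deriv F (quantile F u) * D) (at u)"
    by (subst (asm) DERIV_cong_ev[OF refl _ refl])
  from DERIV_unique[OF this DERIV_ident] have "D = 1 / deriv F (quantile F u)"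
    using F(2) by (simp add: field_simps)
  then show ?thesis using D by simp
qed

lemma quantile_step:
  assumes N: "real_distribution N" "F = cdf N" and U: "quantile_smooth_on F U" and ab: "a < b"
    and L: "\<And>v. a \<le> v \<Longrightarrow> v \<le> b \<Longrightarrow> v \<in> U \<and> 1 / deriv F (quantile F v) \<le> L"
  shows "quantile F b - quantile F a \<le> (b - a) * L"
proof -
  have "\<exists>z>a. z < b \<and> quantile F b - quantile F a = (b - a) * (1 / deriv F (quantile F z))"
    using ab L by (intro MVT2 DERIV_quantile[OF N U]) auto
  then obtain z where "a < z" "z < b" "quantile F b - quantile F a = (b - a) * (1 / deriv F (quantile F z))"
    by blast
  then show ?thesis using L[of z] ab by (simp only:) (intro mult_left_mono, auto)
qed

text \<open>The grid points are the quantiles at \<open>p\<close> plus or minus multiples of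
  \<open>d = sqrt r / n\<close>. Since \<open>\<tau> = d * sqrt (ln r)\<close>, they stay in the
  range \<open>3 * \<tau>\<close> in which \<open>osc\<close> controls the reciprocal density. As
  \<open>ln r \<ge> 1\<close>, the oscillation there is at most \<open>c / f\<close>, whence the
  bound \<open>L\<close>.\<close>

lemma edge_grid:
  fixes p c C \<sigma> :: real and r n :: nat
  defines "\<tau> \<equiv> sqrt (real r / real n * ln (real r) / real n)"
  assumes N: "real_distribution N" "F = cdf N" and U: "quantile_smooth_on F U"
    and n: "0 < n" and r: "1 \<le> ln (real r)" "9 * ln (real r) \<le> real r"
    and near: "\<And>t. \<bar>t\<bar> \<le> 3 \<Longrightarrow> p + t * \<tau> \<in> U"
    and osc: "\<And>t. \<bar>t\<bar> \<le> 3 \<Longrightarrow> \<bar>1 / deriv F (quantile F (p + t * \<tau>)) - 1 / deriv F (quantile F p)\<bar>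
        \<le> c * \<bar>1 / (deriv F (quantile F p) * ln (real r))\<bar>"
    and c: "0 < c" and \<sigma>: "0 < \<sigma>"
    and tail: "(real r / real n) powr (3/2) / (\<sigma> * deriv F (quantile F p)) \<le> C"
  obtains J x y D where "x 0 = quantile F p" "y 0 = quantile F p" "0 \<le> D" "real J \<le> sqrt (real r)"
    "\<And>j. j \<le> J \<Longrightarrow> F (x j) = p - real j * (sqrt (real r) / real n)"
    "\<And>j. j \<le> J \<Longrightarrow> F (y j) = p + real j * (sqrt (real r) / real n)"
    "\<And>j. j < J \<Longrightarrow> x j - x (Suc j) \<le> D" "\<And>j. j < J \<Longrightarrow> y (Suc j) - y j \<le> D"
    "exp (- (real J)\<^sup>2 / 8) \<le> 1 / sqrt (real r)" "D / (sqrt (real n) * \<sigma>) \<le> (1 + c) * C / real r"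
proof -
  define f where "f = deriv F (quantile F p)"
  define d where "d = sqrt (real r) / real n"
  \<comment> \<open>With \<open>s = sqrt (ln r) \<ge> 1\<close>, rounding \<open>3 * s\<close> down
    leaves \<open>J \<ge> 2 * s\<close>, so that \<open>exp (- J^2 / 8) \<le> 1 / sqrt r\<close>;
    and \<open>9 * ln r \<le> r\<close> gives \<open>J \<le> sqrt r\<close>.\<close>
  define J where "J = nat \<lfloor>3 * sqrt (ln (real r))\<rfloor>"
  define L where "L = (1 + c) / f"
  have r0: "0 < real r"
  proof (rule ccontr)
    assume "\<not> 0 < real r"
    then have "real r = 0" by simp
    then show False using r(1) by simp
  qed
  have pU: "p \<in> U" using near[of 0] by simp
  then have f: "0 < f" using U by (auto simp: quantile_smooth_on_def f_def)
  have d: "0 < d" using n r0 by (simp add: d_def)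
  have \<tau>: "\<tau> = d * sqrt (ln (real r))"
    unfolding \<tau>_def d_def using n r by (simp add: real_sqrt_mult real_sqrt_divide real_sqrt_mult_self field_simps)
  have sl: "1 \<le> sqrt (ln (real r))" using r by simp
  have J: "real J \<le> 3 * sqrt (ln (real r))" "3 * sqrt (ln (real r)) < real J + 1"
    using sl by (simp_all add: J_def)
  have in_range: "\<exists>t. \<bar>t\<bar> \<le> 3 \<and> v = p + t * \<tau>" if v: "\<bar>v - p\<bar> \<le> real J * d" for v
  proof (intro exI[of _ "(v - p) / \<tau>"] conjI)
    have t0: "0 < \<tau>" using \<tau> d sl by simp
    have "real J * d \<le> 3 * \<tau>" using J(1) d \<tau> mult_right_mono[OF J(1), of d] by simp
    then have "\<bar>v - p\<bar> \<le> 3 * \<tau>" using v by simp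
    then show "\<bar>(v - p) / \<tau>\<bar> \<le> 3" using t0 by (simp add: abs_divide divide_le_eq)
    show "v = p + (v - p) / \<tau> * \<tau>" using t0 by simp
  qed
  have good: "v \<in> U \<and> 1 / deriv F (quantile F v) \<le> L" if v: "\<bar>v - p\<bar> \<le> real J * d" for v
  proof -
    from in_range[OF v] obtain t where t: "\<bar>t\<bar> \<le> 3" "v = p + t * \<tau>" by blast
    have "1 / deriv F (quantile F v) \<le> 1 / f + c * \<bar>1 / (f * ln (real r))\<bar>"
      using osc[OF t(1)] by (simp add: t(2) f_def abs_le_iff)
    also have "\<bar>1 / (f * ln (real r))\<bar> \<le> 1 / f"
      using f r by (simp add: field_simps)
    finally have "1 / deriv F (quantile F v) \<le> 1 / f + c * (1 / f)" using c by simp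
    then show ?thesis using near[OF t(1)] by (simp add: t(2) L_def add_divide_distrib)
  qed
  define x where "x j = quantile F (p - real j * d)" for j :: nat
  define y where "y j = quantile F (p + real j * d)" for j :: nat
  have jd: "real j * d \<le> real J * d" if "j \<le> J" for j using that d by simp
  show ?thesis
  proof (rule that[of x y "d * L" J])
    show "x 0 = quantile F p" "y 0 = quantile F p" by (simp_all add: x_def y_def)
    show "0 \<le> d * L" using d f c by (simp add: L_def)
    have "3 * sqrt (ln (real r)) = sqrt (9 * ln (real r))" by (simp add: real_sqrt_mult)
    also have "\<dots> \<le> sqrt (real r)" using r by simp
    finally show "real J \<le> sqrt (real r)" using J(1) by linarith
    fix j
    show "F (x j) = p - real j * (sqrt (real r) / real n)" if "j \<le> J"
      unfolding x_def d_def[symmetric] using jd[OF that] d good[of "p - real j * d"]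
      by (intro F_quantile[OF N U]) auto
    show "F (y j) = p + real j * (sqrt (real r) / real n)" if "j \<le> J"
      unfolding y_def d_def[symmetric] using jd[OF that] d good[of "p + real j * d"]
      by (intro F_quantile[OF N U]) auto
    have s: "real (Suc j) * d = real j * d + d" by (simp add: distrib_right)
    show "x j - x (Suc j) \<le> d * L" if "j < J"
    proof -
      have "quantile F (p - real j * d) - quantile F (p - real (Suc j) * d)
          \<le> ((p - real j * d) - (p - real (Suc j) * d)) * L"
      proof (rule quantile_step[OF N U])
        fix v assume v: "p - real (Suc j) * d \<le> v" "v \<le> p - real j * d"
        have "0 \<le> real j * d" "real (Suc j) * d \<le> real J * d" using jd[of "Suc j"] that d by simp_all
        with v have "\<bar>v - p\<bar> \<le> real J * d" by (intro abs_leI) linarith+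
        then show "v \<in> U \<and> 1 / deriv F (quantile F v) \<le> L" by (rule good)
      qed (use d s in simp)
      moreover have "(p - real j * d) - (p - real (Suc j) * d) = d" using s by linarith
      ultimately show ?thesis unfolding x_def by simp
    qed
    show "y (Suc j) - y j \<le> d * L" if "j < J"
    proof -
      have "quantile F (p + real (Suc j) * d) - quantile F (p + real j * d)
          \<le> ((p + real (Suc j) * d) - (p + real j * d)) * L"
      proof (rule quantile_step[OF N U])
        fix v assume v: "p + real j * d \<le> v" "v \<le> p + real (Suc j) * d"
        have "0 \<le> real j * d" "real (Suc j) * d \<le> real J * d" using jd[of "Suc j"] that d by simp_all
        with v have "\<bar>v - p\<bar> \<le> real J * d" by (intro abs_leI) linarith+
        then show "v \<in> U \<and> 1 / deriv F (quantile F v) \<le> L" by (rule good)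
      qed (use d s in simp)
      moreover have "(p + real (Suc j) * d) - (p + real j * d) = d" using s by linarith
      ultimately show ?thesis unfolding y_def by simp
    qed
  next
    have "2 * sqrt (ln (real r)) \<le> real J" using J(2) sl by linarith
    then have "(2 * sqrt (ln (real r)))\<^sup>2 \<le> (real J)\<^sup>2" using sl by (intro power_mono) auto
    then have "4 * ln (real r) \<le> (real J)\<^sup>2" using r by (simp add: power_mult_distrib)
    then have "exp (- (real J)\<^sup>2 / 8) \<le> exp (- (ln (real r) / 2))" by simp
    also have "\<dots> = 1 / sqrt (real r)"
      using r0 by (simp add: exp_minus inverse_eq_divide ln_sqrt[symmetric])
    finally show "exp (- (real J)\<^sup>2 / 8) \<le> 1 / sqrt (real r)" .
    have p32: "(real r / real n) powr (3/2) = real r * d / sqrt (real n)"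
    proof -
      have "(real r / real n) powr (3/2) = (real r / real n) powr (1 + 1/2)" by simp
      also have "\<dots> = (real r / real n) * sqrt (real r / real n)"
        using r0 n by (subst powr_add) (simp add: powr_half_sqrt)
      finally show ?thesis by (simp add: d_def real_sqrt_divide)
    qed
    \<comment> \<open>The standardized step is \<open>(1 + c) / r\<close> times the ratio that the
      tail condition bounds.\<close>
    have "d * L / (sqrt (real n) * \<sigma>) = (1 + c) / real r * ((real r / real n) powr (3/2) / (\<sigma> * f))"
      unfolding p32 L_def using r0 \<sigma> f n by (simp add: field_simps)
    also have "\<dots> \<le> (1 + c) / real r * C"
      using tail c r0 by (intro mult_left_mono) (auto simp: f_def)
    finally show "d * L / (sqrt (real n) * \<sigma>) \<le> (1 + c) * C / real r" by simp
  qed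
qed

theorem theorem1p2:
  fixes M :: "'a measure" and X :: "nat \<Rightarrow> 'a \<Rightarrow> real" and F :: "real \<Rightarrow> real"
    and k m :: "nat \<Rightarrow> nat"
  assumes prob: "prob_space M"
    and indep: "prob_space.indep_vars M (\<lambda>_. borel) X {1..}"
    and ident: "\<And>i. 1 \<le> i \<Longrightarrow> cdf (distr M borel (X i)) = F"
    and nondegenerate: "\<not> (\<exists>c. AE \<omega> in M. X 1 \<omega> = c)"
    and trim: "\<And>n. 1 \<le> n \<Longrightarrow> k n < n - m n \<and> m n \<le> n"
    and trim_lim: "filterlim (\<lambda>n. min (k n) (m n)) at_top sequentially"
    and sep: "real_limsup (frac_of k) < real_liminf (\<lambda>n. 1 - frac_of m n)"
    and scale: "liminf (\<lambda>n. ereal (wins_sd F k m n)) > 0"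
    and A1: "condition_A1 F k m"
    and lower_tail: "limsup (\<lambda>n. ereal (frac_of k n powr (3/2)
           / (wins_sd F k m n * deriv F (quantile F (frac_of k n))))) < \<infinity>"
    and upper_tail: "limsup (\<lambda>n. ereal (frac_of m n powr (3/2)
           / (wins_sd F k m n * deriv F (quantile F (1 - frac_of m n))))) < \<infinity>"
    and lower_osc: "\<And>B. 0 < B \<Longrightarrow>
           ereal_bigo (Psi_lower F k (\<lambda>x. 1 / deriv F x) B)
             (\<lambda>n. 1 / (deriv F (quantile F (frac_of k n)) * ln (real (k n))))"
    and upper_osc: "\<And>B. 0 < B \<Longrightarrow>
           ereal_bigo (Psi_upper F m (\<lambda>x. 1 / deriv F x) B)
             (\<lambda>n. 1 / (deriv F (quantile F (1 - frac_of m n)) * ln (real (m n))))"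
  shows "\<exists>C>0. \<forall>\<^sub>F n in sequentially.
           (SUP x. \<bar>trimmed_cdf M X F k m n x - cdf std_normal_distribution x\<bar>)
             \<le> C * (1 / sqrt (real (k n)) + 1 / sqrt (real (m n)))"
proof -
  interpret prob_space M by (rule prob)
  define N where "N = distr M borel (X 1)"
  have X: "X i \<in> borel_measurable M" if "1 \<le> i" for i
    using indep that by (simp add: indep_vars_def2)
  have N: "real_distribution N" "F = cdf N"
  proof -
    show "real_distribution N" unfolding N_def by (rule real_distribution_distr) (simp add: X)
    show "F = cdf N" unfolding N_def by (rule ident[symmetric]) simp
  qed
  have frac: "0 \<le> frac_of k n \<and> frac_of k n \<le> 1" "0 \<le> frac_of m n \<and> frac_of m n \<le> 1" for n
  proof -
    have "n = 0 \<or> 0 < n \<and> k n \<le> n \<and> m n \<le> n" using trim[of n] by linarith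
    then show "0 \<le> frac_of k n \<and> frac_of k n \<le> 1" "0 \<le> frac_of m n \<and> frac_of m n \<le> 1"
      by (auto simp: frac_of_def)
  qed
  have lim: "filterlim (\<lambda>n. real (k n)) at_top sequentially" "filterlim (\<lambda>n. real (m n)) at_top sequentially"
  proof -
    have "filterlim (\<lambda>n. real (min (k n) (m n))) at_top sequentially"
      by (rule filterlim_compose[OF filterlim_real_sequentially trim_lim])
    then show "filterlim (\<lambda>n. real (k n)) at_top sequentially" "filterlim (\<lambda>n. real (m n)) at_top sequentially"
      by (rule filterlim_at_top_mono; simp)+
  qed
  from A1[unfolded condition_A1_def Let_def real_lim_one_minus[OF frac(2)]] obtain Ua Ub where U: "open Ua" "open Ub" "Ua \<subseteq> {0<..<1}" "Ub \<subseteq> {0<..<1}"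
    "\<forall>u \<in> Ua \<union> Ub. quantile F differentiable (at u)"
    "\<forall>x \<in> quantile F ` (Ua \<union> Ub). F differentiable (at x) \<and> deriv F x > 0"
    and a: "real_liminf (frac_of k) = 0 \<and> real_limsup (frac_of k) = 0 \<longrightarrow> (\<exists>\<epsilon>. 0 < \<epsilon> \<and> \<epsilon> < 1 \<and> {0<..<\<epsilon>} \<subseteq> Ua)"
    "real_liminf (frac_of k) = 0 \<and> 0 < real_limsup (frac_of k) \<longrightarrow> {0<..real_limsup (frac_of k)} \<subseteq> Ua"
    "0 < real_liminf (frac_of k) \<and> real_liminf (frac_of k) \<le> real_limsup (frac_of k)
        \<longrightarrow> {real_liminf (frac_of k)..real_limsup (frac_of k)} \<subseteq> Ua"
    and b: "1 - real_limsup (frac_of m) = 1 \<and> 1 - real_liminf (frac_of m) = 1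
        \<longrightarrow> (\<exists>\<epsilon>. 0 < \<epsilon> \<and> \<epsilon> < 1 \<and> {1 - \<epsilon><..<1} \<subseteq> Ub)"
    "1 - real_limsup (frac_of m) < 1 - real_liminf (frac_of m) \<and> 1 - real_liminf (frac_of m) = 1
        \<longrightarrow> {1 - real_limsup (frac_of m)..<1} \<subseteq> Ub"
    "1 - real_limsup (frac_of m) \<le> 1 - real_liminf (frac_of m) \<and> 1 - real_liminf (frac_of m) < 1
        \<longrightarrow> {1 - real_limsup (frac_of m)..1 - real_liminf (frac_of m)} \<subseteq> Ub"
    by (elim exE conjE) (rule that; assumption)
  have Ua: "quantile_smooth_on F Ua" and Ub: "quantile_smooth_on F Ub"
    using U by (auto simp: quantile_smooth_on_def)
  note o = real_lim_fractions(4)[OF frac(1)] real_lim_fractions(4)[OF frac(2)]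
  \<comment> \<open>Relative to the trimming fraction \<open>r / n\<close>, the reach
    \<open>3 * sqrt (ln r)\<close> steps of \<open>sqrt r / n\<close> amounts to
    \<open>3 * sqrt (ln r / r)\<close>, which tends to 0.\<close>
  have ratio: "((\<lambda>x::real. 3 * sqrt (ln x / x)) \<longlongrightarrow> 0) at_top"
    using tendsto_mult_left[OF tendsto_real_sqrt[OF ln_x_over_x_tendsto_0], of 3] by simp
  have large: "\<forall>\<^sub>F x::real in at_top. 4 \<le> x \<and> 1 \<le> ln x \<and> 9 * ln x \<le> x"
  proof -
    have "\<forall>\<^sub>F x::real in at_top. ln x / x < 1 / 9"
      by (rule order_tendstoD(2)[OF ln_x_over_x_tendsto_0]) simp
    moreover have "\<forall>\<^sub>F x::real in at_top. 1 \<le> ln x"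
      using ln_at_top by (auto simp: filterlim_at_top)
    ultimately show ?thesis
      using eventually_ge_at_top[of 4] by eventually_elim (simp add: field_simps)
  qed
  have near_k: "\<forall>\<^sub>F n in sequentially. \<forall>s. \<bar>s\<bar> \<le> 3 * sqrt (ln (real (k n)) / real (k n))
      \<longrightarrow> frac_of k n * (1 + s) \<in> Ua"
  proof (rule eventually_scaled_in_open[OF frac(1)])
    show "\<forall>\<^sub>F n in sequentially. 0 < frac_of k n"
      using eventually_compose_filterlim[OF large lim(1)] eventually_gt_at_top[of 0]
      by eventually_elim (simp add: frac_of_def)
    show "open Ua" using Ua by (simp add: quantile_smooth_on_def)
    show "(\<lambda>n. 3 * sqrt (ln (real (k n)) / real (k n))) \<longlonglongrightarrow> 0"
      by (rule filterlim_compose[OF ratio lim(1)])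
  qed (use a o in auto)
  \<comment> \<open>The upper edge is reflected by \<open>1 - w\<close>, so that
    \<open>frac_of m n\<close> is treated like a lower trimming fraction.\<close>
  have near_m: "\<forall>\<^sub>F n in sequentially. \<forall>s. \<bar>s\<bar> \<le> 3 * sqrt (ln (real (m n)) / real (m n))
      \<longrightarrow> frac_of m n * (1 + s) \<in> (\<lambda>w. 1 - w) -` Ub"
  proof (rule eventually_scaled_in_open[OF frac(2)])
    show "\<forall>\<^sub>F n in sequentially. 0 < frac_of m n"
      using eventually_compose_filterlim[OF large lim(2)] eventually_gt_at_top[of 0]
      by eventually_elim (simp add: frac_of_def)
    show "open ((\<lambda>w. 1 - w) -` Ub)"
      using Ub by (intro open_vimage continuous_intros) (simp add: quantile_smooth_on_def)
    show "(\<lambda>n. 3 * sqrt (ln (real (m n)) / real (m n))) \<longlonglongrightarrow> 0"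
      by (rule filterlim_compose[OF ratio lim(2)])
    show "\<exists>\<epsilon>>0. {0<..<\<epsilon>} \<subseteq> (\<lambda>w. 1 - w) -` Ub" if "real_liminf (frac_of m) = 0" "real_limsup (frac_of m) = 0"
    proof -
      from b(1) that obtain \<epsilon> where \<epsilon>: "0 < \<epsilon>" "{1 - \<epsilon><..<1} \<subseteq> Ub" by auto
      have "1 - w \<in> Ub" if "w \<in> {0<..<\<epsilon>}" for w using that by (intro subsetD[OF \<epsilon>(2)]) simp
      then show ?thesis using \<epsilon>(1) by blast
    qed
    show "{0<..real_limsup (frac_of m)} \<subseteq> (\<lambda>w. 1 - w) -` Ub" if "real_liminf (frac_of m) = 0" "0 < real_limsup (frac_of m)"
      using that by (intro subsetI vimageI2 subsetD[OF b(2)[rule_format]]) auto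
    show "{real_liminf (frac_of m)..real_limsup (frac_of m)} \<subseteq> (\<lambda>w. 1 - w) -` Ub" if "0 < real_liminf (frac_of m)"
      using that o by (intro subsetI vimageI2 subsetD[OF b(3)[rule_format]]) auto
  qed
  have sd: "\<forall>\<^sub>F n in sequentially. 0 < wins_sd F k m n"
    using less_LiminfD[OF scale] by eventually_elim simp
  have bounded_ratio: "\<exists>C\<ge>0. \<forall>\<^sub>F n in sequentially. f n \<le> C" if "limsup (\<lambda>n. ereal (f n)) < \<infinity>" for f :: "nat \<Rightarrow> real"
  proof -
    from that obtain j :: nat where "limsup (\<lambda>n. ereal (f n)) < ereal (real j)"
      using less_PInf_Ex_of_nat by (metis less_irrefl)
    from Limsup_lessD[OF this] have "\<forall>\<^sub>F n in sequentially. f n \<le> real j"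
      by eventually_elim simp
    then show ?thesis by (intro exI[of _ "real j"]) simp
  qed
  obtain C1 where C1: "0 \<le> C1" "\<forall>\<^sub>F n in sequentially. frac_of k n powr (3/2)
           / (wins_sd F k m n * deriv F (quantile F (frac_of k n))) \<le> C1"
    using bounded_ratio[OF lower_tail] by blast
  obtain C2 where C2: "0 \<le> C2" "\<forall>\<^sub>F n in sequentially. frac_of m n powr (3/2)
           / (wins_sd F k m n * deriv F (quantile F (1 - frac_of m n))) \<le> C2"
    using bounded_ratio[OF upper_tail] by blast
  \<comment> \<open>The oscillation condition is used with \<open>B = 3\<close>, the reach of the
    grid.\<close>
  obtain c1 where c1: "0 < c1" "\<forall>\<^sub>F n in sequentially. Psi_lower F k (\<lambda>x. 1 / deriv F x) 3 n
      \<le> ereal (c1 * \<bar>1 / (deriv F (quantile F (frac_of k n)) * ln (real (k n)))\<bar>)"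
    using lower_osc[of 3] by (auto simp: ereal_bigo_def)
  obtain c2 where c2: "0 < c2" "\<forall>\<^sub>F n in sequentially. Psi_upper F m (\<lambda>x. 1 / deriv F x) 3 n
      \<le> ereal (c2 * \<bar>1 / (deriv F (quantile F (1 - frac_of m n)) * ln (real (m n)))\<bar>)"
    using upper_osc[of 3] by (auto simp: ereal_bigo_def)
  define B1 where "B1 = (1 + c1) * C1"
  define B2 where "B2 = (1 + c2) * C2"
  have B: "0 \<le> B1" "0 \<le> B2" using c1 c2 C1 C2 by (auto simp: B1_def B2_def)
  \<comment> \<open>\<open>66 = 64 + 2\<close>, for the Berry-Esseen part and the two events on
    which the grid is too short; \<open>16 = 8 * 2\<close>, since \<open>c * sqrt k\<close> and
    \<open>c * K * k\<close> are each at most \<open>(B1 + B2) * K\<close>.\<close>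
  define C where "C = 66 + 16 * exp 10 * (B1 + B2)"
  have C0: "0 < C" using B by (auto simp: C_def intro!: add_pos_nonneg)
  have "\<forall>\<^sub>F n in sequentially.
           (SUP x. \<bar>trimmed_cdf M X F k m n x - cdf std_normal_distribution x\<bar>)
             \<le> C * (1 / sqrt (real (k n)) + 1 / sqrt (real (m n)))"
    using eventually_gt_at_top[of 0] eventually_compose_filterlim[OF large lim(1)]
      eventually_compose_filterlim[OF large lim(2)] near_k near_m sd C1(2) C2(2) c1(2) c2(2)
  proof eventually_elim
    case (elim n)
    define \<tau>k where "\<tau>k = sqrt (real (k n) / real n * ln (real (k n)) / real n)"
    define \<tau>m where "\<tau>m = sqrt (real (m n) / real n * ln (real (m n)) / real n)"
    \<comment> \<open>The displacement in the oscillation condition, written as the trimming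
      fraction times a relative change.\<close>
    have scale_eq: "sqrt (real r / real n * ln (real r) / real n) = real r / real n * sqrt (ln (real r) / real r)"
      if "4 \<le> real r" "1 \<le> ln (real r)" for r
    proof -
      have "real r / real n * ln (real r) / real n = (real r / real n)\<^sup>2 * (ln (real r) / real r)"
        using that by (simp add: power2_eq_square)
      then have "sqrt (real r / real n * ln (real r) / real n) = sqrt ((real r / real n)\<^sup>2) * sqrt (ln (real r) / real r)"
        by (simp only: real_sqrt_mult)
      also have "sqrt ((real r / real n)\<^sup>2) = real r / real n" by (rule real_sqrt_unique) simp_all
      finally show ?thesis .
    qed
    have near1: "frac_of k n + t * \<tau>k \<in> Ua" if "\<bar>t\<bar> \<le> 3" for t
    proof -
      have "\<bar>t * sqrt (ln (real (k n)) / real (k n))\<bar> \<le> 3 * sqrt (ln (real (k n)) / real (k n))"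
        using that elim by (simp add: abs_mult mult_right_mono)
      with elim have "frac_of k n * (1 + t * sqrt (ln (real (k n)) / real (k n))) \<in> Ua" by blast
      moreover have "\<tau>k = frac_of k n * sqrt (ln (real (k n)) / real (k n))"
        unfolding \<tau>k_def frac_of_def by (rule scale_eq) (use elim in blast)+
      ultimately show ?thesis by (simp only: distrib_left mult_1_right mult.left_commute)
    qed
    have near2: "1 - frac_of m n + t * \<tau>m \<in> Ub" if "\<bar>t\<bar> \<le> 3" for t
    proof -
      \<comment> \<open>The reflection turns \<open>t\<close> into \<open>- t\<close>.\<close>
      have "\<bar>(- t) * sqrt (ln (real (m n)) / real (m n))\<bar> \<le> 3 * sqrt (ln (real (m n)) / real (m n))"
        using that elim by (simp add: abs_mult mult_right_mono)
      with elim have "1 - frac_of m n * (1 + (- t) * sqrt (ln (real (m n)) / real (m n))) \<in> Ub" by blast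
      moreover have "\<tau>m = frac_of m n * sqrt (ln (real (m n)) / real (m n))"
        unfolding \<tau>m_def frac_of_def by (rule scale_eq) (use elim in blast)+
      moreover have "1 - a * (1 + (- t) * s) = 1 - a + t * (a * s)" for a s :: real
        by (simp add: algebra_simps)
      ultimately show ?thesis by (simp only:)
    qed
    have osc1: "\<bar>1 / deriv F (quantile F (frac_of k n + t * \<tau>k)) - 1 / deriv F (quantile F (frac_of k n))\<bar>
        \<le> c1 * \<bar>1 / (deriv F (quantile F (frac_of k n)) * ln (real (k n)))\<bar>" if "\<bar>t\<bar> \<le> 3" for t
    proof -
      have "ereal \<bar>1 / deriv F (quantile F (frac_of k n + t * \<tau>k)) - 1 / deriv F (quantile F (frac_of k n))\<bar>
          \<le> Psi_lower F k (\<lambda>x. 1 / deriv F x) 3 n"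
        unfolding Psi_lower_def \<tau>k_def frac_of_def using that by (intro SUP_upper) simp
      from order_trans[OF this elim(9)] show ?thesis by (simp only: ereal_less_eq)
    qed
    have osc2: "\<bar>1 / deriv F (quantile F (1 - frac_of m n + t * \<tau>m)) - 1 / deriv F (quantile F (1 - frac_of m n))\<bar>
        \<le> c2 * \<bar>1 / (deriv F (quantile F (1 - frac_of m n)) * ln (real (m n)))\<bar>" if "\<bar>t\<bar> \<le> 3" for t
    proof -
      have "ereal \<bar>1 / deriv F (quantile F (1 - frac_of m n + t * \<tau>m)) - 1 / deriv F (quantile F (1 - frac_of m n))\<bar>
          \<le> Psi_upper F m (\<lambda>x. 1 / deriv F x) 3 n"
        unfolding Psi_upper_def \<tau>m_def frac_of_def using that by (intro SUP_upper) simp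
      from order_trans[OF this elim(10)] show ?thesis by (simp only: ereal_less_eq)
    qed
    have n: "1 \<le> n" using elim by simp
    interpret S: trimmed_sample M X F k m n
    proof unfold_locales
      show "indep_vars (\<lambda>_. borel) X {1..n}" by (rule indep_vars_subset[OF indep]) auto
      show "cdf (distr M borel (X i)) = F" if "i \<in> {1..n}" for i using ident that by simp
      show "F (quantile F (frac_of k n)) = frac_of k n"
        using F_quantile[OF N Ua near1[of 0]] by simp
      show "F (quantile F (1 - frac_of m n)) = 1 - frac_of m n"
        using F_quantile[OF N Ub near2[of 0]] by simp
    qed (use trim[OF n] elim in auto)
    define K where "K = 1 / sqrt (real (k n)) + 1 / sqrt (real (m n))"
    have K: "1 / sqrt (real (k n)) \<le> K" "1 / sqrt (real (m n)) \<le> K" "0 \<le> K" by (auto simp: K_def)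
    have term_le: "64 * K + 8 * exp 10 * (v * sqrt (real r) + v * K * real r) + 2 * e \<le> C * K"
      if v: "v \<le> b / real r" and b: "0 \<le> b" "b \<le> B1 + B2" and e: "e \<le> 1 / sqrt (real r)"
        and r: "0 < real r" "1 / sqrt (real r) \<le> K" for v b e r
    proof -
      have "v * sqrt (real r) \<le> b / real r * sqrt (real r)" using v by (intro mult_right_mono) auto
      also have "\<dots> = b * (1 / sqrt (real r))" using r by (simp add: field_simps)
      also have "\<dots> \<le> b * K" using b r by (intro mult_left_mono)
      finally have 1: "v * sqrt (real r) \<le> b * K" .
      have "v * (K * real r) \<le> b / real r * (K * real r)" using v K by (intro mult_right_mono) auto
      also have "\<dots> = b * K" using r by simp
      finally have "v * sqrt (real r) + v * K * real r \<le> 2 * b * K" using 1 by (simp add: mult.assoc)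
      also have "\<dots> \<le> 2 * (B1 + B2) * K" using b K by (intro mult_right_mono) auto
      finally have "8 * exp 10 * (v * sqrt (real r) + v * K * real r) \<le> 8 * exp 10 * (2 * (B1 + B2) * K)"
        by (intro mult_left_mono) auto
      moreover have "C * K = 66 * K + 8 * exp 10 * (2 * (B1 + B2) * K)" by (simp add: C_def algebra_simps)
      ultimately show ?thesis using e r by linarith
    qed
    have upper: "trimmed_cdf M X F k m n z - Phi z \<le> C * K" for z
    proof -
      obtain J x y D where g: "x 0 = quantile F (frac_of k n)" "y 0 = quantile F (frac_of k n)" "0 \<le> D"
        "real J \<le> sqrt (real (k n))"
        "\<And>j. j \<le> J \<Longrightarrow> F (x j) = frac_of k n - real j * (sqrt (real (k n)) / real n)"
        "\<And>j. j \<le> J \<Longrightarrow> F (y j) = frac_of k n + real j * (sqrt (real (k n)) / real n)"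
        "\<And>j. j < J \<Longrightarrow> x j - x (Suc j) \<le> D" "\<And>j. j < J \<Longrightarrow> y (Suc j) - y j \<le> D"
        and e: "exp (- (real J)\<^sup>2 / 8) \<le> 1 / sqrt (real (k n))"
        and d: "D / (sqrt (real n) * wins_sd F k m n) \<le> (1 + c1) * C1 / real (k n)"
        by (rule edge_grid[OF N Ua, of n "k n" "frac_of k n" c1 "wins_sd F k m n" C1])
           (use elim near1 osc1 c1(1) in \<open>auto simp: \<tau>k_def frac_of_def\<close>)
      have "S.grids S.\<alpha> S.c1 (k n) J x y D"
        unfolding S.grids_def S.\<alpha>_def S.c1_def using g by auto
      from S.prob_T_le[OF this, of z] show ?thesis
        using term_le[of "D / (sqrt (real n) * wins_sd F k m n)" B1 "k n" "exp (- (real J)\<^sup>2 / 8)"]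
          d e B K elim unfolding S.trimmed_cdf_eq S.\<sigma>_def S.K_def B1_def[symmetric] K_def[symmetric] by linarith
    qed
    have lower: "Phi z - trimmed_cdf M X F k m n z \<le> C * K" for z
    proof -
      obtain J x y D where g: "x 0 = quantile F (1 - frac_of m n)" "y 0 = quantile F (1 - frac_of m n)" "0 \<le> D"
        "real J \<le> sqrt (real (m n))"
        "\<And>j. j \<le> J \<Longrightarrow> F (x j) = 1 - frac_of m n - real j * (sqrt (real (m n)) / real n)"
        "\<And>j. j \<le> J \<Longrightarrow> F (y j) = 1 - frac_of m n + real j * (sqrt (real (m n)) / real n)"
        "\<And>j. j < J \<Longrightarrow> x j - x (Suc j) \<le> D" "\<And>j. j < J \<Longrightarrow> y (Suc j) - y j \<le> D"
        and e: "exp (- (real J)\<^sup>2 / 8) \<le> 1 / sqrt (real (m n))"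
        and d: "D / (sqrt (real n) * wins_sd F k m n) \<le> (1 + c2) * C2 / real (m n)"
        by (rule edge_grid[OF N Ub, of n "m n" "1 - frac_of m n" c2 "wins_sd F k m n" C2])
           (use elim near2 osc2 c2(1) in \<open>auto simp: \<tau>m_def frac_of_def\<close>)
      have "S.grids (1 - S.\<beta>) S.c2 (m n) J x y D"
        unfolding S.grids_def S.\<beta>_def S.c2_def using g by auto
      from S.prob_T_ge[OF this, of z] show ?thesis
        using term_le[of "D / (sqrt (real n) * wins_sd F k m n)" B2 "m n" "exp (- (real J)\<^sup>2 / 8)"]
          d e B K elim unfolding S.trimmed_cdf_eq S.\<sigma>_def S.K_def B2_def[symmetric] K_def[symmetric] by linarith
    qed
    show ?case
      unfolding K_def[symmetric]
      by (rule cSUP_least) (use upper lower in \<open>auto simp: abs_le_iff\<close>)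
  qed
  with C0 show ?thesis by blast
qed

end
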